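(* Let $\mathcal X=[0,1]^d$ and $M>0$. Let $(\mathcal Q,\mathcal G_n(\cdot))$ be either $\big(\mathcal P^2_{\mathsf{KL}}(M,\mathcal X),\mathcal G_n^{\mathsf R}(\cdot)\big)$ or $\big(\mathcal P^2_{\mathsf{KL},\mathsf B}(M,\mathcal X),\mathcal G_n^{\mathsf S}(\cdot)\big)$. Then the estimator $\hat{\mathsf D}_{\mathcal G_n(M)}(X^n,Y^n)$ is minimax rate-optimal over $\mathcal Q$, with risk of order $n^{-1/2}$: there are constants $0<c\le C<\infty$ depending only on $M,d$ such that $$\sup_{(\mu,\nu)\in\mathcal Q}\mathbb E\Big[\big|\hat{\mathsf D}_{\mathcal G_n(M)}(X^n,Y^n)-\mathsf D_{\mathsf{KL}}(\mu\|\nu)\big|\Big]\le C\,n^{-1/2}\quad\text{for all }n,$$ while for all sufficiently large $n$ $$\inf_{\hat{\mathsf D}}\ \sup_{(\mu,\nu)\in\mathcal Q}\mathbb E\Big[\big|\hat{\mathsf D}(X^n,Y^n)-\mathsf D_{\mathsf{KL}}(\mu\|\nu)\big|\Big]\ge c\,n^{-1/2},$$ the infimum being over all estimators (measurable functions of $(X^n,Y^n)$). Moreover, with $m_n=(\log\log n)\vee1$, the estimator $\hat{\mathsf D}_{\mathcal G_n(m_n)}(X^n,Y^n)$, which does not use $M$, satisfies $$\sup_{(\mu,\nu)\in\mathcal Q}\mathbb E\big[|\hat{\mathsf D}_{\mathcal G_n(m_n)}(X^n,Y^n)-\mathsf D_{\mathsf{KL}}(\mu\|\nu)|\big]=\tilde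 O(n^{-1/2})$$ as $n\to\infty$, where $\tilde O$ hides factors polynomial in $\log n$.
   Context: $\mathsf D_{\mathsf{KL}}(\mu\|\nu)=\mathbb E_\mu[\log\frac{d\mu}{d\nu}]$ if $\mu\ll\nu$ and $\infty$ otherwise. $\mathcal P^2_{\mathsf{KL}}(\mathcal X)$ is the set of pairs of Borel probability measures on $\mathcal X$ with $\mu\ll\nu$ and $\mathsf D_{\mathsf{KL}}(\mu\|\nu)<\infty$; $f_{\mathsf{KL}}=\log\frac{d\mu}{d\nu}$ (pointwise conditions refer to a suitable version). $\mathcal P^2_{\mathsf{KL}}(M,\mathcal X)=\{(\mu,\nu)\in\mathcal P^2_{\mathsf{KL}}(\mathcal X):c^\star_{\mathsf{KB}}(f_{\mathsf{KL}},\mathcal X)\vee\mathsf D_{\mathsf{KL}}(\mu\|\nu)\le M\}$ and $\mathcal P^2_{\mathsf{KL},\mathsf B}(M,\mathcal X)=\{(\mu,\nu)\in\mathcal P^2_{\mathsf{KL}}(\mathcal X):c^\star_{\mathsf{B}}(f_{\mathsf{KL}},\mathcal X)\vee\mathsf D_{\mathsf{KL}}(\mu\|\nu)\le M\}$. Coefficients: $\|\mathcal X\|:=\sup_{x\in\mathcal X}\|x\|_\infty$. For $\tilde f:\mathbb R^d\to\mathbb R$ with a Fourier representation $\tilde f(x)=\int_{\mathbb R^d}e^{i\omega\cdot x}F(d\omega)$, $F$ a complex Borel measure with magnitude $|F|$, let $S_m(\tilde f)=\int_{\mathbb R^d}\|\omega\|_1^m|F|(d\omega)$. For $f:\mathcal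 X\to\mathbb R$: $c^\star_{\mathsf{KB}}(f,\mathcal X)$ is the infimum of $c\ge0$ such that some such $\tilde f$ satisfies $\tilde f|_{\mathcal X}=f$, $\|\mathcal X\|S_2(\tilde f)\le c$, $|\tilde f(0)|\le c$, $\|\nabla\tilde f(0)\|_1\le c$; $c^\star_{\mathsf B}(f,\mathcal X)$ is the infimum of $c\ge 0$ such that some such $\tilde f$ satisfies $\tilde f|_{\mathcal X}=f$, $\|\mathcal X\|S_1(\tilde f)\le c$, $|\tilde f(0)|\le c$. Neural networks: $\mathcal G_k(a_1,a_2,a_3,a_4,\phi)$ is the set of $g(x)=\sum_{i=1}^k\beta_i\phi(w_i\cdot x+b_i)+w_0\cdot x+b_0$ on $\mathbb R^d$ with $\|w_i\|_1\vee|b_i|\le a_1$, $|\beta_i|\le a_2$ ($1\le i\le k$), $|b_0|\le a_3$, $\|w_0\|_1\le a_4$. $\phi_{\mathsf S}(z)=(1+e^{-z})^{-1}$, $\phi_{\mathsf R}(z)=\max\{z,0\}$, $\mathcal G_k^{\mathsf R}(a)=\mathcal G_k(1,2k^{-1}a,a,a,\phi_{\mathsf R})$, $\mathcal G_k^{\mathsf S}(a)=\mathcal G_k(k^{1/2}\log k,2k^{-1}a,a,0,\phi_{\mathsf S})$. Estimator: $\hat{\mathsf D}_{\mathcal G}(X^n,Y^n)=\sup_{g\in\mathcal G}\frac1n\sum_{i=1}^n\big[g(X_i)-(e^{g(Y_i)}-1)\big]$, where $X^n=(X_1,\dots,X_n)$ is i.i.d. from $\mu$ and $Y^n=(Y_1,\dots,Y_n)$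 i.i.d. from $\nu$ (independent samples). *)

theory Defs
  imports "HOL-Probability.Probability"
begin

section \<open>Complex Borel measures and Fourier representations\<close>

definition complex_borel_measure :: "('a::topological_space set \<Rightarrow> complex) \<Rightarrow> bool" where
  "complex_borel_measure F \<longleftrightarrow>
     (\<forall>A::nat \<Rightarrow> 'a set. range A \<subseteq> sets borel \<longrightarrow> disjoint_family A \<longrightarrow>
        (\<lambda>i. F (A i)) sums F (\<Union>i. A i))"

text \<open>The magnitude \<open>|F|\<close>: the total variation, a supremum over countable Borel partitions.\<close>

definition variation :: "('a::topological_space set \<Rightarrow> complex) \<Rightarrow> 'a measure" where
  "variation F = measure_of UNIV (sets borel)
     (\<lambda>A. SUP E \<in> {E :: nat \<Rightarrow> 'a set.
            range E \<subseteq> sets borel \<and> disjoint_family E \<and> (\<Union>i. E i) = A}.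
          (\<Sum>i. ennreal (cmod (F (E i)))))"

text \<open>
  Polar decomposition \<open>F(d\<omega>) = h(\<omega>) |F|(d\<omega>)\<close> with \<open>|h| = 1\<close>. Every complex measure has one, and
  \<open>h\<close> is unique up to \<open>|F|\<close>-null sets; the integral of \<open>g\<close> against \<open>F\<close> is by definition the
  integral of \<open>g h\<close> against \<open>|F|\<close>.
\<close>

definition polar_density ::
  "('a::topological_space set \<Rightarrow> complex) \<Rightarrow> ('a \<Rightarrow> complex) \<Rightarrow> bool" where
  "polar_density F h \<longleftrightarrow>
     integrable (variation F) h \<and> (\<forall>\<omega>. cmod (h \<omega>) = 1) \<and>
     (\<forall>A \<in> sets borel. F A = (LINT \<omega>:A|variation F. h \<omega>))"

definition fourier_representation ::
  "('a::euclidean_space \<Rightarrow> real) \<Rightarrow> ('a set \<Rightarrow> complex) \<Rightarrow> bool" where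
  "fourier_representation f F \<longleftrightarrow> complex_borel_measure F \<and>
     (\<exists>h. polar_density F h \<and>
        (\<forall>x. complex_of_real (f x) =
           (LINT \<omega>|variation F. exp (\<i> * complex_of_real (\<omega> \<bullet> x)) * h \<omega>)))"

section \<open>Spectral coefficients\<close>

definition norm1 :: "real ^ 'd \<Rightarrow> real" where
  "norm1 w = (\<Sum>i\<in>UNIV. \<bar>w $ i\<bar>)"

definition sup_norm_set :: "(real ^ 'd) set \<Rightarrow> ennreal" where
  "sup_norm_set X = (SUP x\<in>X. ennreal (infnorm x))"

text \<open>
  The moment \<open>S\<^sub>m\<close> is a function of the Fourier measure; this measure is uniquely determined by
  the represented function.
\<close>

definition spectral_moment :: "nat \<Rightarrow> ((real ^ 'd) set \<Rightarrow> complex) \<Rightarrow> ennreal" where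
  "spectral_moment m F = (\<integral>\<^sup>+ \<omega>. ennreal (norm1 \<omega> ^ m) \<partial>variation F)"

text \<open>Both coefficients are \<open>\<infinity>\<close> (infimum of the empty set) if there is no admissible extension.\<close>

definition c_KB :: "(real ^ 'd \<Rightarrow> real) \<Rightarrow> (real ^ 'd) set \<Rightarrow> ereal" where
  "c_KB f X = Inf {ereal c | c. 0 \<le> c \<and>
     (\<exists>g F. fourier_representation g F \<and> (\<forall>x\<in>X. g x = f x) \<and>
        sup_norm_set X * spectral_moment 2 F \<le> ennreal c \<and>
        \<bar>g 0\<bar> \<le> c \<and> (\<exists>D. GDERIV g 0 :> D \<and> norm1 D \<le> c))}"

definition c_B :: "(real ^ 'd \<Rightarrow> real) \<Rightarrow> (real ^ 'd) set \<Rightarrow> ereal" where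
  "c_B f X = Inf {ereal c | c. 0 \<le> c \<and>
     (\<exists>g F. fourier_representation g F \<and> (\<forall>x\<in>X. g x = f x) \<and>
        sup_norm_set X * spectral_moment 1 F \<le> ennreal c \<and>
        \<bar>g 0\<bar> \<le> c)}"

section \<open>Kullback--Leibler divergence and the distribution classes\<close>

definition borel_prob_on :: "'a::topological_space set \<Rightarrow> 'a measure \<Rightarrow> bool" where
  "borel_prob_on X \<mu> \<longleftrightarrow> prob_space \<mu> \<and> sets \<mu> = sets (restrict_space borel X)"

text \<open>
  The library constants \<open>entropy_density\<close> and \<open>KL_divergence\<close> take the reference measure first.
  The negative part of \<open>log (d\<mu>/d\<nu>)\<close> is always \<open>\<mu>\<close>-integrable, so non-integrability means that
  its expectation is \<open>\<infinity>\<close>, whereas the library constant is real-valued and would return 0.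
\<close>

definition KL :: "'a measure \<Rightarrow> 'a measure \<Rightarrow> ereal" where
  "KL \<mu> \<nu> =
     (if absolutely_continuous \<nu> \<mu> \<and> integrable \<mu> (entropy_density (exp 1) \<nu> \<mu>)
      then ereal (KL_divergence (exp 1) \<nu> \<mu>) else \<infinity>)"

definition P2_KL :: "'a::topological_space set \<Rightarrow> ('a measure \<times> 'a measure) set" where
  "P2_KL X = {(\<mu>, \<nu>). borel_prob_on X \<mu> \<and> borel_prob_on X \<nu> \<and>
     absolutely_continuous \<nu> \<mu> \<and> KL \<mu> \<nu> < \<infinity>}"

text \<open>
  \<open>f\<close> is a real-valued version of \<open>log (d\<mu>/d\<nu>)\<close>. Stated through \<open>exp\<close> because \<open>ln 0 = 0\<close>
  in the library, whereas here a vanishing density has logarithm \<open>-\<infinity>\<close>, so that a real-valued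
  version forces the density to be \<open>\<nu>\<close>-almost everywhere positive.
\<close>

definition log_density_version ::
  "'a measure \<Rightarrow> 'a measure \<Rightarrow> ('a \<Rightarrow> real) \<Rightarrow> bool" where
  "log_density_version \<mu> \<nu> f \<longleftrightarrow>
     f \<in> borel_measurable \<nu> \<and> (AE x in \<nu>. RN_deriv \<nu> \<mu> x = ennreal (exp (f x)))"

definition P2_KL_KB ::
  "real \<Rightarrow> (real ^ 'd) set \<Rightarrow> ((real ^ 'd) measure \<times> (real ^ 'd) measure) set" where
  "P2_KL_KB M X = {(\<mu>, \<nu>) \<in> P2_KL X.
     \<exists>f. log_density_version \<mu> \<nu> f \<and> max (c_KB f X) (KL \<mu> \<nu>) \<le> ereal M}"

definition P2_KL_B ::
  "real \<Rightarrow> (real ^ 'd) set \<Rightarrow> ((real ^ 'd) measure \<times> (real ^ 'd) measure) set" where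
  "P2_KL_B M X = {(\<mu>, \<nu>) \<in> P2_KL X.
     \<exists>f. log_density_version \<mu> \<nu> f \<and> max (c_B f X) (KL \<mu> \<nu>) \<le> ereal M}"

section \<open>Shallow neural networks\<close>

definition sigmoid :: "real \<Rightarrow> real" where
  "sigmoid z = 1 / (1 + exp (- z))"

definition relu :: "real \<Rightarrow> real" where
  "relu z = max z 0"

definition networks ::
  "nat \<Rightarrow> real \<Rightarrow> real \<Rightarrow> real \<Rightarrow> real \<Rightarrow> (real \<Rightarrow> real) \<Rightarrow> (real ^ 'd \<Rightarrow> real) set" where
  "networks k a1 a2 a3 a4 \<phi> =
     {g. \<exists>\<beta> w b w0 b0.
        g = (\<lambda>x. (\<Sum>i=1..k. \<beta> i * \<phi> (w i \<bullet> x + b i)) + w0 \<bullet> x + b0) \<and>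
        (\<forall>i\<in>{1..k}. max (norm1 (w i)) \<bar>b i\<bar> \<le> a1 \<and> \<bar>\<beta> i\<bar> \<le> a2) \<and>
        \<bar>b0\<bar> \<le> a3 \<and> norm1 w0 \<le> a4}"

definition relu_networks :: "nat \<Rightarrow> real \<Rightarrow> (real ^ 'd \<Rightarrow> real) set" where
  "relu_networks k a = networks k 1 (2 * a / real k) a a relu"

definition sigmoid_networks :: "nat \<Rightarrow> real \<Rightarrow> (real ^ 'd \<Rightarrow> real) set" where
  "sigmoid_networks k a =
     networks k (sqrt (real k) * ln (real k)) (2 * a / real k) a 0 sigmoid"

section \<open>Estimators and their risk\<close>

text \<open>The samples \<open>X\<^sub>1, \<dots>, X\<^sub>n\<close> and \<open>Y\<^sub>1, \<dots>, Y\<^sub>n\<close> are functions on the index set \<open>{1..n}\<close>.\<close>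

definition neural_estimator ::
  "('a \<Rightarrow> real) set \<Rightarrow> nat \<Rightarrow> (nat \<Rightarrow> 'a) \<times> (nat \<Rightarrow> 'a) \<Rightarrow> real" where
  "neural_estimator G n = (\<lambda>(x, y).
     SUP g\<in>G. (1 / real n) * (\<Sum>i=1..n. g (x i) - (exp (g (y i)) - 1)))"

definition sample_space :: "nat \<Rightarrow> 'a measure \<Rightarrow> 'a measure \<Rightarrow> ((nat \<Rightarrow> 'a) \<times> (nat \<Rightarrow> 'a)) measure" where
  "sample_space n \<mu> \<nu> = (\<Pi>\<^sub>M i\<in>{1..n}. \<mu>) \<Otimes>\<^sub>M (\<Pi>\<^sub>M i\<in>{1..n}. \<nu>)"

definition estimators ::
  "nat \<Rightarrow> 'a::topological_space set \<Rightarrow> ((nat \<Rightarrow> 'a) \<times> (nat \<Rightarrow> 'a) \<Rightarrow> real) set" where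
  "estimators n X =
     borel_measurable (sample_space n (restrict_space borel X) (restrict_space borel X))"

text \<open>The divergence is finite on the classes of interest, so \<open>real_of_ereal\<close> is harmless there.\<close>

definition risk ::
  "nat \<Rightarrow> ((nat \<Rightarrow> 'a) \<times> (nat \<Rightarrow> 'a) \<Rightarrow> real) \<Rightarrow> 'a measure \<Rightarrow> 'a measure \<Rightarrow> ennreal" where
  "risk n T \<mu> \<nu> =
     (\<integral>\<^sup>+ s. ennreal \<bar>T s - real_of_ereal (KL \<mu> \<nu>)\<bar> \<partial>sample_space n \<mu> \<nu>)"

definition sup_risk ::
  "nat \<Rightarrow> ((nat \<Rightarrow> 'a) \<times> (nat \<Rightarrow> 'a) \<Rightarrow> real) \<Rightarrow> ('a measure \<times> 'a measure) set \<Rightarrow> ennreal" where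
  "sup_risk n T Q = (SUP (\<mu>, \<nu>)\<in>Q. risk n T \<mu> \<nu>)"

end

theory Submission
  imports Defs "HOL-Real_Asymp.Real_Asymp"
begin

text \<open>
  Upper bound. By the Gibbs inequality every network \<open>g\<close> satisfies
  \<open>\<mu> g - \<nu> (e\<^sup>g - 1) \<le> D\<close>, and the gap is at most a constant times \<open>\<nu> \<bar>f - g\<bar>\<close>; so only an
  approximation in \<open>L\<^sup>1(\<nu>)\<close> is needed. Taylor expansion with integral remainder along each
  frequency writes \<open>f\<close> as a mixture of single neurons, up to a uniform error \<open>O(1 / \<tau>)\<close> in the sigmoid
  case, where \<open>\<tau>\<close> bounds the weights, and Maurey's argument replaces the mixture by \<open>n\<close> neurons at
  cost \<open>n\<^sup>-\<^sup>1\<^sup>/\<^sup>2\<close>.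
  For the fluctuations, symmetrization and contraction remove the exponential. A network is a
  bounded signed combination of monotone functions of linear forms, so by the layer cake formula its
  Rademacher sum is at most a constant times that of half-spaces. This does not depend on the
  growing sigmoid weights. Half-spaces have finite VC dimension, and chaining over dyadic packings
  gives \<open>n\<^sup>-\<^sup>1\<^sup>/\<^sup>2\<close> without a logarithm. The constants depend on the network scale \<open>a\<close>
  like \<open>e\<close> to a multiple of \<open>a\<close>, which is polylogarithmic for \<open>a = log log n\<close>.

  Lower bound. Le Cam's method with measures on two vertices of the cube, whose log-density is a
  constant plus a cosine with nonnegative coefficients, so that the Fourier measure is positive.
\<close>

section \<open>Rademacher averages and finite maxima\<close>


text \<open>The rate has to hold without a logarithm, so no step may pay for the number of
  parameters or for a covering number of the networks. Finite nets do occur, but only to replace the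
  supremum over an uncountable class by a measurable maximum; their cardinality never enters a
  bound. The log-density \<open>f\<close> is controlled only through Fourier moments. Its uniform
  bound comes from the approximation property itself, applied to point masses; together with the
  bound on networks it gives the range on which exp is Lipschitz, hence the exponential dependence
  on the scale. The infima defining the spectral coefficients are not assumed to be attained. An
  extension of slightly larger cost is approximated and the network is scaled back into the class,
  at a price of order n to the -1/2. For the lower bound both hypotheses share \<open>\<nu>\<close>
  and perturb a \<open>\<mu>\<close> different from \<open>\<nu>\<close>. There the divergence has
  nonzero slope, so a perturbation of order n to the -1/2, which n samples cannot reliably detect,
  moves it by the same order; around \<open>\<mu> = \<nu>\<close> it would move only by the
  square.\<close>

definition rad_avg :: "nat set \<Rightarrow> ((nat \<Rightarrow> real) \<Rightarrow> real) \<Rightarrow> real" where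
  "rad_avg I F = (\<Sum>S\<in>Pow I. F (\<lambda>i. if i \<in> S then 1 else - 1)) / 2 ^ card I"

lemma rad_avg_empty [simp]: "rad_avg {} F = F (\<lambda>_. - 1)"
  by (simp add: rad_avg_def)

text \<open>Splitting off one sign drives the inductions over \<open>I\<close>. A sign vector is
  encoded by the set of its positive coordinates, so coordinates outside \<open>I\<close> carry -1
  until the update at \<open>i\<close> overrides them.\<close>

lemma rad_avg_insert:
  assumes "finite I" "i \<notin> I"
  shows "rad_avg (insert i I) F =
    (rad_avg I (\<lambda>e. F (e(i := 1))) + rad_avg I (\<lambda>e. F (e(i := - 1)))) / 2"
proof -
  have "(\<Sum>S\<in>Pow (insert i I). F (\<lambda>j. if j \<in> S then 1 else - 1)) =
      (\<Sum>S\<in>Pow I. F (\<lambda>j. if j \<in> S then 1 else - 1)) +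
      (\<Sum>S\<in>insert i ` Pow I. F (\<lambda>j. if j \<in> S then 1 else - 1))"
    unfolding Pow_insert using assms by (intro sum.union_disjoint) auto
  also have "(\<Sum>S\<in>insert i ` Pow I. F (\<lambda>j. if j \<in> S then 1 else - 1)) =
      (\<Sum>S\<in>Pow I. F (\<lambda>j. if j \<in> insert i S then 1 else - 1))"
    using assms by (subst sum.reindex) (auto intro!: inj_onI simp: o_def)
  also have "\<dots> = (\<Sum>S\<in>Pow I. F ((\<lambda>j. if j \<in> S then 1 else - 1)(i := 1)))"
    by (intro sum.cong refl arg_cong[of _ _ F]) auto
  also have "(\<Sum>S\<in>Pow I. F (\<lambda>j. if j \<in> S then 1 else - 1)) =
      (\<Sum>S\<in>Pow I. F ((\<lambda>j. if j \<in> S then 1 else - 1)(i := - 1)))"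
    using assms by (intro sum.cong refl arg_cong[of _ _ F] ext) auto
  finally have eq: "(\<Sum>S\<in>Pow (insert i I). F (\<lambda>j. if j \<in> S then 1 else - 1)) =
      (\<Sum>S\<in>Pow I. F ((\<lambda>j. if j \<in> S then 1 else - 1)(i := - 1))) +
      (\<Sum>S\<in>Pow I. F ((\<lambda>j. if j \<in> S then 1 else - 1)(i := 1)))" .
  have "(a + b) / 2 ^ Suc k = (b / 2 ^ k + a / 2 ^ k) / 2" for a b :: real and k
    by (simp add: field_simps)
  then show ?thesis
    unfolding rad_avg_def eq card_insert_disjoint[OF assms] by simp
qed

lemma rad_avg_mono:
  assumes "\<And>e. (\<And>i. \<bar>e i\<bar> = 1) \<Longrightarrow> F e \<le> G e"
  shows "rad_avg I F \<le> rad_avg I G"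
  unfolding rad_avg_def by (intro divide_right_mono sum_mono assms) auto

lemma rad_avg_add: "rad_avg I (\<lambda>e. F e + G e) = rad_avg I F + rad_avg I G"
  by (simp add: rad_avg_def sum.distrib add_divide_distrib)

lemma rad_avg_cmult: "rad_avg I (\<lambda>e. c * F e) = c * rad_avg I F"
  by (simp add: rad_avg_def sum_distrib_left)

lemma rad_avg_const [simp]: "finite I \<Longrightarrow> rad_avg I (\<lambda>e. c) = c"
  by (simp add: rad_avg_def card_Pow)

lemma rad_avg_sum: "rad_avg I (\<lambda>e. \<Sum>k\<in>K. F k e) = (\<Sum>k\<in>K. rad_avg I (F k))"
  unfolding rad_avg_def by (subst sum.swap) (simp add: sum_divide_distrib)

text \<open>The linear term is there to cancel when the bounds at \<open>x\<close> and
  \<open>- x\<close> are added; this yields the sub-Gaussian bound on cosh without comparing power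
  series.\<close>

lemma exp_le_add_exp_square: "exp x \<le> x + exp (x\<^sup>2)" for x :: real
proof (cases "x \<ge> 0")
  case True
  show ?thesis
  proof (cases "x \<le> 1")
    case le: True
    then show ?thesis
      using exp_bound[of x] exp_ge_add_one_self[of "x\<^sup>2"] True by linarith
  next
    case False
    then have "x \<le> x\<^sup>2" by (simp add: power2_eq_square)
    then show ?thesis using True by (smt (verit) exp_le_cancel_iff)
  qed
next
  case False
  define y where "y = - x"
  have y: "y > 0" using False by (simp add: y_def)
  \<comment> \<open>The goal \<open>exp (- y) \<le> 1 - y + y\<^sup>2\<close> is multiplied by
    \<open>exp y\<close>; the quadratic Taylor polynomial of \<open>exp y\<close> already suffices,
    since the product has no negative coefficient left.\<close>
  have "1 \<le> (1 + y + y\<^sup>2 / 2) * (1 - y + y\<^sup>2)"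
  proof -
    have "(1 + y + y\<^sup>2 / 2) * (1 - y + y\<^sup>2) = 1 + y ^ 2 / 2 + y ^ 3 / 2 + y ^ 4 / 2"
      by (simp add: field_simps power2_eq_square power3_eq_cube power4_eq_xxxx)
    then show ?thesis using y by simp
  qed
  also have "\<dots> \<le> exp y * (1 - y + y\<^sup>2)"
  proof (intro mult_right_mono exp_lower_Taylor_quadratic)
    have "1 - y + y\<^sup>2 = (1 - y / 2)\<^sup>2 + 3 / 4 * y\<^sup>2" by (simp add: power2_eq_square field_simps)
    then show "0 \<le> 1 - y + y\<^sup>2" by simp
  qed (use y in simp)
  finally have "exp x \<le> 1 + x + x\<^sup>2"
    by (simp add: y_def exp_minus field_simps)
  then show ?thesis using exp_ge_add_one_self[of "x\<^sup>2"] by linarith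
qed

lemma cosh_le_exp_square: "(exp x + exp (- x)) / 2 \<le> exp (x\<^sup>2)" for x :: real
  using exp_le_add_exp_square[of x] exp_le_add_exp_square[of "- x"] by simp

text \<open>The signs are independent, so the exponential moment factors into cosh terms.\<close>

lemma rad_avg_exp_le:
  assumes "finite I"
  shows "rad_avg I (\<lambda>e. exp (\<Sum>i\<in>I. e i * v i)) \<le> exp (\<Sum>i\<in>I. (v i)\<^sup>2)"
  using assms
proof (induction I rule: finite_induct)
  case (insert i I)
  have *: "(\<Sum>j\<in>insert i I. (e(i := s)) j * v j) = s * v i + (\<Sum>j\<in>I. e j * v j)" for e s
  proof -
    have "(\<Sum>j\<in>I. (e(i := s)) j * v j) = (\<Sum>j\<in>I. e j * v j)"
      using insert by (intro sum.cong) auto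
    then show ?thesis using insert by simp
  qed
  have "rad_avg (insert i I) (\<lambda>e. exp (\<Sum>j\<in>insert i I. e j * v j)) =
      (exp (v i) + exp (- v i)) / 2 * rad_avg I (\<lambda>e. exp (\<Sum>j\<in>I. e j * v j))"
    unfolding rad_avg_insert[OF insert(1,2)] *
    by (simp only: exp_add rad_avg_cmult) (simp add: field_simps)
  also have "\<dots> \<le> exp ((v i)\<^sup>2) * exp (\<Sum>i\<in>I. (v i)\<^sup>2)"
    by (intro mult_mono cosh_le_exp_square insert) (auto simp: rad_avg_def intro!: divide_nonneg_nonneg sum_nonneg)
  finally show ?case using insert by (simp add: exp_add)
qed simp

text \<open>Massart's finite class lemma. The factor 2 in \<open>2 * N\<close> comes from the
  absolute value, which doubles the number of linear forms; \<open>N\<close> is a real bound because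
  packing numbers are only estimated.\<close>

lemma rad_avg_Max_le:
  assumes I: "finite I" and K: "finite K" "K \<noteq> {}" and N: "real (card K) \<le> N" and s: "0 < s"
    and v: "\<And>k. k \<in> K \<Longrightarrow> (\<Sum>i\<in>I. (v k i)\<^sup>2) \<le> s"
  shows "rad_avg I (\<lambda>e. Max ((\<lambda>k. \<bar>\<Sum>i\<in>I. e i * v k i\<bar>) ` K)) \<le> 2 * sqrt (s * ln (2 * N))"
proof -
  have "card K \<ge> 1" using K by (simp add: Suc_leI card_gt_0_iff)
  then have N1: "1 \<le> N" using N by linarith
  then have lnN: "0 < ln (2 * N)" by simp
  \<comment> \<open>This \<open>l\<close> minimizes \<open>ln (2 * N) / l + l * s\<close>, which is
    \<open>c / l\<close> for the \<open>c\<close> below.\<close>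
  define l where "l = sqrt (ln (2 * N) / s)"
  have l: "0 < l" using lnN s by (simp add: l_def)
  define c where "c = ln (2 * N) + l\<^sup>2 * s"
  have c: "c = 2 * ln (2 * N)" using lnN s by (simp add: c_def l_def)
  define Z where "Z = (\<lambda>e k. \<Sum>i\<in>I. e i * v k i)"
  have "l * rad_avg I (\<lambda>e. Max ((\<lambda>k. \<bar>Z e k\<bar>) ` K)) =
      rad_avg I (\<lambda>e. l * Max ((\<lambda>k. \<bar>Z e k\<bar>) ` K))"
    by (simp add: rad_avg_cmult)
  also have "\<dots> \<le> rad_avg I (\<lambda>e. (c - 1) + exp (- c) * (\<Sum>k\<in>K. exp (l * Z e k) + exp (l * - Z e k)))"
  proof (rule rad_avg_mono)
    fix e
    have "Max ((\<lambda>k. \<bar>Z e k\<bar>) ` K) \<in> (\<lambda>k. \<bar>Z e k\<bar>) ` K" using K by (intro Max_in) auto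
    then obtain k where k: "k \<in> K" "Max ((\<lambda>k. \<bar>Z e k\<bar>) ` K) = \<bar>Z e k\<bar>" by auto
    \<comment> \<open>A tangent inequality for exp takes the place of Jensen's inequality. With
      \<open>c\<close> as chosen, the averaged exponential contributes at most 1, which leaves
      \<open>c\<close>.\<close>
    have "l * \<bar>Z e k\<bar> \<le> (c - 1) + exp (l * \<bar>Z e k\<bar> - c)"
      using exp_ge_add_one_self[of "l * \<bar>Z e k\<bar> - c"] by linarith
    also have "exp (l * \<bar>Z e k\<bar> - c) = exp (- c) * exp (l * \<bar>Z e k\<bar>)"
      by (simp add: exp_diff exp_minus field_simps)
    also have "\<dots> \<le> exp (- c) * (exp (l * Z e k) + exp (l * - Z e k))"
      by (intro mult_left_mono) (auto simp: abs_if)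
    also have "\<dots> \<le> exp (- c) * (\<Sum>k\<in>K. exp (l * Z e k) + exp (l * - Z e k))"
      using K k by (intro mult_left_mono member_le_sum) (auto intro!: add_nonneg_nonneg)
    finally show "l * Max ((\<lambda>k. \<bar>Z e k\<bar>) ` K) \<le>
        (c - 1) + exp (- c) * (\<Sum>k\<in>K. exp (l * Z e k) + exp (l * - Z e k))"
      using k by simp
  qed
  also have "\<dots> = (c - 1) + exp (- c) *
      (\<Sum>k\<in>K. rad_avg I (\<lambda>e. exp (\<Sum>i\<in>I. e i * (l * v k i))) +
             rad_avg I (\<lambda>e. exp (\<Sum>i\<in>I. e i * (- l * v k i))))"
    using I by (simp add: rad_avg_add rad_avg_cmult rad_avg_sum Z_def sum_distrib_left sum_negf mult_ac)
  also have "\<dots> \<le> (c - 1) + exp (- c) * (\<Sum>k\<in>K. exp (l\<^sup>2 * s) + exp (l\<^sup>2 * s))"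
  proof (intro add_left_mono mult_left_mono sum_mono add_mono)
    fix k assume k: "k \<in> K"
    have "l\<^sup>2 * (\<Sum>i\<in>I. (v k i)\<^sup>2) \<le> l\<^sup>2 * s" using v[OF k] by (intro mult_left_mono) auto
    then have *: "(\<Sum>i\<in>I. (l * v k i)\<^sup>2) \<le> l\<^sup>2 * s"
      by (simp add: power_mult_distrib sum_distrib_left)
    show "rad_avg I (\<lambda>e. exp (\<Sum>i\<in>I. e i * (l * v k i))) \<le> exp (l\<^sup>2 * s)"
      using rad_avg_exp_le[OF I, of "\<lambda>i. l * v k i"] * by (meson exp_le_cancel_iff order_trans)
    show "rad_avg I (\<lambda>e. exp (\<Sum>i\<in>I. e i * (- l * v k i))) \<le> exp (l\<^sup>2 * s)"
      using rad_avg_exp_le[OF I, of "\<lambda>i. - l * v k i"] *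
      by (simp add: order_trans[OF _ exp_le_cancel_iff[THEN iffD2]])
  qed simp
  also have "\<dots> = (c - 1) + exp (- c) * (2 * card K * exp (l\<^sup>2 * s))" by simp
  also have "\<dots> \<le> (c - 1) + exp (- c) * (2 * N * exp (l\<^sup>2 * s))"
    using N by (intro add_left_mono mult_left_mono mult_right_mono) auto
  also have "2 * N * exp (l\<^sup>2 * s) = exp c" using N1 by (simp add: c_def exp_add)
  also have "(c - 1) + exp (- c) * exp c = c" by (simp add: exp_minus)
  finally have "rad_avg I (\<lambda>e. Max ((\<lambda>k. \<bar>Z e k\<bar>) ` K)) \<le> c / l"
    using l by (simp add: field_simps)
  also have "c / l = 2 * sqrt (s * ln (2 * N))"
  proof -
    have "l * sqrt (s * ln (2 * N)) = ln (2 * N)"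
      using s lnN unfolding l_def real_sqrt_mult[symmetric] by (simp add: power2_eq_square[symmetric])
    then show ?thesis using l unfolding c by (simp add: field_simps)
  qed
  finally show ?thesis by (simp add: Z_def)
qed

section \<open>The Sauer-Shelah lemma\<close>

definition shatters :: "'a set set \<Rightarrow> 'a set \<Rightarrow> bool" where
  "shatters F S \<longleftrightarrow> (\<forall>A\<subseteq>S. \<exists>T\<in>F. T \<inter> S = A)"

lemma shattersE:
  assumes "shatters F S" "A \<subseteq> S"
  obtains T where "T \<in> F" "T \<inter> S = A"
  using assms by (auto simp: shatters_def)

text \<open>Pajor's form of the Sauer-Shelah lemma. For a new point \<open>x\<close>, split
  \<open>F\<close> into the members \<open>A\<close> avoiding \<open>x\<close> and the members
  \<open>B\<close> containing it, with \<open>x\<close> removed in \<open>B'\<close>. Then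
  \<open>card F\<close> is the sum of the sizes of \<open>A \<union> B'\<close> and
  \<open>A \<inter> B'\<close>. Whatever the union shatters is shattered by \<open>F\<close>, and
  whatever the intersection shatters stays shattered after adding \<open>x\<close>; the two kinds of
  sets differ in containing \<open>x\<close>.\<close>

lemma card_le_card_shattered:
  assumes "finite J" "F \<subseteq> Pow J"
  shows "card F \<le> card {S. S \<subseteq> J \<and> shatters F S}"
  using assms
proof (induction J arbitrary: F rule: finite_induct)
  case empty
  then have F: "F = {} \<or> F = {{}}" by auto
  have "card F \<le> 1" using F by auto
  moreover have "{S. S \<subseteq> {} \<and> shatters F S} = {{}}" if "F \<noteq> {}" using F that by (auto simp: shatters_def)
  ultimately show ?case by (cases "F = {}") auto
next
  case (insert x J)
  define A where "A = {T\<in>F. x \<notin> T}"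
  define B where "B = {T\<in>F. x \<in> T}"
  define B' where "B' = (\<lambda>T. T - {x}) ` B"
  have finF: "finite F" using insert finite_subset by fastforce
  have AB: "A \<subseteq> Pow J" "B' \<subseteq> Pow J" using insert.prems by (auto simp: A_def B_def B'_def)
  have fin: "finite A" "finite B" "finite B'" using finF by (auto simp: A_def B_def B'_def)
  have "card B' = card B"
    unfolding B'_def by (intro card_image inj_onI) (auto simp: B_def)
  moreover have "F = A \<union> B" "A \<inter> B = {}" by (auto simp: A_def B_def)
  ultimately have "card F = card A + card B'" using fin by (simp add: card_Un_disjoint)
  also have "\<dots> = card (A \<union> B') + card (A \<inter> B')" using card_Un_Int[of A B'] fin by simp
  also have "\<dots> \<le> card {S. S \<subseteq> J \<and> shatters (A \<union> B') S} + card {S. S \<subseteq> J \<and> shatters (A \<inter> B') S}"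
    using AB by (intro add_mono insert.IH) auto
  also have "card {S. S \<subseteq> J \<and> shatters (A \<inter> B') S} =
      card (insert x ` {S. S \<subseteq> J \<and> shatters (A \<inter> B') S})"
    using insert.hyps
    by (intro card_image[symmetric] inj_onI) (metis (no_types, lifting) insert_ident mem_Collect_eq subsetD)
  also have "card {S. S \<subseteq> J \<and> shatters (A \<union> B') S} + \<dots> =
      card ({S. S \<subseteq> J \<and> shatters (A \<union> B') S} \<union> insert x ` {S. S \<subseteq> J \<and> shatters (A \<inter> B') S})"
    using insert.hyps by (intro card_Un_disjoint[symmetric]) auto
  also have "\<dots> \<le> card {S. S \<subseteq> insert x J \<and> shatters F S}"
  proof (intro card_mono)
    show "finite {S. S \<subseteq> insert x J \<and> shatters F S}" using insert.hyps by simp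
    have 1: "shatters F S" if "S \<subseteq> J" "shatters (A \<union> B') S" for S
      unfolding shatters_def
    proof (intro allI impI)
      fix C assume "C \<subseteq> S"
      with that(2) obtain T where T: "T \<in> A \<union> B'" "T \<inter> S = C" by (rule shattersE)
      have "x \<notin> S" using that insert.hyps by auto
      show "\<exists>T\<in>F. T \<inter> S = C"
      proof (cases "T \<in> A")
        case True then show ?thesis using T by (auto simp: A_def)
      next
        case False
        then obtain U where "U \<in> F" "T = U - {x}" using T by (auto simp: B'_def B_def)
        then show ?thesis using T \<open>x \<notin> S\<close> by (intro bexI[of _ U]) auto
      qed
    qed
    have 2: "shatters F (insert x S)" if "S \<subseteq> J" "shatters (A \<inter> B') S" for S
      unfolding shatters_def
    proof (intro allI impI)
      fix C assume C: "C \<subseteq> insert x S"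
      have "x \<notin> S" using that insert.hyps by auto
      have "C - {x} \<subseteq> S" using C by auto
      with that(2) obtain T where "T \<in> A \<inter> B'" and TS: "T \<inter> S = C - {x}" by (rule shattersE)
      then have T: "T \<in> A" "T \<in> B'" "T \<inter> S = C - {x}" by auto
      from T obtain U where U: "U \<in> F" "x \<in> U" "T = U - {x}" by (auto simp: B'_def B_def)
      show "\<exists>T\<in>F. T \<inter> insert x S = C"
      proof (cases "x \<in> C")
        case True
        then have "U \<inter> insert x S = C" using T U \<open>x \<notin> S\<close> by auto
        then show ?thesis using U by blast
      next
        case False
        then have "T \<inter> insert x S = C" using T U \<open>x \<notin> S\<close> by auto
        then show ?thesis using T by (auto simp: A_def)
      qed
    qed
    show "{S. S \<subseteq> J \<and> shatters (A \<union> B') S} \<union> insert x ` {S. S \<subseteq> J \<and> shatters (A \<inter> B') S}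
        \<subseteq> {S. S \<subseteq> insert x J \<and> shatters F S}" using 1 2 by auto
  qed
  finally show ?case .
qed

text \<open>Each small subset arises from one with at most \<open>D - 1\<close> elements by
  inserting a point or nothing, which is one of \<open>card J + 1\<close> choices. Only polynomial
  growth matters later.\<close>

lemma card_small_subsets_le:
  assumes "finite J"
  shows "card {S. S \<subseteq> J \<and> card S \<le> D} \<le> (card J + 1) ^ D"
proof (induction D)
  case 0
  have "{S. S \<subseteq> J \<and> card S \<le> 0} \<subseteq> {{}}" using assms finite_subset by fastforce
  then show ?case using card_mono[of "{{}}" "{S. S \<subseteq> J \<and> card S \<le> 0}"] by simp
next
  case (Suc D)
  define f where "f = (\<lambda>(x, S). case x of None \<Rightarrow> S | Some (y::'a) \<Rightarrow> insert y S)"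
  have fin: "finite {S. S \<subseteq> J \<and> card S \<le> D}" for D using assms by simp
  have "{S. S \<subseteq> J \<and> card S \<le> Suc D} \<subseteq> f ` (insert None (Some ` J) \<times> {S. S \<subseteq> J \<and> card S \<le> D})"
  proof
    fix S assume S: "S \<in> {S. S \<subseteq> J \<and> card S \<le> Suc D}"
    have finS: "finite S" using S assms finite_subset by auto
    show "S \<in> f ` (insert None (Some ` J) \<times> {S. S \<subseteq> J \<and> card S \<le> D})"
    proof (cases "S = {}")
      case True then show ?thesis by (intro image_eqI[of _ _ "(None, {})"]) (auto simp: f_def)
    next
      case False
      then obtain y where y: "y \<in> S" by auto
      then have "card (S - {y}) \<le> D" using S finS by auto
      then show ?thesis using S y
        by (intro image_eqI[of _ _ "(Some y, S - {y})"]) (auto simp: f_def)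
    qed
  qed
  then have "card {S. S \<subseteq> J \<and> card S \<le> Suc D} \<le>
      card (insert None (Some ` J) \<times> {S. S \<subseteq> J \<and> card S \<le> D})"
    using assms fin by (intro surj_card_le) auto
  also have "\<dots> = (card J + 1) * card {S. S \<subseteq> J \<and> card S \<le> D}"
    using assms by (simp add: card_cartesian_product card_image)
  also have "\<dots> \<le> (card J + 1) * (card J + 1) ^ D" using Suc by (intro mult_left_mono) auto
  finally show ?case by simp
qed

text \<open>\<open>T\<close> is kept apart from \<open>F\<close> because the dimension bound is
  known for the full family, while the traces to be counted are those of a separated
  subfamily.\<close>

lemma card_traces_le:
  assumes "finite J" and vc: "\<And>S. S \<subseteq> J \<Longrightarrow> shatters T S \<Longrightarrow> card S \<le> D" and "F \<subseteq> T"
  shows "card ((\<lambda>A. A \<inter> J) ` F) \<le> (card J + 1) ^ D"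
proof -
  have "card ((\<lambda>A. A \<inter> J) ` F) \<le> card {S. S \<subseteq> J \<and> shatters ((\<lambda>A. A \<inter> J) ` F) S}"
    using assms by (intro card_le_card_shattered) auto
  also have "\<dots> \<le> card {S. S \<subseteq> J \<and> card S \<le> D}"
  proof (intro card_mono)
    show "{S. S \<subseteq> J \<and> shatters ((\<lambda>A. A \<inter> J) ` F) S} \<subseteq> {S. S \<subseteq> J \<and> card S \<le> D}"
    proof safe
      fix S assume S: "S \<subseteq> J" "shatters ((\<lambda>A. A \<inter> J) ` F) S"
      have "shatters T S" unfolding shatters_def
      proof (intro allI impI)
        fix A assume "A \<subseteq> S"
        with S(2) obtain C where "C \<in> (\<lambda>A. A \<inter> J) ` F" "C \<inter> S = A" by (rule shattersE)
        then obtain B where "B \<in> F" "B \<inter> J \<inter> S = A" by auto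
        then have "B \<in> T" "B \<inter> S = A" using S \<open>F \<subseteq> T\<close> by auto
        then show "\<exists>B\<in>T. B \<inter> S = A" by blast
      qed
      then show "card S \<le> D" using vc S by auto
    qed
  qed (use assms in simp)
  also have "\<dots> \<le> (card J + 1) ^ D" by (rule card_small_subsets_le[OF assms(1)])
  finally show ?thesis .
qed

section \<open>Chaining for families of finite VC dimension\<close>


text \<open>
  Haussler's packing argument: some tuple of about \<open>2 ln (card F) / d\<close> points hits every symmetric
  difference, because the failing tuples are too few; on it the members of \<open>F\<close> have distinct traces.
\<close>

lemma card_separated_le:
  fixes d :: real
  assumes I: "finite I" "I \<noteq> {}" and F: "F \<subseteq> T" "F \<subseteq> Pow I"
    and vc: "\<And>S. S \<subseteq> I \<Longrightarrow> shatters T S \<Longrightarrow> card S \<le> D"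
    and d: "0 < d" "d \<le> 1"
    and sep: "\<And>A B. A \<in> F \<Longrightarrow> B \<in> F \<Longrightarrow> A \<noteq> B \<Longrightarrow> d * card I \<le> card ((A - B) \<union> (B - A))"
  shows "real (card F) \<le> ((4 * real D + 5) / d) ^ (2 * D)"
proof (cases "card F \<le> 1")
  case True
  have "1 \<le> (4 * real D + 5) / d" using d by (simp add: field_simps)
  then have "1 \<le> ((4 * real D + 5) / d) ^ (2 * D)" by (rule one_le_power)
  then show ?thesis using True by linarith
next
  case False
  define n where "n = card I"
  define N where "N = card F"
  have n: "n \<ge> 1" using I by (simp add: n_def Suc_leI card_gt_0_iff)
  have N: "N \<ge> 2" using False by (simp add: N_def)
  have finF: "finite F" using F(2) I finite_subset by auto
  \<comment> \<open>A random point misses a given symmetric difference with probability at most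
    \<open>1 - d\<close>, so \<open>m\<close> points all miss it with probability below
    \<open>1 / N\<^sup>2\<close>. There are at most \<open>N\<^sup>2\<close> pairs, so some tuple of
    \<open>m\<close> points misses none; \<open>U\<close> collects the bad tuples.\<close>
  define m where "m = nat \<lceil>2 * ln N / d\<rceil> + 1"
  have m1: "2 * ln N / d < m" unfolding m_def by linarith
  have m2: "m \<le> 2 * ln N / d + 2"
  proof -
    have "0 \<le> 2 * ln N / d" using N d by simp
    then show ?thesis unfolding m_def by linarith
  qed
  define P where "P = {(A, B) \<in> F \<times> F. A \<noteq> B}"
  define U where "U = (\<Union>(A, B)\<in>P. PiE {..<m} (\<lambda>_. I - ((A - B) \<union> (B - A))))"
  have finP: "finite P" unfolding P_def by (rule finite_subset[of _ "F \<times> F"]) (use finF in auto)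
  have "card U \<le> (\<Sum>(A, B)\<in>P. card (PiE {..<m} (\<lambda>_. I - ((A - B) \<union> (B - A)))))"
    unfolding U_def using card_UN_le[OF finP] by (simp add: case_prod_beta)
  also have "\<dots> = (\<Sum>(A, B)\<in>P. card (I - ((A - B) \<union> (B - A))) ^ m)"
    by (simp add: card_PiE)
  finally have "real (card U) \<le> (\<Sum>(A, B)\<in>P. real (card (I - ((A - B) \<union> (B - A)))) ^ m)"
    by (simp add: case_prod_beta flip: of_nat_power of_nat_sum)
  also have "\<dots> \<le> (\<Sum>(A, B)\<in>P. ((1 - d) * n) ^ m)"
  proof (intro sum_mono, clarify)
    fix A B assume AB: "(A, B) \<in> P"
    then have *: "(A - B) \<union> (B - A) \<subseteq> I" using F by (auto simp: P_def)
    have "d * n \<le> card ((A - B) \<union> (B - A))" using AB sep by (auto simp: P_def n_def)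
    moreover have "card (I - ((A - B) \<union> (B - A))) = n - card ((A - B) \<union> (B - A))"
      using * I unfolding n_def by (intro card_Diff_subset) (auto intro: finite_subset)
    moreover have "card ((A - B) \<union> (B - A)) \<le> n" using * I by (auto simp: n_def intro: card_mono)
    ultimately show "real (card (I - ((A - B) \<union> (B - A)))) ^ m \<le> ((1 - d) * n) ^ m"
      by (intro power_mono) (auto simp: algebra_simps of_nat_diff)
  qed
  also have "\<dots> = card P * ((1 - d) * n) ^ m" by simp
  also have "\<dots> \<le> real (N ^ 2) * ((1 - d) * n) ^ m"
  proof (intro mult_right_mono)
    have "card P \<le> card (F \<times> F)" unfolding P_def using finF by (intro card_mono) auto
    then show "real (card P) \<le> real (N\<^sup>2)"
      unfolding of_nat_le_iff by (simp add: N_def card_cartesian_product power2_eq_square)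
  qed (use d in auto)
  also have "\<dots> = (real N ^ 2 * (1 - d) ^ m) * real n ^ m" by (simp add: power_mult_distrib)
  also have "\<dots> < 1 * real n ^ m"
  proof (intro mult_strict_right_mono)
    have "(1 - d) ^ m \<le> exp (- d) ^ m"
      using d exp_ge_add_one_self[of "- d"] by (intro power_mono) auto
    also have "\<dots> = exp (- (d * m))" by (simp add: exp_of_nat_mult[symmetric] mult_ac)
    also have "\<dots> < exp (- (2 * ln N))" using m1 d by (simp add: field_simps)
    also have "\<dots> = 1 / real N ^ 2"
      using N by (simp add: exp_minus exp_of_nat_mult[of 2, simplified] field_simps)
    finally show "real N ^ 2 * (1 - d) ^ m < 1" using N by (simp add: field_simps)
  qed (use n in simp)
  also have "1 * real n ^ m = real (card (PiE {..<m} (\<lambda>_. I)))" by (simp add: card_PiE n_def)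
  finally have "card U < card (PiE {..<m} (\<lambda>_. I))" by simp
  moreover have "finite U" unfolding U_def using finP I by (auto intro!: finite_PiE)
  ultimately have "\<not> PiE {..<m} (\<lambda>_. I) \<subseteq> U" by (meson card_mono leD)
  then obtain t where t: "t \<in> PiE {..<m} (\<lambda>_. I)" "t \<notin> U" by auto
  define J where "J = t ` {..<m}"
  have J: "J \<subseteq> I" "finite J" "card J \<le> m"
    using t card_image_le[of "{..<m}" t] by (auto simp: J_def PiE_iff)
  have "inj_on (\<lambda>A. A \<inter> J) F"
  proof (intro inj_onI, rule ccontr)
    fix A B assume AB: "A \<in> F" "B \<in> F" "A \<inter> J = B \<inter> J" "A \<noteq> B"
    then have "(A, B) \<in> P" by (simp add: P_def)
    then have "t \<notin> PiE {..<m} (\<lambda>_. I - ((A - B) \<union> (B - A)))" using t by (auto simp: U_def)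
    then obtain k where "k < m" "t k \<in> (A - B) \<union> (B - A)" using t by (auto simp: PiE_iff)
    then show False using AB(3) by (auto simp: J_def)
  qed
  then have "N = card ((\<lambda>A. A \<inter> J) ` F)" by (simp add: N_def card_image)
  also have "\<dots> \<le> (card J + 1) ^ D"
    using J F by (intro card_traces_le[of _ T] vc) auto
  also have "\<dots> \<le> (m + 1) ^ D" using J by (intro power_mono) auto
  finally have N_le: "N \<le> (m + 1) ^ D" .
  \<comment> \<open>For \<open>D = 0\<close> the trace bound would read \<open>N \<le> 1\<close>,
    against \<open>N \<ge> 2\<close>.\<close>
  have D: "D \<ge> 1"
  proof (rule ccontr)
    assume "\<not> D \<ge> 1"
    then have "D = 0" by simp
    with N_le N show False by simp
  qed
  \<comment> \<open>The trace bound is implicit: \<open>m\<close> is logarithmic in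
    \<open>N\<close>. Since \<open>ln N \<le> 2 * D * r\<close> and \<open>N = r ^ (2 * D)\<close>,
    half of the power can be divided away; this is why the exponent is \<open>2 * D\<close> and not
    \<open>D\<close>.\<close>
  define r where "r = real N powr (1 / (2 * D))"
  have r: "r \<ge> 1" using N by (simp add: r_def ge_one_powr_ge_zero)
  have rN: "r ^ (2 * D) = N"
  proof -
    have "r ^ (2 * D) = r powr real (2 * D)" using r by (subst powr_realpow) auto
    also have "\<dots> = real N powr 1" unfolding r_def powr_powr using D by simp
    finally show ?thesis using N by simp
  qed
  have "ln N = 2 * D * ln r" using N D by (simp add: r_def ln_powr)
  also have "\<dots> \<le> 2 * D * r" using r ln_le_minus_one[of r] by (intro mult_left_mono) auto
  finally have "2 * ln N / d \<le> 4 * real D * r / d" using d by (simp add: field_simps)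
  moreover have "3 \<le> 5 * r / d" using r d by (simp add: field_simps)
  ultimately have "real m + 1 \<le> 4 * real D * r / d + 5 * r / d" using m2 by linarith
  also have "\<dots> = (4 * real D + 5) / d * r" by (simp add: field_simps add_divide_distrib)
  finally have "(real m + 1) ^ D \<le> ((4 * real D + 5) / d) ^ D * r ^ D"
    unfolding power_mult_distrib[symmetric] by (intro power_mono) auto
  moreover have "real N \<le> (real m + 1) ^ D" using N_le by (metis of_nat_1 of_nat_add of_nat_le_iff of_nat_power)
  ultimately have "r ^ D * r ^ D \<le> ((4 * real D + 5) / d) ^ D * r ^ D"
    using rN by (simp add: power_mult power2_eq_square power_mult_distrib mult_2 power_add)
  then have "r ^ D \<le> ((4 * real D + 5) / d) ^ D" using r by simp
  then have "(r ^ D) ^ 2 \<le> (((4 * real D + 5) / d) ^ D) ^ 2"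
    using r by (intro power_mono[of "r ^ D"]) auto
  then show ?thesis using rN by (simp add: N_def power_mult[symmetric] mult.commute)
qed

text \<open>A maximal separated subfamily is automatically a net, because an uncovered member could
  be added to it.\<close>

lemma ex_maximal_separated:
  fixes s :: real
  assumes "finite T" "0 < s"
  shows "\<exists>F\<subseteq>T. (\<forall>A\<in>F. \<forall>B\<in>F. A \<noteq> B \<longrightarrow> s \<le> card ((A - B) \<union> (B - A))) \<and>
           (\<forall>A\<in>T. \<exists>B\<in>F. card ((A - B) \<union> (B - A)) < s)"
proof -
  define Q where "Q = {F. F \<subseteq> T \<and> (\<forall>A\<in>F. \<forall>B\<in>F. A \<noteq> B \<longrightarrow> s \<le> card ((A - B) \<union> (B - A)))}"
  have "finite Q" "{} \<in> Q" using assms by (auto simp: Q_def)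
  then obtain F where F: "F \<in> Q" "\<And>G. G \<in> Q \<Longrightarrow> F \<subseteq> G \<Longrightarrow> F = G"
    using finite_has_maximal[of Q] by auto
  have "\<exists>B\<in>F. card ((A - B) \<union> (B - A)) < s" if A: "A \<in> T" for A
  proof (rule ccontr)
    assume *: "\<not> ?thesis"
    have "A \<notin> F" using * assms by force
    have "insert A F \<in> Q" using F(1) * A by (auto simp: Q_def not_less Un_commute)
    with F(2)[of "insert A F"] \<open>A \<notin> F\<close> show False by auto
  qed
  then show ?thesis using F(1) by (auto simp: Q_def)
qed

text \<open>This is the discrete entropy integral: the logarithm of the packing number at scale
  \<open>2 ^ (- j)\<close> grows linearly in \<open>j\<close>, while the squared radius decays
  geometrically. Its convergence is what removes the logarithm.\<close>

lemma summable_sqrt_geometric: "summable (\<lambda>j. sqrt ((real j + 1) / 2 ^ j))"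
proof (rule summable_ratio_test[of "sqrt (3 / 4)" 1])
  fix j :: nat assume "1 \<le> j"
  then have "sqrt ((real (Suc j) + 1) / 2 ^ Suc j) \<le> sqrt (3 / 4 * ((real j + 1) / 2 ^ j))"
    by (intro real_sqrt_le_mono) (simp add: field_simps)
  then show "norm (sqrt ((real (Suc j) + 1) / 2 ^ Suc j)) \<le> sqrt (3 / 4) * norm (sqrt ((real j + 1) / 2 ^ j))"
    unfolding real_sqrt_mult by simp
qed simp

text \<open>The first square root comes from the bound \<open>E * (j + 1)\<close> on the
  log-cardinalities in the chaining proof. In the last factor, 1 stands for the coarsest level and
  the series for the links between consecutive levels.\<close>

definition chaining_const :: "nat \<Rightarrow> real" where
  "chaining_const D = 2 * sqrt (1 + 4 * real D * (ln (4 * real D + 5) + 1)) *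
     (1 + 2 * (\<Sum>j. sqrt ((real j + 1) / 2 ^ j)))"

lemma chaining_const_nonneg: "0 \<le> chaining_const D"
  unfolding chaining_const_def
  by (intro mult_nonneg_nonneg add_nonneg_nonneg suminf_nonneg summable_sqrt_geometric) auto

text \<open>Every trace \<open>A\<close> is reached from the coarsest net through its projections
  \<open>p j A\<close> onto maximal families separated at scale \<open>n / 2 ^ j\<close>. Each level
  costs one finite maximum over differences of indicators.\<close>

theorem rad_avg_vc_le:
  assumes I: "finite I" and T: "T \<subseteq> Pow I" "T \<noteq> {}"
    and vc: "\<And>S. S \<subseteq> I \<Longrightarrow> shatters T S \<Longrightarrow> card S \<le> D"
  shows "rad_avg I (\<lambda>e. Max ((\<lambda>A. \<bar>\<Sum>i\<in>A. e i\<bar>) ` T)) \<le> chaining_const D * sqrt (card I)"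
proof (cases "I = {}")
  case True
  then have "T = {{}}" using T by auto
  then show ?thesis using True by simp
next
  case False
  define n where "n = card I"
  have n: "n \<ge> 1" using I False by (simp add: n_def Suc_leI card_gt_0_iff)
  have finT: "finite T" using T I finite_subset by auto
  have fin_in_T: "finite A" "A \<subseteq> I" if "A \<in> T" for A
    using that T finite_subset[OF _ I, of A] by auto
  have "\<forall>j::nat. \<exists>F\<subseteq>T. (\<forall>A\<in>F. \<forall>B\<in>F. A \<noteq> B \<longrightarrow> n / 2 ^ j \<le> card ((A - B) \<union> (B - A))) \<and>
           (\<forall>A\<in>T. \<exists>B\<in>F. card ((A - B) \<union> (B - A)) < n / 2 ^ j)"
    using finT n by (intro allI ex_maximal_separated) auto
  then obtain F where F: "\<And>j::nat. F j \<subseteq> T"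
    "\<And>j A B. A \<in> F j \<Longrightarrow> B \<in> F j \<Longrightarrow> A \<noteq> B \<Longrightarrow> n / 2 ^ j \<le> card ((A - B) \<union> (B - A))"
    "\<And>j A. A \<in> T \<Longrightarrow> \<exists>B\<in>F j. card ((A - B) \<union> (B - A)) < n / 2 ^ j"
    by metis
  define p where "p = (\<lambda>j A. SOME B. B \<in> F j \<and> card ((A - B) \<union> (B - A)) < n / 2 ^ j)"
  have p: "p j A \<in> F j" "card ((A - p j A) \<union> (p j A - A)) < n / 2 ^ j" if "A \<in> T" for j A
    using someI_ex[of "\<lambda>B. B \<in> F j \<and> card ((A - B) \<union> (B - A)) < n / 2 ^ j"] F(3)[OF that]
    unfolding p_def by blast+
  have pT: "p j A \<in> T" if "A \<in> T" for j A using p(1)[OF that] F(1) by auto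
  define N where "N = (\<lambda>j::nat. ((4 * real D + 5) * 2 ^ j) ^ (2 * D))"
  have N: "real (card (F j)) \<le> N j" for j
  proof -
    have "real (card (F j)) \<le> ((4 * real D + 5) / (1 / 2 ^ j)) ^ (2 * D)"
      using F(1) T by (intro card_separated_le[OF I False F(1) _ vc]) 
        (auto simp: n_def[symmetric] field_simps dest: F(2)[of _ j])
    then show ?thesis by (simp add: N_def)
  qed
  have N1: "1 \<le> N j" for j
    unfolding N_def by (intro one_le_power) (simp add: mult_ge1_I)
  \<comment> \<open>The square of \<open>N j\<close> is estimated because a link is a pair of net
    elements from consecutive levels; the additional 2 is that of
    \<open>rad_avg_Max_le\<close>.\<close>
  define E where "E = 1 + 4 * real D * (ln (4 * real D + 5) + 1)"
  have E0: "E \<ge> 1" by (simp add: E_def)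
  have lnN: "ln (2 * (N j) ^ 2) \<le> E * (j + 1)" for j
  proof -
    have "ln (2 * (N j) ^ 2) = ln 2 + 4 * real D * (ln (4 * real D + 5) + j * ln 2)"
      using N1[of j] by (simp add: ln_mult ln_realpow N_def)
    also have "\<dots> \<le> 1 * real (j + 1) + 4 * real D * (ln (4 * real D + 5) * real (j + 1) + 1 * real (j + 1))"
    proof (intro add_mono mult_left_mono)
      show "ln 2 \<le> 1 * real (j + 1)" using ln_2_less_1 by simp
      show "ln ((4 * real D + 5)) \<le> ln ((4 * real D + 5)) * real (j + 1)"
        using mult_left_mono[of 1 "real (j + 1)" "ln ((4 * real D + 5))"] by simp
      have "real j * ln 2 \<le> real j * 1" using ln_2_less_1 by (intro mult_left_mono) auto
      then show "real j * ln 2 \<le> 1 * real (j + 1)" by simp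
    qed simp
    also have "\<dots> = E * (j + 1)" by (simp add: E_def algebra_simps)
    finally show ?thesis .
  qed
  \<comment> \<open>At level \<open>n\<close> the scale \<open>n / 2 ^ n\<close> is at most 1, so a
    symmetric difference of strictly smaller size is empty and the chain ends exactly at
    \<open>A\<close>.\<close>
  define J where "J = n"
  have pJ: "p J A = A" if "A \<in> T" for A
  proof -
    have "real n / 2 ^ J \<le> 1" by (simp add: J_def)
    then have "card ((A - p J A) \<union> (p J A - A)) = 0" using p(2)[OF that, of J] by linarith
    moreover have "finite ((A - p J A) \<union> (p J A - A))" using fin_in_T that pT by auto
    ultimately show ?thesis by auto
  qed
  define K where "K = (\<lambda>j. (\<lambda>A. (p (Suc j) A, p j A)) ` T)"
  define v where "v = (\<lambda>(P, Q) (i::nat). indicator P i - indicator Q i :: real)"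
  have base: "rad_avg I (\<lambda>e. Max ((\<lambda>A. \<bar>\<Sum>i\<in>I. e i * indicator A i\<bar>) ` F 0)) \<le> 2 * sqrt (n * E)"
  proof -
    have ne: "F 0 \<noteq> {}" using p(1)[of _ 0] T(2) by auto
    have "rad_avg I (\<lambda>e. Max ((\<lambda>A. \<bar>\<Sum>i\<in>I. e i * indicator A i\<bar>) ` F 0)) \<le> 2 * sqrt (n * ln (2 * N 0))"
    proof (rule rad_avg_Max_le[OF I _ ne N])
      show "(\<Sum>i\<in>I. (indicator k i)\<^sup>2) \<le> real n" for k
        using sum_mono[of I "\<lambda>i. (indicator k i)\<^sup>2" "\<lambda>i. 1 :: real"] by (simp add: n_def indicator_def)
      show "finite (F 0)" using F(1) finT finite_subset by blast
    qed (use n in auto)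
    also have "\<dots> \<le> 2 * sqrt (n * E)"
    proof -
      have "ln (2 * N 0) \<le> ln (2 * (N 0) ^ 2)"
        using N1[of 0] by (simp add: power2_eq_square)
      then show ?thesis using lnN[of 0] by (intro mult_left_mono real_sqrt_le_mono) auto
    qed
    finally show ?thesis .
  qed
  have step: "rad_avg I (\<lambda>e. Max ((\<lambda>k. \<bar>\<Sum>i\<in>I. e i * v k i\<bar>) ` K j)) \<le>
      2 * sqrt (n * E) * (2 * sqrt ((real (Suc j) + 1) / 2 ^ Suc j))" for j
  proof -
    have "rad_avg I (\<lambda>e. Max ((\<lambda>k. \<bar>\<Sum>i\<in>I. e i * v k i\<bar>) ` K j)) \<le>
        2 * sqrt ((2 * real n / 2 ^ j) * ln (2 * (N (Suc j))\<^sup>2))"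
    proof (rule rad_avg_Max_le[OF I])
      show "finite (K j)" "K j \<noteq> {}" using finT T by (auto simp: K_def)
      have finF: "finite (F j)" for j using F(1) finT finite_subset by blast
      have "card (K j) \<le> card (F (Suc j) \<times> F j)"
        using p(1) finF by (intro card_mono) (auto simp: K_def)
      then have "real (card (K j)) \<le> real (card (F (Suc j))) * real (card (F j))"
        by (simp add: card_cartesian_product flip: of_nat_mult)
      also have "\<dots> \<le> N (Suc j) * N (Suc j)"
      proof (intro mult_mono N order_trans[OF N])
        show "N j \<le> N (Suc j)" unfolding N_def by (intro power_mono mult_left_mono) auto
      qed (use N1[of "Suc j"] in auto)
      finally show "real (card (K j)) \<le> (N (Suc j))\<^sup>2" by (simp add: power2_eq_square)
      show "0 < 2 * real n / 2 ^ j" using n by simp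
      fix k assume "k \<in> K j"
      then obtain A where A: "A \<in> T" "k = (p (Suc j) A, p j A)" by (auto simp: K_def)
      define P Q where "P = p (Suc j) A" and "Q = p j A"
      have PQ: "finite P" "finite Q" "finite A" "P \<subseteq> I" "Q \<subseteq> I"
        using A pT fin_in_T by (auto simp: P_def Q_def)
      have "(\<Sum>i\<in>I. (v k i)\<^sup>2) = (\<Sum>i\<in>I. indicator ((P - Q) \<union> (Q - P)) i)"
        unfolding A(2) P_def Q_def by (intro sum.cong) (auto simp: v_def indicator_def)
      also have "\<dots> = card ((P - Q) \<union> (Q - P))"
      proof -
        have "I \<inter> ((P - Q) \<union> (Q - P)) = (P - Q) \<union> (Q - P)" using PQ by auto
        then show ?thesis
          using sum.inter_restrict[OF I, of "\<lambda>_. 1 :: real" "(P - Q) \<union> (Q - P)"]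
          by (simp add: indicator_def of_bool_def)
      qed
      \<comment> \<open>Triangle inequality for symmetric differences through the common
        \<open>A\<close>: both projections are close to it.\<close>
      also have "\<dots> \<le> card (((A - P) \<union> (P - A)) \<union> ((A - Q) \<union> (Q - A)))"
        unfolding of_nat_le_iff using PQ by (intro card_mono) auto
      also have "\<dots> \<le> card ((A - P) \<union> (P - A)) + card ((A - Q) \<union> (Q - A))"
        unfolding of_nat_le_iff of_nat_add[symmetric] by (rule card_Un_le)
      also have "\<dots> \<le> n / 2 ^ Suc j + n / 2 ^ j"
        using p(2)[OF A(1), of "Suc j"] p(2)[OF A(1), of j] unfolding P_def Q_def by linarith
      also have "\<dots> \<le> 2 * real n / 2 ^ j" by (simp add: field_simps)
      finally show "(\<Sum>i\<in>I. (v k i)\<^sup>2) \<le> 2 * real n / 2 ^ j" .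
    qed
    also have "\<dots> \<le> 2 * sqrt ((2 * real n / 2 ^ j) * (E * (Suc j + 1)))"
      using lnN[of "Suc j"] by (intro mult_left_mono real_sqrt_le_mono) auto
    also have "(2 * real n / 2 ^ j) * (E * (Suc j + 1)) = (n * E) * (2\<^sup>2 * ((real (Suc j) + 1) / 2 ^ Suc j))"
      by (simp add: field_simps)
    finally show ?thesis unfolding real_sqrt_mult[of "n * E"] real_sqrt_mult[of "2\<^sup>2"] by simp
  qed
  have "rad_avg I (\<lambda>e. Max ((\<lambda>A. \<bar>\<Sum>i\<in>A. e i\<bar>) ` T)) \<le>
      rad_avg I (\<lambda>e. Max ((\<lambda>A. \<bar>\<Sum>i\<in>I. e i * indicator A i\<bar>) ` F 0) +
        (\<Sum>j<J. Max ((\<lambda>k. \<bar>\<Sum>i\<in>I. e i * v k i\<bar>) ` K j)))"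
  proof (rule rad_avg_mono)
    fix e :: "nat \<Rightarrow> real"
    show "Max ((\<lambda>A. \<bar>\<Sum>i\<in>A. e i\<bar>) ` T) \<le> Max ((\<lambda>A. \<bar>\<Sum>i\<in>I. e i * indicator A i\<bar>) ` F 0) +
        (\<Sum>j<J. Max ((\<lambda>k. \<bar>\<Sum>i\<in>I. e i * v k i\<bar>) ` K j))"
    proof (intro Max.boundedI)
      fix y assume "y \<in> (\<lambda>A. \<bar>\<Sum>i\<in>A. e i\<bar>) ` T"
      then obtain A where A: "A \<in> T" "y = \<bar>\<Sum>i\<in>A. e i\<bar>" by auto
      have "(\<Sum>i\<in>A. e i) = (\<Sum>i\<in>I. e i * indicator A i)"
        using fin_in_T[OF A(1)] I by (simp add: sum.inter_restrict[symmetric] indicator_def Int_absorb1 if_distrib cong: if_cong)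
      also have "\<dots> = (\<Sum>i\<in>I. e i * indicator (p J A) i)" using A pJ by simp
      also have "\<dots> = (\<Sum>i\<in>I. e i * indicator (p 0 A) i) +
          (\<Sum>j<J. (\<Sum>i\<in>I. e i * indicator (p (Suc j) A) i) - (\<Sum>i\<in>I. e i * indicator (p j A) i))"
        by (subst sum_lessThan_telescope) simp
      also have "(\<Sum>j<J. (\<Sum>i\<in>I. e i * indicator (p (Suc j) A) i) - (\<Sum>i\<in>I. e i * indicator (p j A) i)) =
          (\<Sum>j<J. \<Sum>i\<in>I. e i * v (p (Suc j) A, p j A) i)"
        by (simp add: v_def sum_subtractf[symmetric] right_diff_distrib)
      finally have "y \<le> \<bar>\<Sum>i\<in>I. e i * indicator (p 0 A) i\<bar> + (\<Sum>j<J. \<bar>\<Sum>i\<in>I. e i * v (p (Suc j) A, p j A) i\<bar>)"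
        unfolding A(2) by (simp only:) (rule order_trans[OF abs_triangle_ineq add_left_mono[OF sum_abs]])
      also have "\<dots> \<le> Max ((\<lambda>A. \<bar>\<Sum>i\<in>I. e i * indicator A i\<bar>) ` F 0) +
        (\<Sum>j<J. Max ((\<lambda>k. \<bar>\<Sum>i\<in>I. e i * v k i\<bar>) ` K j))"
        using A(1) p(1) finT F(1) finite_subset[OF F(1) finT]
        by (intro add_mono sum_mono Max_ge) (auto simp: K_def)
      finally show "y \<le> Max ((\<lambda>A. \<bar>\<Sum>i\<in>I. e i * indicator A i\<bar>) ` F 0) +
        (\<Sum>j<J. Max ((\<lambda>k. \<bar>\<Sum>i\<in>I. e i * v k i\<bar>) ` K j))" .
    qed (use finT T in auto)
  qed
  also have "\<dots> \<le> 2 * sqrt (n * E) + (\<Sum>j<J. 2 * sqrt (n * E) * (2 * sqrt ((real (Suc j) + 1) / 2 ^ Suc j)))"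
    unfolding rad_avg_add rad_avg_sum by (intro add_mono base sum_mono step)
  also have "(\<Sum>j<J. 2 * sqrt (n * E) * (2 * sqrt ((real (Suc j) + 1) / 2 ^ Suc j))) =
      4 * sqrt (n * E) * (\<Sum>j<J. sqrt ((real (Suc j) + 1) / 2 ^ Suc j))"
    by (simp add: sum_distrib_left mult_ac)
  also have "2 * sqrt (n * E) + 4 * sqrt (n * E) * (\<Sum>j<J. sqrt ((real (Suc j) + 1) / 2 ^ Suc j)) \<le>
      2 * sqrt (n * E) + 4 * sqrt (n * E) * (\<Sum>j. sqrt ((real j + 1) / 2 ^ j))"
  proof (intro add_left_mono mult_left_mono)
    have "(\<Sum>j<J. sqrt ((real (Suc j) + 1) / 2 ^ Suc j)) \<le> (\<Sum>j<Suc J. sqrt ((real j + 1) / 2 ^ j))"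
      unfolding sum.lessThan_Suc_shift by simp
    also have "\<dots> \<le> (\<Sum>j. sqrt ((real j + 1) / 2 ^ j))"
      by (intro sum_le_suminf summable_sqrt_geometric) auto
    finally show "(\<Sum>j<J. sqrt ((real (Suc j) + 1) / 2 ^ Suc j)) \<le> (\<Sum>j. sqrt ((real j + 1) / 2 ^ j))" .
  qed (use E0 in auto)
  finally have "rad_avg I (\<lambda>e. Max ((\<lambda>A. \<bar>\<Sum>i\<in>A. e i\<bar>) ` T)) \<le>
      2 * sqrt (n * E) + 4 * sqrt (n * E) * (\<Sum>j. sqrt ((real j + 1) / 2 ^ j))" .
  moreover have "chaining_const D = 2 * sqrt E * (1 + 2 * (\<Sum>j. sqrt ((real j + 1) / 2 ^ j)))"
    by (simp add: chaining_const_def E_def)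
  ultimately show ?thesis
    unfolding real_sqrt_mult[of n E] by (simp add: n_def algebra_simps)
qed

section \<open>Half-spaces and ridge functions\<close>


text \<open>The direction \<open>w = 0\<close> is included, so \<open>I\<close> itself and the empty
  set are traces. The first takes care of additive constants in a network.\<close>

definition halfspace_traces :: "(nat \<Rightarrow> 'a::euclidean_space) \<Rightarrow> nat set \<Rightarrow> nat set set" where
  "halfspace_traces x I = {A. \<exists>w t. A = {i \<in> I. t < w \<bullet> x i}}"

lemma halfspace_traces_subset: "halfspace_traces x I \<subseteq> Pow I"
  by (auto simp: halfspace_traces_def)

lemma halfspace_traces_nonempty: "halfspace_traces x I \<noteq> {}"
  by (auto simp: halfspace_traces_def)

lemma finite_halfspace_traces: "finite I \<Longrightarrow> finite (halfspace_traces x I)"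
  by (rule finite_subset[OF halfspace_traces_subset]) simp

text \<open>By Radon's theorem, \<open>DIM('a) + 2\<close> points split into two parts with
  intersecting convex hulls, while a half-space cutting out one part would separate the hulls.
  Cutting out singletons shows that \<open>x\<close> is injective on \<open>S\<close>, so counting
  indices is counting points.\<close>

lemma card_shattered_halfspaces_le:
  fixes x :: "nat \<Rightarrow> 'a::euclidean_space"
  assumes "finite I" "S \<subseteq> I" "shatters (halfspace_traces x I) S"
  shows "card S \<le> DIM('a) + 1"
proof (rule ccontr)
  assume *: "\<not> ?thesis"
  have fin: "finite S" using assms finite_subset by auto
  have inj: "inj_on x S"
  proof (intro inj_onI, rule ccontr)
    fix i j assume ij: "i \<in> S" "j \<in> S" "x i = x j" "i \<noteq> j"
    obtain A where A: "A \<in> halfspace_traces x I" "A \<inter> S = {i}"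
      using assms(3) by (rule shattersE[of _ _ "{i}"]) (use ij in auto)
    then have "i \<in> A" "j \<notin> A" using ij by auto
    then show False using A(1) ij assms(2) by (auto simp: halfspace_traces_def)
  qed
  then have "card (x ` S) \<ge> DIM('a) + 2" using * by (simp add: card_image)
  then have "affine_dependent (x ` S)" using fin by (intro affine_dependent_biggerset) auto
  then obtain m p where mp: "m \<subseteq> x ` S" "p \<subseteq> x ` S" "m \<inter> p = {}" "convex hull m \<inter> convex hull p \<noteq> {}"
    by (rule Radon)
  obtain A where A: "A \<in> halfspace_traces x I" "A \<inter> S = {i\<in>S. x i \<in> m}"
    using assms(3) by (rule shattersE[of _ _ "{i\<in>S. x i \<in> m}"]) auto
  then obtain w t where wt: "A = {i\<in>I. t < w \<bullet> x i}" by (auto simp: halfspace_traces_def)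
  have wtS: "t < w \<bullet> x i \<longleftrightarrow> x i \<in> m" if "i \<in> S" for i
    using A(2) that assms(2) unfolding wt by blast
  have "convex hull m \<subseteq> {y. t < w \<bullet> y}"
    using mp(1) wtS by (intro hull_minimal) (auto simp: convex_halfspace_gt)
  moreover have "convex hull p \<subseteq> {y. w \<bullet> y \<le> t}"
    using mp(2,3) wtS by (intro hull_minimal) (force simp: convex_halfspace_le not_less)+
  ultimately show False using mp(4) by force
qed

definition halfspace_disc :: "(nat \<Rightarrow> 'a::euclidean_space) \<Rightarrow> nat set \<Rightarrow> (nat \<Rightarrow> real) \<Rightarrow> real" where
  "halfspace_disc x I e = Max ((\<lambda>A. \<bar>\<Sum>i\<in>A. e i\<bar>) ` halfspace_traces x I)"

lemma rad_avg_halfspace_disc_le: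
  fixes x :: "nat \<Rightarrow> 'a::euclidean_space"
  assumes "finite I"
  shows "rad_avg I (halfspace_disc x I) \<le> chaining_const (DIM('a) + 1) * sqrt (card I)"
  using rad_avg_vc_le[OF assms halfspace_traces_subset halfspace_traces_nonempty
      card_shattered_halfspaces_le[OF assms]]
  unfolding halfspace_disc_def[abs_def] by simp

lemma halfspace_disc_ge:
  assumes "finite I"
  shows "\<bar>\<Sum>i | i \<in> I \<and> t < w \<bullet> x i. e i\<bar> \<le> halfspace_disc x I e"
  unfolding halfspace_disc_def using finite_halfspace_traces[OF assms]
  by (intro Max_ge) (auto simp: halfspace_traces_def)

lemma halfspace_disc_nonneg: "finite I \<Longrightarrow> 0 \<le> halfspace_disc x I e"
  using halfspace_disc_ge[of I e 0 0 x] abs_ge_zero order_trans by blast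

lemma layer_cake_signed_sum_le:
  fixes v :: "'i \<Rightarrow> real"
  assumes I: "finite I" and v: "\<And>i. i \<in> I \<Longrightarrow> 0 \<le> v i \<and> v i \<le> B" and B: "0 \<le> B"
    and H: "\<And>u. \<bar>\<Sum>i | i \<in> I \<and> u < v i. e i\<bar> \<le> H"
  shows "\<bar>\<Sum>i\<in>I. e i * v i\<bar> \<le> B * H"
proof -
  have ind: "((\<lambda>u. if u < v i then 1 else 0) has_integral v i) {0..B}" if i: "i \<in> I" for i
  proof -
    have "((\<lambda>u. 1) has_integral v i) {0..v i}" using v[OF i] has_integral_const_real[of "1::real" 0 "v i"] by simp
    then have "((\<lambda>u. if u \<in> {0..v i} then 1 else 0) has_integral v i) {0..B}"
      using v[OF i] by (subst has_integral_restrict) auto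
    then show ?thesis
      by (rule has_integral_spike_finite[of "{v i}", rotated 2]) auto
  qed
  have "((\<lambda>u. \<Sum>i\<in>I. e i * (if u < v i then 1 else 0)) has_integral (\<Sum>i\<in>I. e i * v i)) {0..B}"
    using I ind by (intro has_integral_sum has_integral_mult_right) auto
  moreover have "(\<Sum>i\<in>I. e i * (if u < v i then 1 else 0)) = (\<Sum>i | i \<in> I \<and> u < v i. e i)" for u
    using I by (simp add: sum.inter_filter[symmetric] if_distrib cong: if_cong)
  ultimately have "((\<lambda>u. \<Sum>i | i \<in> I \<and> u < v i. e i) has_integral (\<Sum>i\<in>I. e i * v i)) {0..B}" by simp
  moreover have "0 \<le> H" using H[of 0] by linarith
  ultimately have "norm (\<Sum>i\<in>I. e i * v i) \<le> H * measure lborel {0..B}"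
    using H by (intro has_integral_bound_real) auto
  then show ?thesis using B by (simp add: mult.commute)
qed

text \<open>A superlevel set of a monotone function is a ray that may contain its endpoint. On
  finitely many points a strict threshold still describes it: the largest point outside, or anything
  below all points if there is none.\<close>

lemma superlevel_halfspace:
  fixes f :: "real \<Rightarrow> real"
  assumes "finite I" "mono f"
  obtains t where "\<And>i. i \<in> I \<Longrightarrow> u < f (z i) \<longleftrightarrow> t < z i"
proof (cases "{i\<in>I. f (z i) \<le> u} = {}")
  case True
  have *: "u < f (z i)" if "i \<in> I" for i using True that by force
  have "Min (insert 0 (z ` I)) - 1 < z i" if "i \<in> I" for i
  proof -
    have "Min (insert 0 (z ` I)) \<le> z i" using assms that by (intro Min_le) auto
    then show ?thesis by simp
  qed
  with * show ?thesis by (intro that[of "Min (insert 0 (z ` I)) - 1"]) auto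
next
  case False
  define t where "t = Max (z ` {i\<in>I. f (z i) \<le> u})"
  have "t \<in> z ` {i\<in>I. f (z i) \<le> u}" unfolding t_def using False assms by (intro Max_in) auto
  then have ft: "f t \<le> u" by auto
  show ?thesis
  proof (rule that[of t])
    fix i assume i: "i \<in> I"
    show "u < f (z i) \<longleftrightarrow> t < z i"
    proof
      assume "u < f (z i)"
      then have "f t < f (z i)" using ft by simp
      then show "t < z i" using assms(2) by (meson leD le_less_linear monoD)
    next
      assume t: "t < z i"
      show "u < f (z i)"
      proof (rule ccontr)
        assume "\<not> u < f (z i)"
        then have "z i \<le> t" unfolding t_def using assms i by (intro Max_ge) auto
        then show False using t by simp
      qed
    qed
  qed
qed

lemma ridge_signed_sum_le:
  fixes x :: "nat \<Rightarrow> 'a::euclidean_space" and f :: "real \<Rightarrow> real"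
  assumes "finite I" "mono f" "0 \<le> B" "\<And>i. i \<in> I \<Longrightarrow> 0 \<le> f (w \<bullet> x i + b) \<and> f (w \<bullet> x i + b) \<le> B"
  shows "\<bar>\<Sum>i\<in>I. e i * f (w \<bullet> x i + b)\<bar> \<le> B * halfspace_disc x I e"
proof (rule layer_cake_signed_sum_le[OF assms(1,4,3)])
  fix u
  obtain t where t: "\<And>i. i \<in> I \<Longrightarrow> u < f (w \<bullet> x i + b) \<longleftrightarrow> t < w \<bullet> x i + b"
    using superlevel_halfspace[OF assms(1,2), of u "\<lambda>i. w \<bullet> x i + b"] by blast
  then have "{i. i \<in> I \<and> u < f (w \<bullet> x i + b)} = {i. i \<in> I \<and> t - b < w \<bullet> x i}"
    by (auto simp: diff_less_eq)
  then show "\<bar>\<Sum>i | i \<in> I \<and> u < f (w \<bullet> x i + b). e i\<bar> \<le> halfspace_disc x I e"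
    by (simp only: halfspace_disc_ge[OF assms(1)])
qed

section \<open>Symmetrization and contraction\<close>


lemma abs_Max_le:
  fixes f :: "'k \<Rightarrow> real"
  assumes "finite K" "K \<noteq> {}" "\<And>k. k \<in> K \<Longrightarrow> \<bar>f k\<bar> \<le> C"
  shows "\<bar>Max (f ` K)\<bar> \<le> C"
proof -
  have "Max (f ` K) \<in> f ` K" using assms by (intro Max_in) auto
  then show ?thesis using assms(3) by auto
qed

lemma (in prob_space) integrable_bounded:
  fixes f :: "'a \<Rightarrow> real"
  assumes "f \<in> borel_measurable M" "\<And>x. x \<in> space M \<Longrightarrow> \<bar>f x\<bar> \<le> C"
  shows "integrable M f"
  using assms by (intro integrable_const_bound[of _ C]) auto

lemma (in prob_space) integral_le_bound:
  fixes f :: "'a \<Rightarrow> real"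
  assumes "integrable M f" "\<And>x. x \<in> space M \<Longrightarrow> f x \<le> C"
  shows "(\<integral>x. f x \<partial>M) \<le> C"
proof -
  have "(\<integral>x. f x \<partial>M) \<le> (\<integral>x. C \<partial>M)" using assms by (intro integral_mono) auto
  then show ?thesis by (simp add: prob_space)
qed

lemma (in prob_space) abs_integral_le_bound:
  fixes f :: "'a \<Rightarrow> real"
  assumes "f \<in> borel_measurable M" "\<And>x. x \<in> space M \<Longrightarrow> \<bar>f x\<bar> \<le> C"
  shows "\<bar>\<integral>x. f x \<partial>M\<bar> \<le> C"
proof -
  have "\<bar>\<integral>x. f x \<partial>M\<bar> \<le> (\<integral>x. \<bar>f x\<bar> \<partial>M)" by (rule integral_abs_bound)
  also have "\<dots> \<le> C" using assms by (intro integral_le_bound integrable_bounded[of _ C]) auto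
  finally show ?thesis .
qed

lemma fubini_bounded:
  fixes F :: "'a \<times> 'b \<Rightarrow> real"
  assumes "prob_space A" "prob_space B" and F [measurable]: "F \<in> borel_measurable (A \<Otimes>\<^sub>M B)"
    and C: "\<And>a b. a \<in> space A \<Longrightarrow> b \<in> space B \<Longrightarrow> \<bar>F (a, b)\<bar> \<le> C"
  shows "(\<integral>a. (\<integral>b. F (a, b) \<partial>B) \<partial>A) = (\<integral>b. (\<integral>a. F (a, b) \<partial>A) \<partial>B)"
    and "integrable A (\<lambda>a. \<integral>b. F (a, b) \<partial>B)" and "integrable B (\<lambda>b. \<integral>a. F (a, b) \<partial>A)"
proof -
  interpret A: prob_space A by fact
  interpret B: prob_space B by fact
  interpret pair_prob_space A B ..
  have int: "integrable (A \<Otimes>\<^sub>M B) (\<lambda>(a, b). F (a, b))"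
    using C by (intro integrable_bounded[of _ C]) (auto simp: space_pair_measure)
  show "(\<integral>a. (\<integral>b. F (a, b) \<partial>B) \<partial>A) = (\<integral>b. (\<integral>a. F (a, b) \<partial>A) \<partial>B)"
    using Fubini_integral[OF int] by simp
  show "integrable A (\<lambda>a. \<integral>b. F (a, b) \<partial>B)" by (rule integrable_fst[OF int])
  show "integrable B (\<lambda>b. \<integral>a. F (a, b) \<partial>A)" by (rule integrable_snd[OF int])
qed

text \<open>
  One coordinate at a time: for an independent copy \<open>y\<close> of \<open>x\<close>, convexity of \<open>Max\<close> bounds the value
  at \<open>h + u x - u y\<close> by the mean of the values at \<open>h + 2 u x\<close> and \<open>h - 2 u y\<close>. This decouples
  \<open>x\<close> from \<open>y\<close>, so that no symmetry of the product measure is needed.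
\<close>

lemma symmetrization_single:
  fixes u v :: "'k \<Rightarrow> 'a \<Rightarrow> real"
  assumes "prob_space M" and K: "finite K" "K \<noteq> {}"
    and u [measurable]: "\<And>k. k \<in> K \<Longrightarrow> u k \<in> borel_measurable M"
    and v [measurable]: "\<And>k. k \<in> K \<Longrightarrow> v k \<in> borel_measurable M"
    and B: "\<And>k x. k \<in> K \<Longrightarrow> x \<in> space M \<Longrightarrow> \<bar>u k x\<bar> \<le> B \<and> \<bar>v k x\<bar> \<le> B"
    and L: "0 \<le> L" "\<And>k l x. k \<in> K \<Longrightarrow> l \<in> K \<Longrightarrow> x \<in> space M \<Longrightarrow> \<bar>u k x - u l x\<bar> \<le> L * \<bar>v k x - v l x\<bar>"
  shows "(\<integral>x. Max ((\<lambda>k. h k + (u k x - (\<integral>y. u k y \<partial>M))) ` K) \<partial>M) \<le>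
    ((\<integral>x. Max ((\<lambda>k. h k + 2 * L * v k x) ` K) \<partial>M) + (\<integral>x. Max ((\<lambda>k. h k - 2 * L * v k x) ` K) \<partial>M)) / 2"
proof -
  interpret prob_space M by fact
  obtain Ch where Ch: "\<And>k. k \<in> K \<Longrightarrow> \<bar>h k\<bar> \<le> Ch"
    using finite_imageI[OF K(1), of "\<lambda>k. \<bar>h k\<bar>"] Max_ge[of "(\<lambda>k. \<bar>h k\<bar>) ` K"] by blast
  have B0: "\<And>k. k \<in> K \<Longrightarrow> \<bar>\<integral>y. u k y \<partial>M\<bar> \<le> B"
    using B by (intro abs_integral_le_bound) auto
  have iu: "integrable M (u k)" if "k \<in> K" for k
    using B that by (intro integrable_bounded[of _ B]) auto
  have int: "integrable M (\<lambda>x. Max ((\<lambda>k. h k + (a k + c * w k x)) ` K))"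
    if w: "\<And>k. k \<in> K \<Longrightarrow> w k \<in> borel_measurable M"
      "\<And>k x. k \<in> K \<Longrightarrow> x \<in> space M \<Longrightarrow> \<bar>w k x\<bar> \<le> B" and a: "\<And>k. k \<in> K \<Longrightarrow> \<bar>a k\<bar> \<le> B" for w a c
  proof (rule integrable_bounded[of _ "Ch + (B + \<bar>c\<bar> * B)"])
    show "(\<lambda>x. Max ((\<lambda>k. h k + (a k + c * w k x)) ` K)) \<in> borel_measurable M"
      using w K by (intro borel_measurable_Max borel_measurable_add borel_measurable_times borel_measurable_const) auto
    fix x assume x: "x \<in> space M"
    show "\<bar>Max ((\<lambda>k. h k + (a k + c * w k x)) ` K)\<bar> \<le> Ch + (B + \<bar>c\<bar> * B)"
    proof (intro abs_Max_le K)
      fix k assume k: "k \<in> K"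
      have "\<bar>c * w k x\<bar> \<le> \<bar>c\<bar> * B" unfolding abs_mult using w(2)[OF k x] by (intro mult_left_mono) auto
      then show "\<bar>h k + (a k + c * w k x)\<bar> \<le> Ch + (B + \<bar>c\<bar> * B)" using Ch[OF k] a[OF k] by linarith
    qed
  qed
  obtain k0 where k0: "k0 \<in> K" using K by auto
  obtain x0 where "x0 \<in> space M" using not_empty by auto
  then have B1: "0 \<le> B" using B[OF k0] by fastforce
  define a where "a = (\<lambda>s (w :: 'k \<Rightarrow> 'a \<Rightarrow> real) x. Max ((\<lambda>k. h k + s * w k x) ` K))"
  have ai: "integrable M (a s u)" "integrable M (a s v)" for s
    using int[of u "\<lambda>_. 0" s] int[of v "\<lambda>_. 0" s] B B1 by (auto simp: a_def)
  have a_le: "h k + s * w k x \<le> a s w x" if "k \<in> K" for s k w x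
    unfolding a_def using K that by (intro Max_ge) auto
  have "(\<integral>x. Max ((\<lambda>k. h k + (u k x - (\<integral>y. u k y \<partial>M))) ` K) \<partial>M) \<le>
      (\<integral>x. (a 2 u x + (\<integral>y. a (-2) u y \<partial>M)) / 2 \<partial>M)"
  proof (intro integral_mono)
    show "integrable M (\<lambda>x. Max ((\<lambda>k. h k + (u k x - (\<integral>y. u k y \<partial>M))) ` K))"
      using int[of u "\<lambda>k. - (\<integral>y. u k y \<partial>M)" 1] B B0 by (simp add: algebra_simps)
    show "integrable M (\<lambda>x. (a 2 u x + (\<integral>y. a (-2) u y \<partial>M)) / 2)" using ai by auto
    fix x assume x: "x \<in> space M"
    show "Max ((\<lambda>k. h k + (u k x - (\<integral>y. u k y \<partial>M))) ` K) \<le> (a 2 u x + (\<integral>y. a (-2) u y \<partial>M)) / 2"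
    proof (intro Max.boundedI)
      fix z assume "z \<in> (\<lambda>k. h k + (u k x - (\<integral>y. u k y \<partial>M))) ` K"
      then obtain k where k: "k \<in> K" "z = h k + (u k x - (\<integral>y. u k y \<partial>M))" by auto
      have "h k - 2 * (\<integral>y. u k y \<partial>M) = (\<integral>y. h k + (-2) * u k y \<partial>M)"
        using iu[OF k(1)] by (simp add: prob_space)
      also have "\<dots> \<le> (\<integral>y. a (-2) u y \<partial>M)"
        using iu[OF k(1)] ai by (intro integral_mono a_le k(1)) auto
      finally show "z \<le> (a 2 u x + (\<integral>y. a (-2) u y \<partial>M)) / 2"
        using a_le[OF k(1), of 2 u x] k(2) by simp
    qed (use K in auto)
  qed
  also have "\<dots> = (\<integral>x. (a 2 u x + a (-2) u x) / 2 \<partial>M)"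
    using ai by (simp add: prob_space)
  also have "\<dots> \<le> (\<integral>x. (a (2 * L) v x + a (- (2 * L)) v x) / 2 \<partial>M)"
  proof (intro integral_mono)
    fix x assume x: "x \<in> space M"
    have "a 2 u x \<in> (\<lambda>k. h k + 2 * u k x) ` K" "a (-2) u x \<in> (\<lambda>k. h k + (-2) * u k x) ` K"
      unfolding a_def using K by (intro Max_in; auto)+
    then obtain k l where kl: "k \<in> K" "l \<in> K" "a 2 u x = h k + 2 * u k x" "a (-2) u x = h l + (-2) * u l x" by auto
    \<comment> \<open>Contraction. With \<open>k\<close> and \<open>l\<close> maximizing for the two
      signs, only the difference of \<open>u\<close> at \<open>k\<close> and \<open>l\<close>
      matters and is replaced by that of \<open>v\<close>. The absolute value is harmless: whichever
      of \<open>v k x\<close>, \<open>v l x\<close> is larger goes to the maximum with the positive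
      sign.\<close>
    have "a 2 u x + a (-2) u x \<le> h k + h l + 2 * (L * \<bar>v k x - v l x\<bar>)"
      using L(2)[OF kl(1,2) x] unfolding kl by linarith
    also have "\<dots> \<le> a (2 * L) v x + a (- (2 * L)) v x"
    proof (cases "v k x \<ge> v l x")
      case True
      then show ?thesis
        using a_le[OF kl(1), of "2 * L" v x] a_le[OF kl(2), of "- (2 * L)" v x] by (simp add: algebra_simps)
    next
      case False
      then show ?thesis
        using a_le[OF kl(2), of "2 * L" v x] a_le[OF kl(1), of "- (2 * L)" v x] by (simp add: algebra_simps)
    qed
    finally show "(a 2 u x + a (-2) u x) / 2 \<le> (a (2 * L) v x + a (- (2 * L)) v x) / 2" by simp
  qed (use ai in auto)
  also have "\<dots> = ((\<integral>x. a (2 * L) v x \<partial>M) + (\<integral>x. a (- (2 * L)) v x \<partial>M)) / 2"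
    using ai by simp
  finally show ?thesis by (simp add: a_def)
qed


lemma integrable_rad_avg:
  assumes "\<And>e. integrable M (F e)"
  shows "integrable M (\<lambda>x. rad_avg I (\<lambda>e. F e x))"
  unfolding rad_avg_def by (intro integrable_divide Bochner_Integration.integrable_sum assms)

lemma integral_rad_avg:
  assumes "\<And>e. integrable M (F e)"
  shows "(\<integral>x. rad_avg I (\<lambda>e. F e x) \<partial>M) = rad_avg I (\<lambda>e. \<integral>x. F e x \<partial>M)"
proof -
  have "(\<integral>x. (\<Sum>S\<in>Pow I. F (\<lambda>i. if i \<in> S then 1 else - 1) x) \<partial>M) =
      (\<Sum>S\<in>Pow I. \<integral>x. F (\<lambda>i. if i \<in> S then 1 else - 1) x \<partial>M)"
    by (intro Bochner_Integration.integral_sum assms)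
  then show ?thesis unfolding rad_avg_def by simp
qed

lemma integral_PiM_insert:
  fixes F :: "('i \<Rightarrow> 'a) \<Rightarrow> real"
  assumes "prob_space M" and I: "finite I" "i \<notin> I"
    and F [measurable]: "F \<in> borel_measurable (PiM (insert i I) (\<lambda>_. M))"
    and C: "\<And>x. x \<in> space (PiM (insert i I) (\<lambda>_. M)) \<Longrightarrow> \<bar>F x\<bar> \<le> C"
  shows "(\<integral>x. F x \<partial>PiM (insert i I) (\<lambda>_. M)) = (\<integral>x. (\<integral>y. F (x(i := y)) \<partial>M) \<partial>PiM I (\<lambda>_. M))"
proof -
  interpret M: prob_space M by fact
  interpret product_prob_space "\<lambda>_. M" "insert i I" ..
  have "prob_space (PiM (insert i I) (\<lambda>_. M))" by (intro prob_space_PiM M.prob_space_axioms)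
  then show ?thesis
    using I C F by (intro product_integral_insert prob_space.integrable_bounded[of _ _ C])
qed

text \<open>Induction over the coordinates, for arbitrary \<open>h\<close>, since \<open>h\<close>
  must absorb the coordinates not being treated: the centred term of the new coordinate when the
  induction hypothesis is applied, and the signed sum over the old ones when
  \<open>symmetrization_single\<close> is applied. Symmetrizing and contracting each coordinate at
  once gives the single factor \<open>2 * L\<close>.\<close>

theorem symmetrization_contraction:
  fixes u v :: "'k \<Rightarrow> 'a \<Rightarrow> real"
  assumes "prob_space M" and I: "finite I" and K: "finite K" "K \<noteq> {}"
    and u [measurable]: "\<And>k. k \<in> K \<Longrightarrow> u k \<in> borel_measurable M"
    and v [measurable]: "\<And>k. k \<in> K \<Longrightarrow> v k \<in> borel_measurable M"
    and B: "\<And>k x. k \<in> K \<Longrightarrow> x \<in> space M \<Longrightarrow> \<bar>u k x\<bar> \<le> B \<and> \<bar>v k x\<bar> \<le> B"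
    and L: "0 \<le> L" "\<And>k l x. k \<in> K \<Longrightarrow> l \<in> K \<Longrightarrow> x \<in> space M \<Longrightarrow> \<bar>u k x - u l x\<bar> \<le> L * \<bar>v k x - v l x\<bar>"
  shows "(\<integral>x. Max ((\<lambda>k. h k + (\<Sum>i\<in>I. u k (x i) - (\<integral>y. u k y \<partial>M))) ` K) \<partial>PiM I (\<lambda>_. M)) \<le>
    rad_avg I (\<lambda>e. \<integral>x. Max ((\<lambda>k. h k + 2 * L * (\<Sum>i\<in>I. e i * v k (x i))) ` K) \<partial>PiM I (\<lambda>_. M))"
  using I
proof (induction I arbitrary: h rule: finite_induct)
  case empty
  show ?case by simp
next
  case (insert i I)
  interpret prob_space M by fact
  define P where "P = PiM I (\<lambda>_. M)"
  have P: "prob_space P" unfolding P_def by (intro prob_space_PiM prob_space_axioms)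
  define m where "m = (\<lambda>k. \<integral>y. u k y \<partial>M)"
  have mB: "\<bar>m k\<bar> \<le> B" if "k \<in> K" for k
    unfolding m_def using B that by (intro abs_integral_le_bound) auto
  \<comment> \<open>One family contains every integrand of the induction step, so that
    measurability, boundedness and Fubini are settled only once.\<close>
  define gen where "gen = (\<lambda>a1 a2 a3 b1 b2 e (y, x).
    Max ((\<lambda>k. h k + (a1 * u k y + a2 * m k + a3 * v k y) +
      (b1 * (\<Sum>j\<in>I. u k (x j) - m k) + b2 * (\<Sum>j\<in>I. e j * v k (x j)))) ` K))"
  have gm: "gen a1 a2 a3 b1 b2 e \<in> borel_measurable (M \<Otimes>\<^sub>M P)" for a1 a2 a3 b1 b2 e
  proof -
    have [measurable]: "(\<lambda>z. u k (snd z j)) \<in> borel_measurable (M \<Otimes>\<^sub>M P)"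
      "(\<lambda>z. v k (snd z j)) \<in> borel_measurable (M \<Otimes>\<^sub>M P)" if "k \<in> K" "j \<in> I" for k j
      using that u v unfolding P_def by measurable
    show ?thesis
      unfolding gen_def case_prod_beta using K by (intro borel_measurable_Max) measurable
  qed
  have gb: "\<exists>C. \<forall>y\<in>space M. \<forall>x\<in>space P. \<bar>gen a1 a2 a3 b1 b2 e (y, x)\<bar> \<le> C" for a1 a2 a3 b1 b2 e
  proof (intro exI ballI)
    fix y x assume y: "y \<in> space M" and x: "x \<in> space P"
    have xj: "x j \<in> space M" if "j \<in> I" for j using x that by (auto simp: P_def space_PiM)
    show "\<bar>gen a1 a2 a3 b1 b2 e (y, x)\<bar> \<le> Max ((\<lambda>k. \<bar>h k\<bar>) ` K) + (\<bar>a1\<bar> * B + \<bar>a2\<bar> * B + \<bar>a3\<bar> * B)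
       + (\<bar>b1\<bar> * (\<Sum>j\<in>I. 2 * B) + \<bar>b2\<bar> * (\<Sum>j\<in>I. \<bar>e j\<bar> * B))"
      unfolding gen_def case_prod_conv
    proof (intro abs_Max_le K)
      fix k assume k: "k \<in> K"
      have 1: "\<bar>h k\<bar> \<le> Max ((\<lambda>k. \<bar>h k\<bar>) ` K)" using K k by (intro Max_ge) auto
      have 2: "\<bar>a1 * u k y\<bar> \<le> \<bar>a1\<bar> * B" "\<bar>a2 * m k\<bar> \<le> \<bar>a2\<bar> * B" "\<bar>a3 * v k y\<bar> \<le> \<bar>a3\<bar> * B"
        using B[OF k y] mB[OF k] by (auto simp: abs_mult intro!: mult_left_mono)
      have uB: "\<bar>u k (x j) - m k\<bar> \<le> 2 * B" if "j \<in> I" for j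
        using B[OF k xj[OF that]] mB[OF k] by linarith
      have 3: "\<bar>b1 * (\<Sum>j\<in>I. u k (x j) - m k)\<bar> \<le> \<bar>b1\<bar> * (\<Sum>j\<in>I. 2 * B)"
        unfolding abs_mult by (intro mult_left_mono order_trans[OF sum_abs] sum_mono uB) auto
      have "\<bar>e j * v k (x j)\<bar> \<le> \<bar>e j\<bar> * B" if "j \<in> I" for j
        using B[OF k xj[OF that]] by (auto simp: abs_mult intro!: mult_left_mono)
      then have 4: "\<bar>b2 * (\<Sum>j\<in>I. e j * v k (x j))\<bar> \<le> \<bar>b2\<bar> * (\<Sum>j\<in>I. \<bar>e j\<bar> * B)"
        unfolding abs_mult[of b2] by (intro mult_left_mono order_trans[OF sum_abs] sum_mono) auto
      show "\<bar>h k + (a1 * u k y + a2 * m k + a3 * v k y) +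
        (b1 * (\<Sum>j\<in>I. u k (x j) - m k) + b2 * (\<Sum>j\<in>I. e j * v k (x j)))\<bar> \<le>
        Max ((\<lambda>k. \<bar>h k\<bar>) ` K) + (\<bar>a1\<bar> * B + \<bar>a2\<bar> * B + \<bar>a3\<bar> * B)
       + (\<bar>b1\<bar> * (\<Sum>j\<in>I. 2 * B) + \<bar>b2\<bar> * (\<Sum>j\<in>I. \<bar>e j\<bar> * B))"
        by (intro abs_triangle_ineq[THEN order_trans] add_mono 1 2 3 4)
    qed
  qed
  have swap: "(\<integral>y. (\<integral>x. gen a1 a2 a3 b1 b2 e (y, x) \<partial>P) \<partial>M) = (\<integral>x. (\<integral>y. gen a1 a2 a3 b1 b2 e (y, x) \<partial>M) \<partial>P)"
    and intM: "integrable M (\<lambda>y. \<integral>x. gen a1 a2 a3 b1 b2 e (y, x) \<partial>P)"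
    and intP: "integrable P (\<lambda>x. \<integral>y. gen a1 a2 a3 b1 b2 e (y, x) \<partial>M)" for a1 a2 a3 b1 b2 e
  proof -
    obtain C where C: "\<forall>y\<in>space M. \<forall>x\<in>space P. \<bar>gen a1 a2 a3 b1 b2 e (y, x)\<bar> \<le> C" using gb by blast
    then have C': "\<bar>gen a1 a2 a3 b1 b2 e (y, x)\<bar> \<le> C" if "y \<in> space M" "x \<in> space P" for y x
      using that by blast
    note * = fubini_bounded[OF prob_space_axioms P gm C']
    show "(\<integral>y. (\<integral>x. gen a1 a2 a3 b1 b2 e (y, x) \<partial>P) \<partial>M) = (\<integral>x. (\<integral>y. gen a1 a2 a3 b1 b2 e (y, x) \<partial>M) \<partial>P)"
      "integrable M (\<lambda>y. \<integral>x. gen a1 a2 a3 b1 b2 e (y, x) \<partial>P)"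
      "integrable P (\<lambda>x. \<integral>y. gen a1 a2 a3 b1 b2 e (y, x) \<partial>M)"
      by (rule *; assumption)+
  qed
  have split: "(\<integral>x. F x \<partial>PiM (insert i I) (\<lambda>_. M)) = (\<integral>x. (\<integral>y. gen a1 a2 a3 b1 b2 e (y, x) \<partial>M) \<partial>P)"
    if F: "F \<in> borel_measurable (PiM (insert i I) (\<lambda>_. M))"
      and eq: "\<And>x y. F (x(i := y)) = gen a1 a2 a3 b1 b2 e (y, x)" for F a1 a2 a3 b1 b2 e
  proof -
    obtain C where C: "\<forall>y\<in>space M. \<forall>x\<in>space P. \<bar>gen a1 a2 a3 b1 b2 e (y, x)\<bar> \<le> C" using gb by blast
    have "\<bar>F x\<bar> \<le> C" if x: "x \<in> space (PiM (insert i I) (\<lambda>_. M))" for x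
    proof -
      define x' where "x' = restrict x I"
      have "x = x'(i := x i)" using x by (auto simp: x'_def fun_eq_iff space_PiM PiE_def extensional_def)
      then have "F x = gen a1 a2 a3 b1 b2 e (x i, x')" using eq by metis
      moreover have "x i \<in> space M" "x' \<in> space P" using x by (auto simp: P_def x'_def space_PiM)
      ultimately show ?thesis using C by auto
    qed
    from integral_PiM_insert[OF prob_space_axioms insert(1,2) F this]
    show ?thesis unfolding eq P_def .
  qed
  have upd: "(\<Sum>j\<in>I. f j ((x(i := y)) j)) = (\<Sum>j\<in>I. f j (x j))" for f :: "nat \<Rightarrow> 'a \<Rightarrow> real" and x y
    using insert(2) by (intro sum.cong) auto
  have "(\<integral>x. Max ((\<lambda>k. h k + (\<Sum>j\<in>insert i I. u k (x j) - m k)) ` K) \<partial>PiM (insert i I) (\<lambda>_. M)) =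
      (\<integral>x. (\<integral>y. gen 1 (-1) 0 1 0 (\<lambda>_. 0) (y, x) \<partial>M) \<partial>P)"
  proof (rule split)
    show "(\<lambda>x. Max ((\<lambda>k. h k + (\<Sum>j\<in>insert i I. u k (x j) - m k)) ` K)) \<in>
        borel_measurable (PiM (insert i I) (\<lambda>_. M))"
      using K by (intro borel_measurable_Max) measurable
    show "Max ((\<lambda>k. h k + (\<Sum>j\<in>insert i I. u k ((x(i := y)) j) - m k)) ` K) =
      gen 1 (-1) 0 1 0 (\<lambda>_. 0) (y, x)" for x y
      unfolding gen_def case_prod_conv sum.insert[OF insert(1,2)] upd[of "\<lambda>j z. u k z - m k" for k]
      by (simp add: algebra_simps)
  qed
  also have "\<dots> = (\<integral>y. (\<integral>x. gen 1 (-1) 0 1 0 (\<lambda>_. 0) (y, x) \<partial>P) \<partial>M)" by (rule swap[symmetric])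
  also have "\<dots> \<le> (\<integral>y. rad_avg I (\<lambda>e. \<integral>x. gen 1 (-1) 0 0 (2 * L) e (y, x) \<partial>P) \<partial>M)"
  proof (intro integral_mono intM)
    show "integrable M (\<lambda>y. rad_avg I (\<lambda>e. \<integral>x. gen 1 (-1) 0 0 (2 * L) e (y, x) \<partial>P))"
      by (rule integrable_rad_avg) (rule intM)
    show "(\<integral>x. gen 1 (-1) 0 1 0 (\<lambda>_. 0) (y, x) \<partial>P) \<le> rad_avg I (\<lambda>e. \<integral>x. gen 1 (-1) 0 0 (2 * L) e (y, x) \<partial>P)" for y
      using insert.IH[of "\<lambda>k. h k + (u k y - m k)"] unfolding gen_def m_def P_def by simp
  qed
  also have "\<dots> = rad_avg I (\<lambda>e. \<integral>y. (\<integral>x. gen 1 (-1) 0 0 (2 * L) e (y, x) \<partial>P) \<partial>M)"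
    by (rule integral_rad_avg) (rule intM)
  also have "\<dots> = rad_avg I (\<lambda>e. \<integral>x. (\<integral>y. gen 1 (-1) 0 0 (2 * L) e (y, x) \<partial>M) \<partial>P)"
    unfolding swap ..
  also have "\<dots> \<le> rad_avg I (\<lambda>e. \<integral>x. ((\<integral>y. gen 0 0 (2 * L) 0 (2 * L) e (y, x) \<partial>M) + (\<integral>y. gen 0 0 (- (2 * L)) 0 (2 * L) e (y, x) \<partial>M)) / 2 \<partial>P)"
  proof (intro rad_avg_mono integral_mono intP integrable_divide Bochner_Integration.integrable_add)
    fix e :: "nat \<Rightarrow> real" and x
    show "(\<integral>y. gen 1 (-1) 0 0 (2 * L) e (y, x) \<partial>M) \<le>
      ((\<integral>y. gen 0 0 (2 * L) 0 (2 * L) e (y, x) \<partial>M) + (\<integral>y. gen 0 0 (- (2 * L)) 0 (2 * L) e (y, x) \<partial>M)) / 2"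
      using symmetrization_single[where u = u and v = v and h = "\<lambda>k. h k + 2 * L * (\<Sum>j\<in>I. e j * v k (x j))",
          OF prob_space_axioms K u v B L]
      unfolding gen_def m_def by (simp add: algebra_simps)
  qed
  also have "\<dots> = (rad_avg I (\<lambda>e. \<integral>x. (\<integral>y. gen 0 0 (2 * L) 0 (2 * L) e (y, x) \<partial>M) \<partial>P) +
      rad_avg I (\<lambda>e. \<integral>x. (\<integral>y. gen 0 0 (- (2 * L)) 0 (2 * L) e (y, x) \<partial>M) \<partial>P)) / 2"
    using intP rad_avg_cmult[of I "1 / 2"] by (simp add: rad_avg_add)
  \<comment> \<open>The two halves are the two values of the new sign.\<close>
  also have "\<dots> = rad_avg (insert i I) (\<lambda>e. \<integral>x. Max ((\<lambda>k. h k + 2 * L * (\<Sum>j\<in>insert i I. e j * v k (x j))) ` K)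
      \<partial>PiM (insert i I) (\<lambda>_. M))"
  proof -
    have *: "(\<integral>x. Max ((\<lambda>k. h k + 2 * L * (\<Sum>j\<in>insert i I. (e(i := s)) j * v k (x j))) ` K) \<partial>PiM (insert i I) (\<lambda>_. M)) =
      (\<integral>x. (\<integral>y. gen 0 0 (s * (2 * L)) 0 (2 * L) e (y, x) \<partial>M) \<partial>P)" for e s
    proof (rule split)
      show "(\<lambda>x. Max ((\<lambda>k. h k + 2 * L * (\<Sum>j\<in>insert i I. (e(i := s)) j * v k (x j))) ` K)) \<in>
          borel_measurable (PiM (insert i I) (\<lambda>_. M))"
        using K by (intro borel_measurable_Max) measurable
      have e: "(\<Sum>j\<in>I. (e(i := s)) j * v k (x j)) = (\<Sum>j\<in>I. e j * v k (x j))" for k x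
        using insert(2) by (intro sum.cong) auto
      show "Max ((\<lambda>k. h k + 2 * L * (\<Sum>j\<in>insert i I. (e(i := s)) j * v k ((x(i := y)) j))) ` K) =
        gen 0 0 (s * (2 * L)) 0 (2 * L) e (y, x)" for x y
        unfolding gen_def case_prod_conv sum.insert[OF insert(1,2)] e upd[of "\<lambda>j z. e j * v k z" for k]
        by (simp add: algebra_simps)
    qed
    show ?thesis unfolding rad_avg_insert[OF insert(1,2)] * by simp
  qed
  finally show ?case unfolding m_def .
qed

text \<open>The majorant \<open>H\<close> may depend on sample and signs but not on
  \<open>k\<close>. Thus the size of \<open>K\<close> disappears, and the bound passes from finite
  nets of any resolution to the whole class.\<close>

corollary expected_max_deviation_le:
  fixes u v :: "'k \<Rightarrow> 'a \<Rightarrow> real" and H :: "(nat \<Rightarrow> 'a) \<Rightarrow> (nat \<Rightarrow> real) \<Rightarrow> real"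
  assumes M: "prob_space M" and I: "finite I" and K: "finite K" "K \<noteq> {}"
    and u [measurable]: "\<And>k. k \<in> K \<Longrightarrow> u k \<in> borel_measurable M"
    and v [measurable]: "\<And>k. k \<in> K \<Longrightarrow> v k \<in> borel_measurable M"
    and B: "\<And>k x. k \<in> K \<Longrightarrow> x \<in> space M \<Longrightarrow> \<bar>u k x\<bar> \<le> B \<and> \<bar>v k x\<bar> \<le> B"
    and L: "0 \<le> L" "\<And>k l x. k \<in> K \<Longrightarrow> l \<in> K \<Longrightarrow> x \<in> space M \<Longrightarrow> \<bar>u k x - u l x\<bar> \<le> L * \<bar>v k x - v l x\<bar>"
    and H: "\<And>k x e. k \<in> K \<Longrightarrow> x \<in> space (PiM I (\<lambda>_. M)) \<Longrightarrow> \<bar>\<Sum>i\<in>I. e i * v k (x i)\<bar> \<le> H x e"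
    and R: "\<And>x. x \<in> space (PiM I (\<lambda>_. M)) \<Longrightarrow> rad_avg I (H x) \<le> R"
  shows "(\<integral>x. Max ((\<lambda>k. \<Sum>i\<in>I. u k (x i) - (\<integral>y. u k y \<partial>M)) ` K) \<partial>PiM I (\<lambda>_. M)) \<le> 2 * L * R"
proof -
  interpret M: prob_space M by fact
  interpret PI: prob_space "PiM I (\<lambda>_. M)" by (intro prob_space_PiM M)
  have int: "integrable (PiM I (\<lambda>_. M)) (\<lambda>x. Max ((\<lambda>k. 2 * L * (\<Sum>i\<in>I. e i * v k (x i))) ` K))" for e
  proof (rule PI.integrable_bounded[of _ "2 * L * (\<Sum>i\<in>I. \<bar>e i\<bar> * B)"])
    show "(\<lambda>x. Max ((\<lambda>k. 2 * L * (\<Sum>i\<in>I. e i * v k (x i))) ` K)) \<in> borel_measurable (PiM I (\<lambda>_. M))"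
      using K by (intro borel_measurable_Max) measurable
    fix x assume x: "x \<in> space (PiM I (\<lambda>_. M))"
    show "\<bar>Max ((\<lambda>k. 2 * L * (\<Sum>i\<in>I. e i * v k (x i))) ` K)\<bar> \<le> 2 * L * (\<Sum>i\<in>I. \<bar>e i\<bar> * B)"
    proof (intro abs_Max_le K)
      fix k assume k: "k \<in> K"
      have "\<bar>e j * v k (x j)\<bar> \<le> \<bar>e j\<bar> * B" if "j \<in> I" for j
        using B[OF k, of "x j"] x that by (auto simp: abs_mult space_PiM intro!: mult_left_mono)
      then show "\<bar>2 * L * (\<Sum>i\<in>I. e i * v k (x i))\<bar> \<le> 2 * L * (\<Sum>i\<in>I. \<bar>e i\<bar> * B)"
        using L unfolding abs_mult[of "2 * L"]
        by (intro mult_mono order_trans[OF sum_abs] sum_mono) auto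
    qed
  qed
  have "(\<integral>x. Max ((\<lambda>k. \<Sum>i\<in>I. u k (x i) - (\<integral>y. u k y \<partial>M)) ` K) \<partial>PiM I (\<lambda>_. M)) \<le>
      rad_avg I (\<lambda>e. \<integral>x. Max ((\<lambda>k. 2 * L * (\<Sum>i\<in>I. e i * v k (x i))) ` K) \<partial>PiM I (\<lambda>_. M))"
    using symmetrization_contraction[OF M I K u v B L, where h = "\<lambda>_. 0"] by simp
  also have "\<dots> = (\<integral>x. rad_avg I (\<lambda>e. Max ((\<lambda>k. 2 * L * (\<Sum>i\<in>I. e i * v k (x i))) ` K)) \<partial>PiM I (\<lambda>_. M))"
    by (rule integral_rad_avg[symmetric]) (rule int)
  also have "\<dots> \<le> 2 * L * R"
  proof (rule PI.integral_le_bound)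
    show "integrable (PiM I (\<lambda>_. M)) (\<lambda>x. rad_avg I (\<lambda>e. Max ((\<lambda>k. 2 * L * (\<Sum>i\<in>I. e i * v k (x i))) ` K)))"
      by (rule integrable_rad_avg) (rule int)
    fix x assume x: "x \<in> space (PiM I (\<lambda>_. M))"
    have "rad_avg I (\<lambda>e. Max ((\<lambda>k. 2 * L * (\<Sum>i\<in>I. e i * v k (x i))) ` K)) \<le> rad_avg I (\<lambda>e. 2 * L * H x e)"
    proof (intro rad_avg_mono Max.boundedI)
      fix e z assume "z \<in> (\<lambda>k. 2 * L * (\<Sum>i\<in>I. e i * v k (x i))) ` K"
      then obtain k where k: "k \<in> K" "z = 2 * L * (\<Sum>i\<in>I. e i * v k (x i))" by auto
      have "(\<Sum>i\<in>I. e i * v k (x i)) \<le> H x e" using H[OF k(1) x, of e] by linarith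
      then show "z \<le> 2 * L * H x e"
        unfolding k(2) using L by (intro mult_left_mono) auto
    qed (use K in auto)
    also have "\<dots> \<le> 2 * L * R" unfolding rad_avg_cmult using R[OF x] L by (intro mult_left_mono) auto
    finally show "rad_avg I (\<lambda>e. Max ((\<lambda>k. 2 * L * (\<Sum>i\<in>I. e i * v k (x i))) ` K)) \<le> 2 * L * R" .
  qed
  finally show ?thesis .
qed

section \<open>Shallow networks on the unit cube\<close>


abbreviation unit_cube :: "(real ^ 'd) set" where
  "unit_cube \<equiv> {x. \<forall>i. 0 \<le> x $ i \<and> x $ i \<le> 1}"

lemma compact_unit_cube: "compact (unit_cube :: (real ^ 'd) set)"
proof -
  have "(unit_cube :: (real ^ 'd) set) = cbox (\<chi> i. 0) (\<chi> i. 1)" by (auto simp: mem_box_cart)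
  then show ?thesis by simp
qed

lemma norm1_nonneg [simp]: "0 \<le> norm1 w"
  by (simp add: norm1_def sum_nonneg)

lemma norm1_0 [simp]: "norm1 0 = 0"
  by (simp add: norm1_def)

lemma norm1_scale: "norm1 (c *\<^sub>R w) = \<bar>c\<bar> * norm1 w"
  by (simp add: norm1_def abs_mult sum_distrib_left)

lemma continuous_on_norm1: "continuous_on S norm1"
  unfolding norm1_def[abs_def] by (intro continuous_intros)

lemma compact_norm1_le: "compact {w. norm1 w \<le> c}"
  unfolding compact_eq_bounded_closed
proof
  show "bounded {w. norm1 w \<le> c}"
    unfolding bounded_iff norm1_def using norm_le_l1_cart order_trans by (intro exI[of _ c]) blast
  show "closed {w. norm1 w \<le> c}"
    using continuous_on_norm1 by (intro closed_Collect_le continuous_on_const)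
qed

lemma abs_inner_le_norm1:
  assumes "x \<in> unit_cube"
  shows "\<bar>w \<bullet> x\<bar> \<le> norm1 w"
proof -
  have "\<bar>w \<bullet> x\<bar> \<le> (\<Sum>i\<in>UNIV. \<bar>w $ i * x $ i\<bar>)" unfolding inner_vec_def by (simp add: sum_abs)
  also have "\<dots> \<le> norm1 w"
    unfolding norm1_def abs_mult using assms by (intro sum_mono mult_left_le) auto
  finally show ?thesis .
qed

text \<open>The range is restricted only at arguments that admissible weights produce on the cube,
  since \<open>relu\<close> is unbounded; the lower bound 0 serves the layer cake formula. The type
  argument fixes the dimension of the cube.\<close>

definition bounded_ridge :: "(real \<Rightarrow> real) \<Rightarrow> real \<Rightarrow> real \<Rightarrow> 'd::finite itself \<Rightarrow> bool" where
  "bounded_ridge \<phi> a1 B (_ :: 'd itself) \<longleftrightarrow> mono \<phi> \<and> continuous_on UNIV \<phi> \<and> 0 \<le> a1 \<and> 0 \<le> B \<and>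
     (\<forall>w b. \<forall>x\<in>(unit_cube :: (real ^ 'd) set). norm1 w \<le> a1 \<longrightarrow> \<bar>b\<bar> \<le> a1 \<longrightarrow>
       0 \<le> \<phi> (w \<bullet> x + b) \<and> \<phi> (w \<bullet> x + b) \<le> B)"

lemma bounded_ridge_relu: "bounded_ridge relu 1 2 TYPE('d::finite)"
  unfolding bounded_ridge_def
proof (intro conjI allI ballI impI)
  show "mono relu" by (auto simp: mono_def relu_def)
  show "continuous_on UNIV relu" unfolding relu_def[abs_def] by (intro continuous_intros)
  fix w x :: "real ^ 'd" and b :: real assume "x \<in> unit_cube" "norm1 w \<le> 1" "\<bar>b\<bar> \<le> 1"
  then show "relu (w \<bullet> x + b) \<le> 2" "0 \<le> relu (w \<bullet> x + b)"
    using abs_inner_le_norm1[of x w] by (auto simp: relu_def)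
qed auto

lemma sigmoid_bounds: "0 < sigmoid z" "sigmoid z < 1"
  by (auto simp: sigmoid_def divide_simps add_pos_pos)

lemma bounded_ridge_sigmoid: "0 \<le> a1 \<Longrightarrow> bounded_ridge sigmoid a1 1 TYPE('d::finite)"
  unfolding bounded_ridge_def
proof (intro conjI allI ballI impI)
  show "mono sigmoid" by (auto simp: mono_def sigmoid_def intro!: divide_left_mono mult_pos_pos add_pos_pos)
  have "1 + exp (- z) \<noteq> 0" for z :: real using exp_gt_zero[of "- z"] by linarith
  then show "continuous_on UNIV sigmoid" unfolding sigmoid_def[abs_def] by (intro continuous_intros) auto
qed (use sigmoid_bounds in \<open>auto intro: less_imp_le\<close>)

lemma networksE:
  assumes "g \<in> networks k a1 a2 a3 a4 \<phi>"
  obtains \<beta> w b w0 b0 where "\<And>x. g x = (\<Sum>i=1..k. \<beta> i * \<phi> (w i \<bullet> x + b i)) + w0 \<bullet> x + b0"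
    "\<And>i. i \<in> {1..k} \<Longrightarrow> norm1 (w i) \<le> a1 \<and> \<bar>b i\<bar> \<le> a1 \<and> \<bar>\<beta> i\<bar> \<le> a2" "\<bar>b0\<bar> \<le> a3" "norm1 w0 \<le> a4"
  using assms by (auto simp: networks_def)

lemma networksI:
  assumes "\<And>x. g x = (\<Sum>i=1..k. \<beta> i * \<phi> (w i \<bullet> x + b i)) + w0 \<bullet> x + b0"
    "\<And>i. i \<in> {1..k} \<Longrightarrow> norm1 (w i) \<le> a1 \<and> \<bar>b i\<bar> \<le> a1 \<and> \<bar>\<beta> i\<bar> \<le> a2" "\<bar>b0\<bar> \<le> a3" "norm1 w0 \<le> a4"
  shows "g \<in> networks k a1 a2 a3 a4 \<phi>"
  unfolding networks_def using assms
  by (intro CollectI exI[of _ \<beta>] exI[of _ w] exI[of _ b] exI[of _ w0] exI[of _ b0]) auto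

text \<open>Exchanging the sums turns the Rademacher sum of a network into a combination of those of
  single neurons, of the coordinates (monotone with values in [0,1]) and of the constant 1. With
  outer weights of order \<open>1 / k\<close> the factor is free of \<open>k\<close>.\<close>

lemma network_signed_sum_le:
  fixes x :: "nat \<Rightarrow> real ^ 'd"
  assumes g: "g \<in> networks k a1 a2 a3 a4 \<phi>" and r: "bounded_ridge \<phi> a1 B TYPE('d)" and I: "finite I"
    and x: "\<And>i. i \<in> I \<Longrightarrow> x i \<in> unit_cube" and a: "0 \<le> a2" "0 \<le> a3" "0 \<le> a4"
  shows "\<bar>\<Sum>i\<in>I. e i * g (x i)\<bar> \<le> (k * a2 * B + a4 + a3) * halfspace_disc x I e"
proof -
  define H where "H = halfspace_disc x I e"
  have H: "0 \<le> H" unfolding H_def by (rule halfspace_disc_nonneg[OF I])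
  from g obtain \<beta> w b w0 b0 where
    g: "\<And>x. g x = (\<Sum>j=1..k. \<beta> j * \<phi> (w j \<bullet> x + b j)) + w0 \<bullet> x + b0" and
    bd: "\<And>j. j \<in> {1..k} \<Longrightarrow> norm1 (w j) \<le> a1 \<and> \<bar>b j\<bar> \<le> a1 \<and> \<bar>\<beta> j\<bar> \<le> a2" and
    b0: "\<bar>b0\<bar> \<le> a3" and w0: "norm1 w0 \<le> a4"
    by (rule networksE) blast
  have "(\<Sum>i\<in>I. e i * g (x i)) = (\<Sum>i\<in>I. \<Sum>j=1..k. e i * (\<beta> j * \<phi> (w j \<bullet> x i + b j))) +
      (\<Sum>i\<in>I. \<Sum>l\<in>UNIV. e i * (w0 $ l * x i $ l)) + (\<Sum>i\<in>I. e i * b0)"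
    unfolding g inner_vec_def by (simp add: sum.distrib distrib_left sum_distrib_left)
  also have "\<dots> = (\<Sum>j=1..k. \<beta> j * (\<Sum>i\<in>I. e i * \<phi> (w j \<bullet> x i + b j))) +
      (\<Sum>l\<in>UNIV. w0 $ l * (\<Sum>i\<in>I. e i * x i $ l)) + b0 * (\<Sum>i\<in>I. e i)"
    by (subst sum.swap, subst (2) sum.swap) (simp add: sum_distrib_left mult_ac)
  finally have eq: "(\<Sum>i\<in>I. e i * g (x i)) = (\<Sum>j=1..k. \<beta> j * (\<Sum>i\<in>I. e i * \<phi> (w j \<bullet> x i + b j))) +
      (\<Sum>l\<in>UNIV. w0 $ l * (\<Sum>i\<in>I. e i * x i $ l)) + b0 * (\<Sum>i\<in>I. e i)" .
  have 1: "\<bar>\<Sum>j=1..k. \<beta> j * (\<Sum>i\<in>I. e i * \<phi> (w j \<bullet> x i + b j))\<bar> \<le> (\<Sum>j=1..k. a2 * (B * H))"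
  proof (intro order_trans[OF sum_abs] sum_mono)
    fix j assume j: "j \<in> {1..k}"
    have "\<bar>\<Sum>i\<in>I. e i * \<phi> (w j \<bullet> x i + b j)\<bar> \<le> B * H"
      unfolding H_def using r bd[OF j] x by (intro ridge_signed_sum_le[OF I]) (auto simp: bounded_ridge_def)
    then show "\<bar>\<beta> j * (\<Sum>i\<in>I. e i * \<phi> (w j \<bullet> x i + b j))\<bar> \<le> a2 * (B * H)"
      unfolding abs_mult using bd[OF j] a by (intro mult_mono) auto
  qed
  have 2: "\<bar>\<Sum>l\<in>UNIV. w0 $ l * (\<Sum>i\<in>I. e i * x i $ l)\<bar> \<le> (\<Sum>l\<in>UNIV. \<bar>w0 $ l\<bar> * H)"
  proof (intro order_trans[OF sum_abs] sum_mono)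
    fix l
    have "\<bar>\<Sum>i\<in>I. e i * x i $ l\<bar> \<le> 1 * H"
      using ridge_signed_sum_le[OF I, of "\<lambda>z. z" 1 "axis l 1" x 0 e] x
      unfolding H_def by (auto simp: inner_axis' mono_def)
    then show "\<bar>w0 $ l * (\<Sum>i\<in>I. e i * x i $ l)\<bar> \<le> \<bar>w0 $ l\<bar> * H"
      unfolding abs_mult by (intro mult_left_mono) auto
  qed
  have "(\<Sum>l\<in>UNIV. \<bar>w0 $ l\<bar> * H) \<le> a4 * H"
    using w0 H unfolding norm1_def sum_distrib_right[symmetric] by (intro mult_right_mono) auto
  \<comment> \<open>The half-space with zero direction and threshold -1 contains all points.\<close>
  moreover have "\<bar>\<Sum>i\<in>I. e i\<bar> \<le> H"
    using halfspace_disc_ge[OF I, of e "-1" 0 x] by (simp add: H_def)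
  then have "\<bar>b0 * (\<Sum>i\<in>I. e i)\<bar> \<le> a3 * H"
    unfolding abs_mult using b0 a by (intro mult_mono) auto
  ultimately have "\<bar>\<Sum>i\<in>I. e i * g (x i)\<bar> \<le> (\<Sum>j=1..k. a2 * (B * H)) + a4 * H + a3 * H"
    unfolding eq using 1 2 by linarith
  also have "\<dots> = (k * a2 * B + a4 + a3) * H" by (simp add: algebra_simps)
  finally show ?thesis by (simp add: H_def)
qed

lemma network_bound:
  fixes g :: "real ^ 'd \<Rightarrow> real"
  assumes g: "g \<in> networks k a1 a2 a3 a4 \<phi>" and r: "bounded_ridge \<phi> a1 B TYPE('d)"
    and x: "x \<in> unit_cube" and a: "0 \<le> a2"
  shows "\<bar>g x\<bar> \<le> k * a2 * B + a4 + a3"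
proof -
  from g obtain \<beta> w b w0 b0 where
    g: "\<And>x. g x = (\<Sum>j=1..k. \<beta> j * \<phi> (w j \<bullet> x + b j)) + w0 \<bullet> x + b0" and
    bd: "\<And>j. j \<in> {1..k} \<Longrightarrow> norm1 (w j) \<le> a1 \<and> \<bar>b j\<bar> \<le> a1 \<and> \<bar>\<beta> j\<bar> \<le> a2" and
    b0: "\<bar>b0\<bar> \<le> a3" and w0: "norm1 w0 \<le> a4"
    by (rule networksE) blast
  have "\<bar>\<Sum>j=1..k. \<beta> j * \<phi> (w j \<bullet> x + b j)\<bar> \<le> (\<Sum>j=1..k. a2 * B)"
  proof (intro order_trans[OF sum_abs] sum_mono)
    fix j assume j: "j \<in> {1..k}"
    have "\<bar>\<phi> (w j \<bullet> x + b j)\<bar> \<le> B" using r bd[OF j] x by (auto simp: bounded_ridge_def)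
    then show "\<bar>\<beta> j * \<phi> (w j \<bullet> x + b j)\<bar> \<le> a2 * B"
      unfolding abs_mult using bd[OF j] a by (intro mult_mono) auto
  qed
  then show ?thesis unfolding g using abs_inner_le_norm1[OF x, of w0] b0 w0 by simp
qed

lemma continuous_on_network:
  assumes "g \<in> networks k a1 a2 a3 a4 \<phi>" "continuous_on UNIV \<phi>"
  shows "continuous_on UNIV g"
  using assms unfolding networks_def
  by (auto intro!: continuous_intros continuous_on_compose2[OF assms(2)])

lemma zero_in_networks:
  "0 \<le> a1 \<Longrightarrow> 0 \<le> a2 \<Longrightarrow> 0 \<le> a3 \<Longrightarrow> 0 \<le> a4 \<Longrightarrow> (\<lambda>_. 0) \<in> networks k a1 a2 a3 a4 \<phi>"
  by (rule networksI[where \<beta> = "\<lambda>_. 0" and w = "\<lambda>_. 0" and b = "\<lambda>_. 0" and ?w0.0 = 0 and ?b0.0 = 0]) auto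

lemma scale_in_networks:
  assumes "g \<in> networks k a1 a2 a3 a4 \<phi>" "0 \<le> s"
  shows "(\<lambda>x. s * g x) \<in> networks k a1 (s * a2) (s * a3) (s * a4) \<phi>"
proof -
  from assms(1) obtain \<beta> w b w0 b0 where
    g: "\<And>x. g x = (\<Sum>j=1..k. \<beta> j * \<phi> (w j \<bullet> x + b j)) + w0 \<bullet> x + b0" and
    bd: "\<And>j. j \<in> {1..k} \<Longrightarrow> norm1 (w j) \<le> a1 \<and> \<bar>b j\<bar> \<le> a1 \<and> \<bar>\<beta> j\<bar> \<le> a2" and
    b0: "\<bar>b0\<bar> \<le> a3" and w0: "norm1 w0 \<le> a4"
    by (rule networksE) blast
  show ?thesis
  proof (rule networksI)
    show "s * g x = (\<Sum>i = 1..k. s * \<beta> i * \<phi> (w i \<bullet> x + b i)) + (s *\<^sub>R w0) \<bullet> x + s * b0" for x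
      unfolding g by (simp add: distrib_left sum_distrib_left mult_ac)
  qed (use bd b0 w0 assms(2) in \<open>auto simp: abs_mult norm1_scale intro!: mult_left_mono\<close>)
qed

lemma networks_mono:
  assumes "a2 \<le> a2'" "a3 \<le> a3'" "a4 \<le> a4'"
  shows "networks k a1 a2 a3 a4 \<phi> \<subseteq> networks k a1 a2' a3' a4' \<phi>"
proof
  fix g assume "g \<in> networks k a1 a2 a3 a4 \<phi>"
  then obtain \<beta> w b w0 b0 where
    g: "\<And>x. g x = (\<Sum>j=1..k. \<beta> j * \<phi> (w j \<bullet> x + b j)) + w0 \<bullet> x + b0" and
    bd: "\<And>j. j \<in> {1..k} \<Longrightarrow> norm1 (w j) \<le> a1 \<and> \<bar>b j\<bar> \<le> a1 \<and> \<bar>\<beta> j\<bar> \<le> a2" and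
    b0: "\<bar>b0\<bar> \<le> a3" and w0: "norm1 w0 \<le> a4"
    by (rule networksE) blast
  show "g \<in> networks k a1 a2' a3' a4' \<phi>"
    by (rule networksI[OF g]) (use bd b0 w0 assms in \<open>auto intro: order_trans\<close>)
qed

text \<open>The net has to lie inside the class, so that its members inherit the bounds and the
  discrepancy estimate of the class.\<close>

definition finite_nets :: "'a set \<Rightarrow> ('a \<Rightarrow> real) set \<Rightarrow> bool" where
  "finite_nets X F \<longleftrightarrow> (\<forall>\<eta>>0. \<exists>F0\<subseteq>F. finite F0 \<and> (\<forall>g\<in>F. \<exists>g0\<in>F0. \<forall>x\<in>X. \<bar>g x - g0 x\<bar> \<le> \<eta>))"

lemma finite_netsE:
  assumes "finite_nets X F" "0 < \<eta>"
  obtains F0 where "F0 \<subseteq> F" "finite F0" "\<And>g. g \<in> F \<Longrightarrow> \<exists>g0\<in>F0. \<forall>x\<in>X. \<bar>g x - g0 x\<bar> \<le> \<eta>"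
proof -
  from assms have "\<exists>F0\<subseteq>F. finite F0 \<and> (\<forall>g\<in>F. \<exists>g0\<in>F0. \<forall>x\<in>X. \<bar>g x - g0 x\<bar> \<le> \<eta>)"
    by (simp add: finite_nets_def)
  then show ?thesis by (elim exE conjE) (rule that, auto)
qed

text \<open>Joint continuity on a compact product is uniform, so nearby parameters give uniformly
  close functions.\<close>

lemma finite_nets_compact_family:
  fixes \<Phi> :: "'p::metric_space \<times> 'x::metric_space \<Rightarrow> real"
  assumes P: "compact P" and X: "compact X" and c: "continuous_on (P \<times> X) \<Phi>"
  shows "finite_nets X ((\<lambda>p x. \<Phi> (p, x)) ` P)"
  unfolding finite_nets_def
proof (intro allI impI)
  fix \<eta> :: real assume "0 < \<eta>"
  have "uniformly_continuous_on (P \<times> X) \<Phi>" by (intro compact_uniformly_continuous c compact_Times P X)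
  then obtain d where d: "0 < d" "\<And>z z'. z \<in> P \<times> X \<Longrightarrow> z' \<in> P \<times> X \<Longrightarrow> dist z' z < d \<Longrightarrow> dist (\<Phi> z') (\<Phi> z) < \<eta>"
    using \<open>0 < \<eta>\<close> unfolding uniformly_continuous_on_def by metis
  obtain Q where Q: "Q \<subseteq> P" "finite Q" "P \<subseteq> (\<Union>q\<in>Q. ball q d)"
  proof (rule compactE_image[OF P, of P "\<lambda>q. ball q d"])
    show "P \<subseteq> (\<Union>q\<in>P. ball q d)" using d(1) by auto
  qed auto
  show "\<exists>F0\<subseteq>(\<lambda>p x. \<Phi> (p, x)) ` P. finite F0 \<and>
      (\<forall>g\<in>(\<lambda>p x. \<Phi> (p, x)) ` P. \<exists>g0\<in>F0. \<forall>x\<in>X. \<bar>g x - g0 x\<bar> \<le> \<eta>)"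
  proof (intro exI[of _ "(\<lambda>p x. \<Phi> (p, x)) ` Q"] conjI ballI)
    fix g assume "g \<in> (\<lambda>p x. \<Phi> (p, x)) ` P"
    then obtain p where p: "p \<in> P" "g = (\<lambda>x. \<Phi> (p, x))" by auto
    then obtain q where q: "q \<in> Q" "dist q p < d" using Q(3) by auto
    have "\<bar>g x - \<Phi> (q, x)\<bar> \<le> \<eta>" if "x \<in> X" for x
      using d(2)[of "(q, x)" "(p, x)"] p q Q(1) that
      by (auto simp: dist_Pair_Pair dist_commute dist_real_def)
    then show "\<exists>g0\<in>(\<lambda>p x. \<Phi> (p, x)) ` Q. \<forall>x\<in>X. \<bar>g x - g0 x\<bar> \<le> \<eta>" using q(1) by auto
  qed (use Q in auto)
qed

lemma finite_nets_add:
  assumes "finite_nets X F" "finite_nets X G"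
  shows "finite_nets X {\<lambda>x. f x + g x | f g. f \<in> F \<and> g \<in> G}"
  unfolding finite_nets_def
proof (intro allI impI)
  fix \<eta> :: real assume "0 < \<eta>"
  then have "0 < \<eta> / 2" by simp
  obtain F0 where F0: "F0 \<subseteq> F" "finite F0" "\<And>f. f \<in> F \<Longrightarrow> \<exists>f0\<in>F0. \<forall>x\<in>X. \<bar>f x - f0 x\<bar> \<le> \<eta> / 2"
    using finite_netsE[OF assms(1) \<open>0 < \<eta> / 2\<close>] by blast
  obtain G0 where G0: "G0 \<subseteq> G" "finite G0" "\<And>f. f \<in> G \<Longrightarrow> \<exists>f0\<in>G0. \<forall>x\<in>X. \<bar>f x - f0 x\<bar> \<le> \<eta> / 2"
    using finite_netsE[OF assms(2) \<open>0 < \<eta> / 2\<close>] by blast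
  define K where "K = (\<lambda>(f, g) x. f x + g x :: real) ` (F0 \<times> G0)"
  show "\<exists>K\<subseteq>{\<lambda>x. f x + g x | f g. f \<in> F \<and> g \<in> G}. finite K \<and>
      (\<forall>h\<in>{\<lambda>x. f x + g x | f g. f \<in> F \<and> g \<in> G}. \<exists>h0\<in>K. \<forall>x\<in>X. \<bar>h x - h0 x\<bar> \<le> \<eta>)"
  proof (intro exI[of _ K] conjI ballI)
    show "K \<subseteq> {\<lambda>x. f x + g x | f g. f \<in> F \<and> g \<in> G}"       using F0(1) G0(1) by (auto simp: K_def)
    show "finite K" using F0 G0 by (simp add: K_def)
    fix h assume "h \<in> {\<lambda>x. f x + g x | f g. f \<in> F \<and> g \<in> G}"
    then obtain f g where fg: "f \<in> F" "g \<in> G" "h = (\<lambda>x. f x + g x)" by auto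
    obtain f0 where f0: "f0 \<in> F0" "\<And>x. x \<in> X \<Longrightarrow> \<bar>f x - f0 x\<bar> \<le> \<eta> / 2" using F0(3)[OF fg(1)] by auto
    obtain g0 where g0: "g0 \<in> G0" "\<And>x. x \<in> X \<Longrightarrow> \<bar>g x - g0 x\<bar> \<le> \<eta> / 2" using G0(3)[OF fg(2)] by auto
    have "(\<lambda>x. f0 x + g0 x) \<in> K" using f0 g0 by (auto simp: K_def)
    moreover have "\<forall>x\<in>X. \<bar>h x - (f0 x + g0 x)\<bar> \<le> \<eta>"
    proof
      fix x assume "x \<in> X"
      then show "\<bar>h x - (f0 x + g0 x)\<bar> \<le> \<eta>" using f0(2)[of x] g0(2)[of x] unfolding fg by linarith
    qed
    ultimately show "\<exists>h0\<in>K. \<forall>x\<in>X. \<bar>h x - h0 x\<bar> \<le> \<eta>" by (intro bexI[of _ "\<lambda>x. f0 x + g0 x"])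
  qed
qed

text \<open>A network class is a Minkowski sum of \<open>k\<close> copies of the single-neuron
  family and one affine family, each with compact parameters. Induction on \<open>k\<close> avoids a
  topology on the space of parameter sequences.\<close>

lemma finite_nets_networks:
  assumes "continuous_on UNIV \<phi>"
  shows "finite_nets (unit_cube :: (real ^ 'd) set) (networks k a1 a2 a3 a4 \<phi>)"
proof -
  define unit where "unit = (\<lambda>((c, w, b), x :: real ^ 'd). c * \<phi> (w \<bullet> x + b) :: real)"
  define P where "P = {-a2..a2} \<times> {w :: real ^ 'd. norm1 w \<le> a1} \<times> {-a1..a1}"
  define U where "U = (\<lambda>p x. unit (p, x)) ` P"
  have U: "finite_nets unit_cube U"
    unfolding U_def
  proof (intro finite_nets_compact_family compact_unit_cube)
    show "compact P" unfolding P_def by (intro compact_Times compact_norm1_le compact_Icc)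
    show "continuous_on (P \<times> unit_cube) unit"
      unfolding unit_def case_prod_beta
      by (intro continuous_intros continuous_on_compose2[OF assms]) auto
  qed
  define V where "V = (\<lambda>k :: nat. {g. \<exists>\<beta> w b. g = (\<lambda>x :: real ^ 'd. \<Sum>i=1..k. \<beta> i * \<phi> (w i \<bullet> x + b i)) \<and>
     (\<forall>i\<in>{1..k}. (\<beta> i, w i, b i) \<in> P)})"
  have V: "finite_nets unit_cube (V k)" for k
  proof (induction k)
    case 0
    have "V 0 = {\<lambda>_. 0}" by (auto simp: V_def)
    then show ?case by (auto simp: finite_nets_def)
  next
    case (Suc k)
    have "V (Suc k) = {\<lambda>x. f x + g x | f g. f \<in> V k \<and> g \<in> U}"
    proof (intro set_eqI iffI)
      fix h assume "h \<in> V (Suc k)"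
      then obtain \<beta> w b where h: "h = (\<lambda>x :: real ^ 'd. \<Sum>i=1..Suc k. \<beta> i * \<phi> (w i \<bullet> x + b i))"
        "\<forall>i\<in>{1..Suc k}. (\<beta> i, w i, b i) \<in> P" unfolding V_def by blast
      have 1: "(\<lambda>x. \<Sum>i=1..k. \<beta> i * \<phi> (w i \<bullet> x + b i)) \<in> V k"
        unfolding V_def mem_Collect_eq using h(2) by (intro exI[of _ \<beta>] exI[of _ w] exI[of _ b]) auto
      have 2: "(\<lambda>x. unit ((\<beta> (Suc k), w (Suc k), b (Suc k)), x)) \<in> U" using h(2) unfolding U_def by auto
      have 3: "h = (\<lambda>x. (\<Sum>i=1..k. \<beta> i * \<phi> (w i \<bullet> x + b i)) + unit ((\<beta> (Suc k), w (Suc k), b (Suc k)), x))"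
        unfolding h unit_def by simp
      show "h \<in> {\<lambda>x. f x + g x | f g. f \<in> V k \<and> g \<in> U}"
        by (intro CollectI exI conjI) (rule 3, rule 1, rule 2)
    next
      fix h assume "h \<in> {\<lambda>x. f x + g x | f g. f \<in> V k \<and> g \<in> U}"
      then obtain f g where fg: "h = (\<lambda>x. f x + g x)" "f \<in> V k" "g \<in> U" by blast
      obtain \<beta> w b where f: "f = (\<lambda>x :: real ^ 'd. \<Sum>i=1..k. \<beta> i * \<phi> (w i \<bullet> x + b i))"
        "\<forall>i\<in>{1..k}. (\<beta> i, w i, b i) \<in> P" using fg(2) unfolding V_def by blast
      obtain c u d where g: "(c, u, d) \<in> P" "g = (\<lambda>x. c * \<phi> (u \<bullet> x + d))"
        using fg(3) unfolding U_def unit_def by auto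
      have "h = (\<lambda>x. \<Sum>i=1..Suc k. (\<beta>(Suc k := c)) i * \<phi> ((w(Suc k := u)) i \<bullet> x + (b(Suc k := d)) i))"
      proof
        fix x
        have "(\<Sum>i=1..k. (\<beta>(Suc k := c)) i * \<phi> ((w(Suc k := u)) i \<bullet> x + (b(Suc k := d)) i)) =
            (\<Sum>i=1..k. \<beta> i * \<phi> (w i \<bullet> x + b i))" by (intro sum.cong) auto
        then show "h x = (\<Sum>i=1..Suc k. (\<beta>(Suc k := c)) i * \<phi> ((w(Suc k := u)) i \<bullet> x + (b(Suc k := d)) i))"
          unfolding fg f g by simp
      qed
      moreover have "\<forall>i\<in>{1..Suc k}. ((\<beta>(Suc k := c)) i, (w(Suc k := u)) i, (b(Suc k := d)) i) \<in> P"
        using f(2) g(1) by auto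
      ultimately show "h \<in> V (Suc k)" unfolding V_def by blast
    qed
    then show ?case using finite_nets_add[OF Suc U] by simp
  qed
  define W where "W = (\<lambda>p x. (\<lambda>((w, b), x :: real ^ 'd). w \<bullet> x + b :: real) (p, x)) ` ({w :: real ^ 'd. norm1 w \<le> a4} \<times> {-a3..a3})"
  have W: "finite_nets unit_cube W"
    unfolding W_def
    by (intro finite_nets_compact_family compact_unit_cube compact_Times compact_norm1_le compact_Icc)
      (auto simp: case_prod_beta intro!: continuous_intros)
  have "networks k a1 a2 a3 a4 \<phi> = {\<lambda>x. f x + g x | f g. f \<in> V k \<and> g \<in> W}"
    unfolding networks_def
  proof (intro set_eqI iffI)
    fix h assume "h \<in> {g. \<exists>\<beta> w b w0 b0. g = (\<lambda>x :: real ^ 'd. (\<Sum>i=1..k. \<beta> i * \<phi> (w i \<bullet> x + b i)) + w0 \<bullet> x + b0) \<and>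
        (\<forall>i\<in>{1..k}. max (norm1 (w i)) \<bar>b i\<bar> \<le> a1 \<and> \<bar>\<beta> i\<bar> \<le> a2) \<and> \<bar>b0\<bar> \<le> a3 \<and> norm1 w0 \<le> a4}"
    then obtain \<beta> w b w0 b0 where h: "h = (\<lambda>x :: real ^ 'd. (\<Sum>i=1..k. \<beta> i * \<phi> (w i \<bullet> x + b i)) + w0 \<bullet> x + b0)"
      "\<forall>i\<in>{1..k}. max (norm1 (w i)) \<bar>b i\<bar> \<le> a1 \<and> \<bar>\<beta> i\<bar> \<le> a2" "\<bar>b0\<bar> \<le> a3" "norm1 w0 \<le> a4" by blast
    have 1: "(\<lambda>x. \<Sum>i=1..k. \<beta> i * \<phi> (w i \<bullet> x + b i)) \<in> V k"
      unfolding V_def mem_Collect_eq P_def using h(2)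
      by (intro exI[of _ \<beta>] exI[of _ w] exI[of _ b]) (auto simp: abs_le_iff)
    have 2: "(\<lambda>x. w0 \<bullet> x + b0) \<in> W"
      unfolding W_def using h(3,4) by (intro image_eqI[of _ _ "(w0, b0)"]) auto
    have 3: "h = (\<lambda>x. (\<Sum>i=1..k. \<beta> i * \<phi> (w i \<bullet> x + b i)) + (w0 \<bullet> x + b0))"
      unfolding h by (simp add: add.assoc)
    show "h \<in> {\<lambda>x. f x + g x | f g. f \<in> V k \<and> g \<in> W}"
      by (intro CollectI exI conjI) (rule 3, rule 1, rule 2)
  next
    fix h assume "h \<in> {\<lambda>x. f x + g x | f g. f \<in> V k \<and> g \<in> W}"
    then obtain f g where fg: "h = (\<lambda>x. f x + g x)" "f \<in> V k" "g \<in> W" by blast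
    obtain \<beta> w b where f: "f = (\<lambda>x :: real ^ 'd. \<Sum>i=1..k. \<beta> i * \<phi> (w i \<bullet> x + b i))"
      "\<forall>i\<in>{1..k}. (\<beta> i, w i, b i) \<in> P" using fg(2) unfolding V_def by blast
    obtain q where q: "q \<in> {w :: real ^ 'd. norm1 w \<le> a4} \<times> {-a3..a3}" "g = (\<lambda>x. fst q \<bullet> x + snd q)"
      using fg(3) unfolding W_def by (auto simp: case_prod_beta)
    define w0 b0 where "w0 = fst q" and "b0 = snd q"
    have g: "norm1 w0 \<le> a4" "\<bar>b0\<bar> \<le> a3" "g = (\<lambda>x. w0 \<bullet> x + b0)"
      using q by (auto simp: w0_def b0_def)
    have "h = (\<lambda>x. (\<Sum>i=1..k. \<beta> i * \<phi> (w i \<bullet> x + b i)) + w0 \<bullet> x + b0)"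
      unfolding fg f g by (simp add: add.assoc)
    moreover have "\<forall>i\<in>{1..k}. max (norm1 (w i)) \<bar>b i\<bar> \<le> a1 \<and> \<bar>\<beta> i\<bar> \<le> a2"
      using f(2) unfolding P_def by (auto simp: abs_le_iff)
    ultimately show "h \<in> {g. \<exists>\<beta> w b w0 b0. g = (\<lambda>x :: real ^ 'd. (\<Sum>i=1..k. \<beta> i * \<phi> (w i \<bullet> x + b i)) + w0 \<bullet> x + b0) \<and>
        (\<forall>i\<in>{1..k}. max (norm1 (w i)) \<bar>b i\<bar> \<le> a1 \<and> \<bar>\<beta> i\<bar> \<le> a2) \<and> \<bar>b0\<bar> \<le> a3 \<and> norm1 w0 \<le> a4}"
      using g by blast
  qed
  then show ?thesis using finite_nets_add[OF V W] by simp
qed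

section \<open>Maurey's argument\<close>


lemma (in prob_space) ex_le_integral:
  fixes q :: "'a \<Rightarrow> real"
  assumes "integrable M q" "(\<integral>x. q x \<partial>M) \<le> c" "AE x in M. P x"
  shows "\<exists>x\<in>space M. P x \<and> q x \<le> c"
proof (rule ccontr)
  assume *: "\<not> ?thesis"
  have "AE x in M. c < q x" using assms(3) AE_space by eventually_elim (use * in force)
  then have "(\<integral>x. c \<partial>M) < (\<integral>x. q x \<partial>M)"
    using assms(1) by (intro integral_less_AE_space) (auto simp: emeasure_space_1)
  then show False using assms(2) by (simp add: prob_space)
qed

text \<open>
  The sampling argument is derandomized: given the first \<open>n\<close> parameters, the cross term has mean
  zero in the next one, hence some choice increases the squared error by at most \<open>B\<^sup>2\<close>.
\<close>

lemma maurey_sum: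
  fixes \<phi> :: "'t \<Rightarrow> 'a \<Rightarrow> real" and n :: nat and B :: real and m :: "'a \<Rightarrow> real"
  assumes "prob_space R" "prob_space N"
    and meas: "(\<lambda>z. \<phi> (fst z) (snd z)) \<in> borel_measurable (R \<Otimes>\<^sub>M N)"
    and B: "\<And>\<theta> x. \<theta> \<in> space R \<Longrightarrow> x \<in> space N \<Longrightarrow> \<bar>\<phi> \<theta> x\<bar> \<le> B"
    and P: "AE \<theta> in R. P \<theta>"
  defines "m \<equiv> \<lambda>x. \<integral>\<theta>. \<phi> \<theta> x \<partial>R"
  shows "\<exists>t. (\<forall>i\<in>{1..n}. t i \<in> space R \<and> P (t i)) \<and>
    (\<integral>x. ((\<Sum>i=1..n. \<phi> (t i) x) - n * m x)\<^sup>2 \<partial>N) \<le> n * B\<^sup>2"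
proof (induction n)
  case 0
  then show ?case by simp
next
  case (Suc n)
  then obtain t where t: "\<And>i. i \<in> {1..n} \<Longrightarrow> t i \<in> space R \<and> P (t i)"
    and le: "(\<integral>x. ((\<Sum>i=1..n. \<phi> (t i) x) - n * m x)\<^sup>2 \<partial>N) \<le> n * B\<^sup>2" by blast
  interpret R: prob_space R by fact
  interpret N: prob_space N by fact
  interpret pair_prob_space R N ..
  have \<phi>m [measurable]: "\<phi> \<theta> \<in> borel_measurable N" if "\<theta> \<in> space R" for \<theta>
    using measurable_compose[OF measurable_Pair1'[OF that] meas] by simp
  have \<phi>r [measurable]: "(\<lambda>\<theta>. \<phi> \<theta> x) \<in> borel_measurable R" if "x \<in> space N" for x
    using measurable_compose[OF measurable_Pair2'[OF that] meas] by simp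
  have mm [measurable]: "m \<in> borel_measurable N"
    unfolding m_def using meas by (intro R.borel_measurable_lebesgue_integral) (subst (asm) measurable_pair_swap_iff, simp add: case_prod_beta)
  have mB: "\<bar>m x\<bar> \<le> B" if "x \<in> space N" for x
    unfolding m_def using that B by (intro R.abs_integral_le_bound) auto
  define S where "S = (\<lambda>x. (\<Sum>i=1..n. \<phi> (t i) x) - n * m x)"
  have Sm [measurable]: "S \<in> borel_measurable N"
    unfolding S_def
    by (intro borel_measurable_diff borel_measurable_sum borel_measurable_times borel_measurable_const mm \<phi>m)
      (use t in auto)
  have SB: "\<bar>S x\<bar> \<le> 2 * n * B" if x: "x \<in> space N" for x
  proof -
    have "\<bar>\<Sum>i=1..n. \<phi> (t i) x\<bar> \<le> (\<Sum>i=1..n. B)" using t B x by (intro order_trans[OF sum_abs] sum_mono) auto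
    moreover have "\<bar>n * m x\<bar> \<le> n * B" unfolding abs_mult using mB[OF x] by (intro mult_mono) auto
    ultimately show ?thesis unfolding S_def by (simp add: abs_le_iff)
  qed
  define q where "q = (\<lambda>\<theta> x. (S x + \<phi> \<theta> x - m x)\<^sup>2)"
  have qb: "\<bar>q \<theta> x\<bar> \<le> (2 * n * B + B + B)\<^sup>2" if "\<theta> \<in> space R" "x \<in> space N" for \<theta> x
  proof -
    have "\<bar>S x + \<phi> \<theta> x - m x\<bar> \<le> 2 * n * B + B + B" using SB mB B that by (smt (verit))
    then have "\<bar>S x + \<phi> \<theta> x - m x\<bar>\<^sup>2 \<le> (2 * n * B + B + B)\<^sup>2" by (intro power_mono) auto
    then show ?thesis by (simp add: q_def)
  qed
  have qm: "(\<lambda>z. q (fst z) (snd z)) \<in> borel_measurable (R \<Otimes>\<^sub>M N)" unfolding q_def using meas by measurable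
  note fub = fubini_bounded[OF R.prob_space_axioms N.prob_space_axioms qm, simplified, OF qb]
  have "(\<integral>\<theta>. (\<integral>x. q \<theta> x \<partial>N) \<partial>R) = (\<integral>x. (\<integral>\<theta>. q \<theta> x \<partial>R) \<partial>N)" by (rule fub(1))
  also have "\<dots> \<le> (\<integral>x. (S x)\<^sup>2 + B\<^sup>2 \<partial>N)"
  proof (intro integral_mono fub(3))
    show "integrable N (\<lambda>x. (S x)\<^sup>2 + B\<^sup>2)"
    proof (intro Bochner_Integration.integrable_add[OF N.integrable_bounded[of _ "(2 * n * B)\<^sup>2"]])
      fix x assume "x \<in> space N"
      then have "\<bar>S x\<bar>\<^sup>2 \<le> (2 * n * B)\<^sup>2" using SB by (intro power_mono) auto
      then show "\<bar>(S x)\<^sup>2\<bar> \<le> (2 * n * B)\<^sup>2" by simp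
    qed auto
    fix x assume x: "x \<in> space N"
    have i1: "integrable R (\<lambda>\<theta>. \<phi> \<theta> x)" using B x by (intro R.integrable_bounded[of _ B]) auto
    have b2: "\<bar>(\<phi> \<theta> x)\<^sup>2\<bar> \<le> B\<^sup>2" if "\<theta> \<in> space R" for \<theta>
      using power_mono[OF B[OF that x], of 2] by simp
    have i2: "integrable R (\<lambda>\<theta>. (\<phi> \<theta> x)\<^sup>2)" using b2 x by (intro R.integrable_bounded[of _ "B\<^sup>2"]) auto
    have "(\<integral>\<theta>. q \<theta> x \<partial>R) = (\<integral>\<theta>. (S x - m x)\<^sup>2 + 2 * (S x - m x) * \<phi> \<theta> x + (\<phi> \<theta> x)\<^sup>2 \<partial>R)"
      unfolding q_def by (intro Bochner_Integration.integral_cong refl) (simp add: power2_eq_square algebra_simps)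
    also have "\<dots> = (S x - m x)\<^sup>2 + 2 * (S x - m x) * m x + (\<integral>\<theta>. (\<phi> \<theta> x)\<^sup>2 \<partial>R)"
      using i1 i2 by (simp add: R.prob_space m_def)
    \<comment> \<open>The cross terms in \<open>S x\<close> cancel because
      \<open>\<phi> \<theta> x\<close> has mean \<open>m x\<close>; what remains besides the old
      error is a variance, at most \<open>B\<^sup>2\<close>.\<close>
    also have "\<dots> = (S x)\<^sup>2 - (m x)\<^sup>2 + (\<integral>\<theta>. (\<phi> \<theta> x)\<^sup>2 \<partial>R)" by (simp add: power2_eq_square algebra_simps)
    also have "\<dots> \<le> (S x)\<^sup>2 + B\<^sup>2"
      using R.integral_le_bound[OF i2, of "B\<^sup>2"] b2 by (smt (verit) zero_le_power2)
    finally show "(\<integral>\<theta>. q \<theta> x \<partial>R) \<le> (S x)\<^sup>2 + B\<^sup>2" .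
  qed
  also have "\<dots> = (\<integral>x. (S x)\<^sup>2 \<partial>N) + B\<^sup>2"
  proof -
    have "integrable N (\<lambda>x. (S x)\<^sup>2)"
    proof (intro N.integrable_bounded[of _ "(2 * n * B)\<^sup>2"])
      fix x assume "x \<in> space N"
      then have "\<bar>S x\<bar>\<^sup>2 \<le> (2 * n * B)\<^sup>2" using SB by (intro power_mono) auto
      then show "\<bar>(S x)\<^sup>2\<bar> \<le> (2 * n * B)\<^sup>2" by simp
    qed auto
    then show ?thesis by (simp add: N.prob_space)
  qed
  also have "\<dots> \<le> n * B\<^sup>2 + B\<^sup>2" using le by (simp add: S_def)
  finally obtain \<theta> where \<theta>: "\<theta> \<in> space R" "P \<theta>" "(\<integral>x. q \<theta> x \<partial>N) \<le> n * B\<^sup>2 + B\<^sup>2"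
    using R.ex_le_integral[OF fub(2) _ P] by blast
  have "(\<Sum>i=1..Suc n. \<phi> ((t(Suc n := \<theta>)) i) x) - Suc n * m x = S x + \<phi> \<theta> x - m x" for x
  proof -
    have "(\<Sum>i=1..n. \<phi> ((t(Suc n := \<theta>)) i) x) = (\<Sum>i=1..n. \<phi> (t i) x)" by (intro sum.cong) auto
    then show ?thesis by (simp add: S_def algebra_simps)
  qed
  then have "(\<integral>x. ((\<Sum>i=1..Suc n. \<phi> ((t(Suc n := \<theta>)) i) x) - Suc n * m x)\<^sup>2 \<partial>N) \<le> Suc n * B\<^sup>2"
    using \<theta>(3) by (simp add: q_def algebra_simps)
  moreover have "\<forall>i\<in>{1..Suc n}. (t(Suc n := \<theta>)) i \<in> space R \<and> P ((t(Suc n := \<theta>)) i)" using t \<theta> by auto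
  ultimately show ?case by blast
qed

corollary maurey_average:
  fixes \<phi> :: "'t \<Rightarrow> 'a \<Rightarrow> real" and n :: nat and B :: real
  assumes R: "prob_space R" and N: "prob_space N"
    and meas: "(\<lambda>z. \<phi> (fst z) (snd z)) \<in> borel_measurable (R \<Otimes>\<^sub>M N)"
    and B: "\<And>\<theta> x. \<theta> \<in> space R \<Longrightarrow> x \<in> space N \<Longrightarrow> \<bar>\<phi> \<theta> x\<bar> \<le> B" "0 < B"
    and P: "AE \<theta> in R. P \<theta>" and n: "1 \<le> n"
  shows "\<exists>t. (\<forall>i\<in>{1..n}. t i \<in> space R \<and> P (t i)) \<and>
    integrable N (\<lambda>x. \<bar>(\<Sum>i=1..n. \<phi> (t i) x / n) - (\<integral>\<theta>. \<phi> \<theta> x \<partial>R)\<bar>) \<and>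
    (\<integral>x. \<bar>(\<Sum>i=1..n. \<phi> (t i) x / n) - (\<integral>\<theta>. \<phi> \<theta> x \<partial>R)\<bar> \<partial>N) \<le> B / sqrt n"
proof -
  define m where "m = (\<lambda>x. \<integral>\<theta>. \<phi> \<theta> x \<partial>R)"
  obtain t where t: "\<And>i. i \<in> {1..n} \<Longrightarrow> t i \<in> space R \<and> P (t i)"
    and le: "(\<integral>x. ((\<Sum>i=1..n. \<phi> (t i) x) - n * m x)\<^sup>2 \<partial>N) \<le> n * B\<^sup>2"
    using maurey_sum[OF R N meas B(1) P, of n] unfolding m_def by blast
  interpret R: prob_space R by fact
  interpret N: prob_space N by fact
  interpret pair_prob_space R N ..
  have \<phi>m [measurable]: "\<phi> \<theta> \<in> borel_measurable N" if "\<theta> \<in> space R" for \<theta>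
    using measurable_compose[OF measurable_Pair1'[OF that] meas] by simp
  have \<phi>r [measurable]: "(\<lambda>\<theta>. \<phi> \<theta> x) \<in> borel_measurable R" if "x \<in> space N" for x
    using measurable_compose[OF measurable_Pair2'[OF that] meas] by simp
  have mm [measurable]: "m \<in> borel_measurable N"
    unfolding m_def using meas by (intro R.borel_measurable_lebesgue_integral) (subst (asm) measurable_pair_swap_iff, simp add: case_prod_beta)
  have mB: "\<bar>m x\<bar> \<le> B" if "x \<in> space N" for x
    unfolding m_def using that B by (intro R.abs_integral_le_bound) auto
  define Z where "Z = (\<lambda>x. (\<Sum>i=1..n. \<phi> (t i) x / n) - m x)"
  have Zm [measurable]: "Z \<in> borel_measurable N"
    unfolding Z_def
    by (intro borel_measurable_diff borel_measurable_sum borel_measurable_divide borel_measurable_const mm \<phi>m)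
      (use t in auto)
  have ZB: "\<bar>Z x\<bar> \<le> 2 * B" if x: "x \<in> space N" for x
  proof -
    have "\<bar>\<Sum>i=1..n. \<phi> (t i) x / n\<bar> \<le> (\<Sum>i=1..n. B / n)"
      using t B x by (intro order_trans[OF sum_abs] sum_mono) (auto intro!: divide_right_mono)
    then show ?thesis using mB[OF x] n unfolding Z_def by simp
  qed
  have Zi: "integrable N (\<lambda>x. \<bar>Z x\<bar>)" using ZB by (intro N.integrable_bounded[of _ "2 * B"]) auto
  have Z2i: "integrable N (\<lambda>x. (Z x)\<^sup>2)"
  proof (intro N.integrable_bounded[of _ "(2 * B)\<^sup>2"])
    fix x assume "x \<in> space N"
    then have "\<bar>Z x\<bar>\<^sup>2 \<le> (2 * B)\<^sup>2" using ZB by (intro power_mono) auto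
    then show "\<bar>(Z x)\<^sup>2\<bar> \<le> (2 * B)\<^sup>2" by simp
  qed auto
  define c where "c = B / sqrt n"
  have c: "0 < c" using B n by (simp add: c_def)
  have "(\<integral>x. (Z x)\<^sup>2 \<partial>N) = (\<integral>x. ((\<Sum>i=1..n. \<phi> (t i) x) - n * m x)\<^sup>2 / (real n)\<^sup>2 \<partial>N)"
  proof (intro Bochner_Integration.integral_cong refl)
    fix x
    have "Z x = ((\<Sum>i=1..n. \<phi> (t i) x) - n * m x) / n"
      using n by (simp add: Z_def sum_divide_distrib[symmetric] diff_divide_distrib)
    then show "(Z x)\<^sup>2 = ((\<Sum>i=1..n. \<phi> (t i) x) - n * m x)\<^sup>2 / (real n)\<^sup>2" by (simp add: power_divide)
  qed
  also have "\<dots> \<le> n * B\<^sup>2 / (real n)\<^sup>2" using le by (simp add: divide_right_mono)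
  also have "\<dots> = c\<^sup>2" using n by (simp add: c_def power_divide power2_eq_square)
  finally have Z2: "(\<integral>x. (Z x)\<^sup>2 \<partial>N) \<le> c\<^sup>2" .
  \<comment> \<open>The arithmetic-geometric mean inequality, weighted by the target bound
    \<open>c\<close>, replaces Cauchy-Schwarz in passing from the squared to the absolute
    error.\<close>
  have "(\<integral>x. \<bar>Z x\<bar> \<partial>N) \<le> (\<integral>x. ((Z x)\<^sup>2 / c + c) / 2 \<partial>N)"
  proof (intro integral_mono Zi)
    fix x
    have "0 \<le> (\<bar>Z x\<bar> - c)\<^sup>2" by simp
    then have "2 * \<bar>Z x\<bar> * c \<le> (Z x)\<^sup>2 + c\<^sup>2" by (simp add: power2_diff)
    then show "\<bar>Z x\<bar> \<le> ((Z x)\<^sup>2 / c + c) / 2" using c by (simp add: field_simps power2_eq_square)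
  qed (use Z2i in auto)
  also have "\<dots> = ((\<integral>x. (Z x)\<^sup>2 \<partial>N) / c + c) / 2" using Z2i by (simp add: N.prob_space)
  also have "\<dots> \<le> c" using Z2 c by (simp add: field_simps power2_eq_square)
  finally show ?thesis using t Zi unfolding Z_def m_def c_def by blast
qed

section \<open>Integral representations along a frequency\<close>


lemma lborel_integral_indicator_cong:
  fixes f g :: "real \<Rightarrow> real"
  assumes "\<And>t. t \<noteq> a \<Longrightarrow> t \<noteq> b \<Longrightarrow> f t = g t" "f \<in> borel_measurable lborel" "g \<in> borel_measurable lborel"
  shows "(\<integral>t. f t \<partial>lborel) = (\<integral>t. g t \<partial>lborel)"
proof (rule integral_cong_AE)
  have "AE t in lborel. t \<notin> {a, b}" by (intro AE_not_in countable_imp_null_set_lborel) auto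
  then show "AE t in lborel. f t = g t" by eventually_elim (use assms(1) in auto)
qed (use assms in auto)

text \<open>For \<open>t > 0\<close> the step is that of \<open>t < z\<close>, for
  \<open>t < 0\<close> it is minus that of \<open>z < t\<close>. Hence only the \<open>t\<close>
  between 0 and \<open>z\<close> count, with the sign of \<open>z\<close>, and the fundamental
  theorem of calculus applies. The sign inside the step lets one increasing activation serve both
  half-lines.\<close>

lemma step_representation:
  fixes F F' :: "real \<Rightarrow> real"
  assumes d: "\<And>t. DERIV F t :> F' t" and c: "continuous_on UNIV F'" and z: "\<bar>z\<bar> \<le> 1"
  shows "F z - F 0 = (\<integral>t. indicator {-1..1} t * (sgn t * F' t * (if 0 < sgn t * (z - t) then 1 else 0)) \<partial>lborel)"
proof -
  have ic: "isCont F' t" for t using c by (simp add: continuous_on_eq_continuous_at)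
  have [measurable]: "F' \<in> borel_measurable borel" using c by (rule borel_measurable_continuous_onI)
  have eq: "(\<integral>t. indicator {-1..1} t * (sgn t * F' t * (if 0 < sgn t * (z - t) then 1 else 0)) \<partial>lborel) =
      (\<integral>t. (sgn z * F' t) * indicator {min 0 z..max 0 z} t \<partial>lborel)"
    using z by (intro lborel_integral_indicator_cong[of 0 z])
      (auto simp: indicator_def sgn_if abs_le_iff zero_less_mult_iff split: if_splits)
  show ?thesis
  proof (cases "0 \<le> z")
    case True
    have "(\<integral>t. (sgn z * F' t) * indicator {0..z} t \<partial>lborel) = sgn z * F z - sgn z * F 0"
      using True ic by (intro integral_FTC_Icc_real[where F = "\<lambda>t. sgn z * F t"]) (auto intro!: derivative_eq_intros d)
    then show ?thesis unfolding eq using True by (auto simp: sgn_if)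
  next
    case False
    have "(\<integral>t. (sgn z * F' t) * indicator {z..0} t \<partial>lborel) = sgn z * F 0 - sgn z * F z"
      using False ic by (intro integral_FTC_Icc_real[where F = "\<lambda>t. sgn z * F t"]) (auto intro!: derivative_eq_intros d)
    then show ?thesis unfolding eq using False by (auto simp: sgn_if)
  qed
qed

text \<open>Taylor's formula with integral remainder: the relu factor equals the distance of
  \<open>z\<close> and \<open>t\<close> for \<open>t\<close> between 0 and \<open>z\<close>, and
  vanishes for all other \<open>t\<close> in [-1,1]. The mixture is exact, so relu networks need no
  growing weights.\<close>

lemma relu_representation:
  fixes F F' F'' :: "real \<Rightarrow> real"
  assumes d: "\<And>t. DERIV F t :> F' t" and d': "\<And>t. DERIV F' t :> F'' t"
    and c: "continuous_on UNIV F''" and z: "\<bar>z\<bar> \<le> 1"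
  shows "F z - F 0 - F' 0 * z = (\<integral>t. indicator {-1..1} t * (F'' t * relu (sgn t * (z - t))) \<partial>lborel)"
proof -
  have ic: "isCont F'' t" for t using c by (simp add: continuous_on_eq_continuous_at)
  have [measurable]: "F'' \<in> borel_measurable borel" using c by (rule borel_measurable_continuous_onI)
  have eq: "(\<integral>t. indicator {-1..1} t * (F'' t * relu (sgn t * (z - t))) \<partial>lborel) =
      (\<integral>t. (F'' t * (sgn z * (z - t))) * indicator {min 0 z..max 0 z} t \<partial>lborel)"
    using z unfolding relu_def by (intro lborel_integral_indicator_cong[of 0 z])
      (auto simp: indicator_def sgn_if abs_le_iff max_def split: if_splits)
  show ?thesis
  proof (cases "0 \<le> z")
    case True
    have "(\<integral>t. (F'' t * (sgn z * (z - t))) * indicator {0..z} t \<partial>lborel) =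
        sgn z * (F' z * (z - z) + F z) - sgn z * (F' 0 * (z - 0) + F 0)"
      using True ic by (intro integral_FTC_Icc_real[where F = "\<lambda>t. sgn z * (F' t * (z - t) + F t)"])
        (auto intro!: derivative_eq_intros d d' simp: algebra_simps)
    then show ?thesis unfolding eq using True by (auto simp: sgn_if)
  next
    case False
    have "(\<integral>t. (F'' t * (sgn z * (z - t))) * indicator {z..0} t \<partial>lborel) =
        sgn z * (F' 0 * (z - 0) + F 0) - sgn z * (F' z * (z - z) + F z)"
      using False ic by (intro integral_FTC_Icc_real[where F = "\<lambda>t. sgn z * (F' t * (z - t) + F t)"])
        (auto intro!: derivative_eq_intros d d' simp: algebra_simps)
    then show ?thesis unfolding eq using False by (auto simp: sgn_if algebra_simps)
  qed
qed

text \<open>The error decays exponentially away from the jump, so that its integral over the jump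
  position is at most \<open>2 / \<tau>\<close>.\<close>

lemma sigmoid_step_error:
  assumes "0 \<le> \<tau>"
  shows "\<bar>(if 0 < s then 1 else 0) - sigmoid (\<tau> * s)\<bar> \<le> exp (- \<tau> * \<bar>s\<bar>)"
proof (cases "0 < s")
  case True
  have "1 - sigmoid (\<tau> * s) = exp (- (\<tau> * s)) / (1 + exp (- (\<tau> * s)))"
    using add_pos_pos[of 1 "exp (- (\<tau> * s))"] by (simp add: sigmoid_def field_simps)
  also have "\<dots> \<le> exp (- (\<tau> * s))" by (simp add: divide_simps add_pos_pos)
  finally show ?thesis using True sigmoid_bounds(2)[of "\<tau> * s"] by simp
next
  case False
  have "sigmoid (\<tau> * s) = exp (\<tau> * s) / (exp (\<tau> * s) + 1)"
    by (simp add: sigmoid_def exp_minus divide_simps add_pos_pos)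
  also have "\<dots> \<le> exp (\<tau> * s)" by (simp add: divide_simps add_pos_pos)
  finally show ?thesis using False sigmoid_bounds(1)[of "\<tau> * s"] by simp
qed

lemma abs_sigmoid_le: "\<bar>sigmoid z\<bar> \<le> 1"
  using sigmoid_bounds[of z] by simp

lemma lborel_integral_exp_abs_le:
  fixes \<tau> z :: real
  assumes \<tau>: "0 < \<tau>" and z: "\<bar>z\<bar> \<le> 1"
  shows "(\<integral>t. indicator {-1..1} t * exp (- \<tau> * \<bar>z - t\<bar>) \<partial>lborel) \<le> 2 / \<tau>"
    and "integrable lborel (\<lambda>t. indicator {-1..1} t * exp (- \<tau> * \<bar>z - t\<bar>))"
proof -
  have 1: "has_bochner_integral lborel (\<lambda>t. exp (- \<tau> * (z - t)) * indicator {-1..z} t)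
      (exp (- \<tau> * (z - z)) / \<tau> - exp (- \<tau> * (z - - 1)) / \<tau>)"
    using z \<tau> by (intro has_bochner_integral_FTC_Icc_real[where F = "\<lambda>t::real. exp (- \<tau> * (z - t)) / \<tau>"])
      (auto intro!: derivative_eq_intros)
  have 2: "has_bochner_integral lborel (\<lambda>t. exp (- \<tau> * (t - z)) * indicator {z..1} t)
      (- exp (- \<tau> * (1 - z)) / \<tau> - - exp (- \<tau> * (z - z)) / \<tau>)"
    using z \<tau> by (intro has_bochner_integral_FTC_Icc_real[where F = "\<lambda>t::real. - exp (- \<tau> * (t - z)) / \<tau>"])
      (auto intro!: derivative_eq_intros)
  note 3 = has_bochner_integral_add[OF 1 2]
  have le: "indicator {-1..1} t * exp (- \<tau> * \<bar>z - t\<bar>) \<le>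
      exp (- \<tau> * (z - t)) * indicator {-1..z} t + exp (- \<tau> * (t - z)) * indicator {z..1} t" for t :: real
    using z by (auto simp: indicator_def abs_if)
  show i: "integrable lborel (\<lambda>t. indicator {-1..1} t * exp (- \<tau> * \<bar>z - t\<bar>))"
  proof (rule Bochner_Integration.integrable_bound[OF integrable.intros[OF 3]])
    show "AE t in lborel. norm (indicator {-1..1} t * exp (- \<tau> * \<bar>z - t\<bar>)) \<le>
        norm (exp (- \<tau> * (z - t)) * indicator {-1..z} t + exp (- \<tau> * (t - z)) * indicator {z..1} t)"
      using le by (intro AE_I2) (auto simp: abs_mult indicator_def)
  qed auto
  have "(\<integral>t. indicator {-1..1} t * exp (- \<tau> * \<bar>z - t\<bar>) \<partial>lborel) \<le>
      (\<integral>t. exp (- \<tau> * (z - t)) * indicator {-1..z} t + exp (- \<tau> * (t - z)) * indicator {z..1} t \<partial>lborel)"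
    using i integrable.intros[OF 3] le by (intro integral_mono) auto
  also have "\<dots> = (exp (- \<tau> * (z - z)) / \<tau> - exp (- \<tau> * (z - - 1)) / \<tau>) +
      (- exp (- \<tau> * (1 - z)) / \<tau> - - exp (- \<tau> * (z - z)) / \<tau>)"
    using 3 by (rule has_bochner_integral_integral_eq)
  also have "\<dots> \<le> 1 / \<tau> + 1 / \<tau>"
    using \<tau> by simp (smt (verit) divide_nonneg_pos exp_ge_zero)
  finally show "(\<integral>t. indicator {-1..1} t * exp (- \<tau> * \<bar>z - t\<bar>) \<partial>lborel) \<le> 2 / \<tau>" by simp
qed

lemma integrable_indicator_bounded:
  fixes f :: "real \<Rightarrow> real"
  assumes "f \<in> borel_measurable borel" "\<And>t. \<bar>t\<bar> \<le> 1 \<Longrightarrow> \<bar>f t\<bar> \<le> C"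
  shows "integrable lborel (\<lambda>t. indicator {-1..1} t * f t)"
proof (rule Bochner_Integration.integrable_bound)
  show "integrable lborel (\<lambda>t. C * indicator {-1..1::real} t)" by simp
  show "AE t in lborel. norm (indicator {-1..1} t * f t) \<le> norm (C * indicator {-1..1} t)"
  proof (intro AE_I2)
    fix t
    show "norm (indicator {-1..1} t * f t) \<le> norm (C * indicator {-1..1} t)"
      using assms(2)[of t] by (auto simp: indicator_def abs_le_iff intro: order_trans[OF _ abs_ge_self])
  qed
qed (use assms in measurable)

text \<open>The smoothed step is inserted into \<open>step_representation\<close>. The error is
  linear in the derivative bound \<open>r\<close>, which is \<open>norm1 \<omega>\<close> in the
  application, so a first spectral moment pays for it.\<close>

lemma sigmoid_representation_error:
  fixes F F' :: "real \<Rightarrow> real"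
  assumes d: "\<And>t. DERIV F t :> F' t" and c: "continuous_on UNIV F'" and z: "\<bar>z\<bar> \<le> 1"
    and r: "\<And>t. \<bar>F' t\<bar> \<le> r" and \<tau>: "0 < \<tau>"
  shows "\<bar>(F z - F 0) - (\<integral>t. indicator {-1..1} t * (sgn t * F' t * sigmoid (\<tau> * (sgn t * (z - t)))) \<partial>lborel)\<bar>
    \<le> r * (2 / \<tau>)"
proof -
  have [measurable]: "F' \<in> borel_measurable borel" using c by (rule borel_measurable_continuous_onI)
  have [measurable]: "sigmoid \<in> borel_measurable borel" unfolding sigmoid_def by measurable
  have r0: "0 \<le> r" using r[of 0] by linarith
  have b: "\<bar>sgn t * F' t * y\<bar> \<le> r" if "\<bar>y\<bar> \<le> 1" for t y
  proof -
    have "\<bar>sgn t\<bar> * \<bar>F' t\<bar> * \<bar>y\<bar> \<le> 1 * r * 1" using r that r0 by (intro mult_mono) (auto simp: sgn_if)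
    then show ?thesis by (simp add: abs_mult)
  qed
  have i1: "integrable lborel (\<lambda>t. indicator {-1..1} t * (sgn t * F' t * (if 0 < sgn t * (z - t) then 1 else 0)))"
    by (rule integrable_indicator_bounded[of _ r]) (measurable, rule b, simp)
  have i2: "integrable lborel (\<lambda>t. indicator {-1..1} t * (sgn t * F' t * sigmoid (\<tau> * (sgn t * (z - t)))))"
    by (rule integrable_indicator_bounded[of _ r])
      (measurable, rule b, rule abs_sigmoid_le)
  have "\<bar>(F z - F 0) - (\<integral>t. indicator {-1..1} t * (sgn t * F' t * sigmoid (\<tau> * (sgn t * (z - t)))) \<partial>lborel)\<bar> =
      \<bar>\<integral>t. indicator {-1..1} t * (sgn t * F' t * (if 0 < sgn t * (z - t) then 1 else 0)) -
         indicator {-1..1} t * (sgn t * F' t * sigmoid (\<tau> * (sgn t * (z - t)))) \<partial>lborel\<bar>"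
    unfolding step_representation[OF d c z] using i1 i2 by simp
  also have "\<dots> \<le> (\<integral>t. \<bar>indicator {-1..1} t * (sgn t * F' t * (if 0 < sgn t * (z - t) then 1 else 0)) -
         indicator {-1..1} t * (sgn t * F' t * sigmoid (\<tau> * (sgn t * (z - t))))\<bar> \<partial>lborel)"
    by (rule integral_abs_bound)
  also have "\<dots> \<le> (\<integral>t. r * (indicator {-1..1} t * exp (- \<tau> * \<bar>z - t\<bar>)) \<partial>lborel)"
  proof (rule integral_mono)
    fix t :: real
    show "\<bar>indicator {-1..1} t * (sgn t * F' t * (if 0 < sgn t * (z - t) then 1 else 0)) -
         indicator {-1..1} t * (sgn t * F' t * sigmoid (\<tau> * (sgn t * (z - t))))\<bar> \<le>
        r * (indicator {-1..1} t * exp (- \<tau> * \<bar>z - t\<bar>))"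
    \<comment> \<open>At \<open>t = 0\<close> the factor \<open>sgn t\<close> is 0 and both
      integrands vanish; elsewhere its modulus is 1.\<close>
    proof (cases "t = 0")
      case False
      have "\<bar>sgn t * F' t\<bar> * \<bar>(if 0 < sgn t * (z - t) then 1 else 0) - sigmoid (\<tau> * (sgn t * (z - t)))\<bar> \<le>
          r * exp (- \<tau> * \<bar>sgn t * (z - t)\<bar>)"
        using b[of 1 t] sigmoid_step_error[of \<tau> "sgn t * (z - t)"] \<tau> r0 by (intro mult_mono) auto
      moreover have "\<bar>sgn t * (z - t)\<bar> = \<bar>z - t\<bar>" using False by (auto simp: sgn_if abs_mult)
      ultimately show ?thesis
        unfolding right_diff_distrib[symmetric] abs_mult[of "indicator {-1..1} t"] abs_mult[of "sgn t * F' t"]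
        by (auto simp: indicator_def)
    qed (use r0 in auto)
  qed (use i1 i2 lborel_integral_exp_abs_le(2)[OF \<tau> z] in auto)
  also have "\<dots> \<le> r * (2 / \<tau>)" using lborel_integral_exp_abs_le(1)[OF \<tau> z] r0
    unfolding integral_mult_right_zero by (rule mult_left_mono)
  finally show ?thesis .
qed


section \<open>Sampling a mixture of ridge functions\<close>

lemma borel_measurable_norm1 [measurable]: "norm1 \<in> borel_measurable borel"
  by (intro borel_measurable_continuous_onI continuous_on_norm1)

text \<open>The neuron has weight
  \<open>(\<tau> * sgn t / norm1 \<omega>) *\<^sub>R \<omega>\<close> and bias
  \<open>- \<tau> * \<bar>t\<bar>\<close>, both within \<open>\<tau>\<close> for \<open>t\<close> in
  [-1,1]; at \<open>\<omega> = 0\<close> the weight is 0. The sigmoid case takes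
  \<open>\<tau>\<close> large, the relu case \<open>\<tau> = 1\<close>.\<close>

definition ridge_integral ::
  "(real ^ 'd \<Rightarrow> real \<Rightarrow> real) \<Rightarrow> (real \<Rightarrow> real) \<Rightarrow> real \<Rightarrow> real ^ 'd \<Rightarrow> real ^ 'd \<Rightarrow> real" where
  "ridge_integral K \<psi> \<tau> x \<omega> = (\<integral>t. indicator {-1..1} t * (K \<omega> t * \<psi> (((\<tau> * sgn t / norm1 \<omega>) *\<^sub>R \<omega>) \<bullet> x - \<tau> * \<bar>t\<bar>)) \<partial>lborel)"

text \<open>The parameters are drawn with \<open>\<omega>\<close> of density
  \<open>norm1 \<omega> ^ m / S\<close> under \<open>V\<close> and \<open>t\<close> uniform on
  [-1,1]. Undoing the two normalizations gives each neuron the factor \<open>2 * S\<close>, with 2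
  the length of the interval; divided by \<open>n\<close> this is the outer-weight bound of the
  network classes.\<close>

lemma ridge_mixture_approx_pos:
  fixes V :: "(real ^ 'd) measure" and K :: "real ^ 'd \<Rightarrow> real \<Rightarrow> real" and S :: real
  assumes V: "finite_measure V" "sets V = sets borel"
    and K: "(\<lambda>z. K (fst z) (snd z)) \<in> borel_measurable (borel \<Otimes>\<^sub>M borel)" "\<And>\<omega> t. \<bar>K \<omega> t\<bar> \<le> 1"
    and S: "integrable V (\<lambda>\<omega>. norm1 \<omega> ^ m)" "S = (\<integral>\<omega>. norm1 \<omega> ^ m \<partial>V)" "0 < S"
    and \<psi>: "bounded_ridge \<psi> \<tau> B TYPE('d)" "0 < B" and \<tau>: "0 \<le> \<tau>"
    and N: "prob_space N" "sets N = sets (restrict_space borel (unit_cube :: (real ^ 'd) set))" and n: "1 \<le> n"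
  shows "\<exists>\<beta> w b. (\<forall>i\<in>{1..n}. norm1 (w i) \<le> \<tau> \<and> \<bar>b i\<bar> \<le> \<tau> \<and> \<bar>\<beta> i\<bar> \<le> 2 * S / real n) \<and>
    integrable N (\<lambda>x. \<bar>(\<Sum>i=1..n. \<beta> i * \<psi> (w i \<bullet> x + b i)) - (\<integral>\<omega>. norm1 \<omega> ^ m * ridge_integral K \<psi> \<tau> x \<omega> \<partial>V)\<bar>) \<and>
    (\<integral>x. \<bar>(\<Sum>i=1..n. \<beta> i * \<psi> (w i \<bullet> x + b i)) - (\<integral>\<omega>. norm1 \<omega> ^ m * ridge_integral K \<psi> \<tau> x \<omega> \<partial>V)\<bar> \<partial>N)
      \<le> 2 * S * B / sqrt n"
proof -
  interpret V: finite_measure V by fact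
  have spN: "space N = unit_cube" using sets_eq_imp_space_eq[OF N(2)] by (simp add: space_restrict_space)
  define wt where "wt = (\<lambda>(\<omega> :: real ^ 'd) t. (\<tau> * sgn t / norm1 \<omega>) *\<^sub>R \<omega>)"
  have wt: "norm1 (wt \<omega> t) \<le> \<tau>" for \<omega> t
  proof -
    have "norm1 (wt \<omega> t) = \<tau> * \<bar>sgn t\<bar> * (norm1 \<omega> / norm1 \<omega>)"
      using \<tau> norm1_nonneg[of \<omega>] by (simp add: wt_def norm1_scale abs_mult)
    also have "\<dots> \<le> \<tau> * 1 * 1"
      using \<tau> norm1_nonneg[of \<omega>] by (intro mult_mono) (auto simp: sgn_if divide_le_eq_1)
    finally show ?thesis by simp
  qed
  define unit where "unit = (\<lambda>(\<theta> :: (real ^ 'd) \<times> real) x. K (fst \<theta>) (snd \<theta>) * \<psi> (wt (fst \<theta>) (snd \<theta>) \<bullet> x + - (\<tau> * \<bar>snd \<theta>\<bar>)))"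
  \<comment> \<open>\<open>U\<close> lives on the whole line although it is concentrated on [-1,1].
    Clipping makes the bounds on neuron and parameters hold everywhere and changes no
    integral.\<close>
  define clip where "clip = (\<lambda>t :: real. max (-1) (min 1 t))"
  define \<phi> where "\<phi> = (\<lambda>(\<theta> :: (real ^ 'd) \<times> real) x. 2 * S * unit (fst \<theta>, clip (snd \<theta>)) x)"
  define A where "A = density V (\<lambda>\<omega>. ennreal (norm1 \<omega> ^ m / S))"
  define U where "U = density lborel (\<lambda>t :: real. ennreal (indicator {-1..1} t / 2))"
  have [measurable]: "(\<lambda>\<omega>. norm1 \<omega> ^ m / S) \<in> borel_measurable V"
    unfolding measurable_cong_sets[OF V(2) refl] by measurable
  have A: "prob_space A"
  proof (rule prob_spaceI)
    have "emeasure A (space A) = (\<integral>\<^sup>+\<omega>. ennreal (norm1 \<omega> ^ m / S) \<partial>V)"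
      unfolding A_def by (simp add: emeasure_density cong: nn_integral_cong)
    also have "\<dots> = ennreal (\<integral>\<omega>. norm1 \<omega> ^ m / S \<partial>V)"
      using S(1,3) norm1_nonneg by (intro nn_integral_eq_integral AE_I2) auto
    also have "(\<integral>\<omega>. norm1 \<omega> ^ m / S \<partial>V) = 1" using S by simp
    finally show "emeasure A (space A) = 1" by simp
  qed
  have U: "prob_space U"
  proof (rule prob_spaceI)
    have "emeasure U (space U) = (\<integral>\<^sup>+t. ennreal (1 / 2) * indicator {-1..1::real} t \<partial>lborel)"
    proof -
      have "ennreal (indicator {-1..1} t / 2) = ennreal (1 / 2) * indicator {-1..1} t" for t :: real
        by (cases "t \<in> {-1..1}") auto
      then show ?thesis unfolding U_def by (subst emeasure_density) simp_all
    qed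
    also have "\<dots> = ennreal (1 / 2) * emeasure lborel {-1..1::real}" by (simp add: nn_integral_cmult_indicator)
    also have "\<dots> = ennreal (1 / 2) * ennreal 2" by simp
    also have "\<dots> = 1" by (subst ennreal_mult[symmetric]) auto
    finally show "emeasure U (space U) = 1" .
  qed
  interpret A: prob_space A by fact
  interpret U: prob_space U by fact
  interpret AU: pair_prob_space A U ..
  have sA: "sets A = sets borel" by (simp add: A_def V)
  have sU: "sets U = sets borel" by (simp add: U_def)
  have \<psi>m [measurable]: "\<psi> \<in> borel_measurable borel"
    using \<psi> by (intro borel_measurable_continuous_onI) (simp add: bounded_ridge_def)
  have clipm [measurable]: "clip \<in> borel_measurable borel" unfolding clip_def by measurable
  have clip: "\<bar>clip t\<bar> \<le> 1" for t by (auto simp: clip_def)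
  have \<psi>b: "\<bar>\<psi> (wt \<omega> t \<bullet> x + - (\<tau> * \<bar>t\<bar>))\<bar> \<le> B" if "x \<in> unit_cube" "\<bar>t\<bar> \<le> 1" for \<omega> t x
  proof -
    have "\<bar>- (\<tau> * \<bar>t\<bar>)\<bar> \<le> \<tau>" using \<tau> that(2) by (simp add: abs_mult mult_left_le)
    then have "0 \<le> \<psi> (wt \<omega> t \<bullet> x + - (\<tau> * \<bar>t\<bar>)) \<and> \<psi> (wt \<omega> t \<bullet> x + - (\<tau> * \<bar>t\<bar>)) \<le> B"
      using \<psi>(1) wt[of \<omega> t] that(1) unfolding bounded_ridge_def by blast
    then show ?thesis by simp
  qed
  have ub: "\<bar>unit (\<omega>, t) x\<bar> \<le> B" if "x \<in> unit_cube" "\<bar>t\<bar> \<le> 1" for \<omega> t x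
    using mult_mono[OF K(2)[of \<omega> t] \<psi>b[OF that, of \<omega>]] by (simp add: unit_def abs_mult)
  have \<phi>b: "\<bar>\<phi> \<theta> x\<bar> \<le> 2 * S * B" if "x \<in> unit_cube" for \<theta> x
    unfolding \<phi>_def abs_mult using ub[OF that clip] S by (intro mult_mono) auto
  have unit_meas: "(\<lambda>z. unit (f z, g z) (h z)) \<in> borel_measurable M"
    if [measurable]: "f \<in> measurable M borel" "g \<in> measurable M borel" "h \<in> measurable M borel" for M f g h
  proof -
    have [measurable]: "(\<lambda>z. K (f z) (g z)) \<in> borel_measurable M"
      using measurable_compose[OF measurable_Pair[OF that(1,2)] K(1)] by simp
    show ?thesis unfolding unit_def wt_def fst_conv snd_conv by measurable
  qed
  have idN: "(\<lambda>x. x) \<in> measurable N borel"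
    unfolding measurable_cong_sets[OF N(2) refl] by (intro measurable_restrict_space1) simp
  have \<phi>m: "(\<lambda>z. \<phi> (fst z) (snd z)) \<in> borel_measurable ((A \<Otimes>\<^sub>M U) \<Otimes>\<^sub>M N)"
  proof -
    have idA: "(\<lambda>x. x) \<in> measurable A borel" and idU: "(\<lambda>x. x) \<in> measurable U borel"
      by (simp_all add: measurable_ident_sets sA sU)
    have 1: "(\<lambda>z. fst (fst z)) \<in> measurable ((A \<Otimes>\<^sub>M U) \<Otimes>\<^sub>M N) borel"
      by (rule measurable_compose[OF measurable_compose[OF measurable_fst measurable_fst] idA])
    have 2: "(\<lambda>z. snd (fst z)) \<in> measurable ((A \<Otimes>\<^sub>M U) \<Otimes>\<^sub>M N) borel"
      by (rule measurable_compose[OF measurable_compose[OF measurable_fst measurable_snd] idU])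
    have 3: "(\<lambda>z. snd z) \<in> measurable ((A \<Otimes>\<^sub>M U) \<Otimes>\<^sub>M N) borel"
      by (rule measurable_compose[OF measurable_snd idN])
    show ?thesis
      unfolding \<phi>_def
      using unit_meas[OF 1 measurable_compose[OF 2 clipm] 3] by simp
  qed
  obtain t where ti: "integrable N (\<lambda>x. \<bar>(\<Sum>i=1..n. \<phi> (t i) x / n) - (\<integral>\<theta>. \<phi> \<theta> x \<partial>(A \<Otimes>\<^sub>M U))\<bar>)"
    and t: "(\<integral>x. \<bar>(\<Sum>i=1..n. \<phi> (t i) x / n) - (\<integral>\<theta>. \<phi> \<theta> x \<partial>(A \<Otimes>\<^sub>M U))\<bar> \<partial>N) \<le> 2 * S * B / sqrt n"
    using maurey_average[OF AU.prob_space_axioms N(1) \<phi>m _ _ _ n, of "2 * S * B" "\<lambda>_. True"] \<phi>b S \<psi>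
    unfolding spN by auto
  have mean: "(\<integral>\<theta>. \<phi> \<theta> x \<partial>(A \<Otimes>\<^sub>M U)) = (\<integral>\<omega>. norm1 \<omega> ^ m * ridge_integral K \<psi> \<tau> x \<omega> \<partial>V)"
    if x: "x \<in> unit_cube" for x
  proof -
    have [measurable]: "(\<lambda>z. \<phi> z x) \<in> borel_measurable (A \<Otimes>\<^sub>M U)"
      using measurable_compose[OF measurable_Pair2' \<phi>m, of x] x spN by simp
    have "(\<integral>\<theta>. \<phi> \<theta> x \<partial>(A \<Otimes>\<^sub>M U)) = (\<integral>\<omega>. (\<integral>t. \<phi> (\<omega>, t) x \<partial>U) \<partial>A)"
      using \<phi>b[OF x] by (intro AU.integral_fst'[symmetric] AU.integrable_bounded[of _ "2 * S * B"]) auto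
    also have "\<dots> = (\<integral>\<omega>. S * (\<integral>t. indicator {-1..1} t * unit (\<omega>, t) x \<partial>lborel) \<partial>A)"
    proof (intro Bochner_Integration.integral_cong refl)
      fix \<omega>
      have "(\<lambda>t. unit (\<omega>, clip t) x) \<in> borel_measurable borel" by (intro unit_meas) measurable
      then have "(\<integral>t. \<phi> (\<omega>, t) x \<partial>U) = (\<integral>t. indicator {-1..1} t / 2 * (2 * S * unit (\<omega>, clip t) x) \<partial>lborel)"
        unfolding U_def \<phi>_def by (subst integral_real_density) auto
      also have "\<dots> = (\<integral>t. S * (indicator {-1..1} t * unit (\<omega>, t) x) \<partial>lborel)"
        by (intro Bochner_Integration.integral_cong refl) (auto simp: indicator_def clip_def)
      finally show "(\<integral>t. \<phi> (\<omega>, t) x \<partial>U) = S * (\<integral>t. indicator {-1..1} t * unit (\<omega>, t) x \<partial>lborel)" by simp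
    qed
    also have "\<dots> = (\<integral>\<omega>. norm1 \<omega> ^ m / S * (S * (\<integral>t. indicator {-1..1} t * unit (\<omega>, t) x \<partial>lborel)) \<partial>V)"
      unfolding A_def
    proof (subst integral_real_density)
      have "(\<lambda>z. indicator {-1..1} (snd z) * unit (fst z, snd z) x) \<in> borel_measurable (borel \<Otimes>\<^sub>M lborel)"
        by (intro borel_measurable_times unit_meas) measurable
      then have "(\<lambda>\<omega>. \<integral>t. indicator {-1..1} t * unit (\<omega>, t) x \<partial>lborel) \<in> borel_measurable borel"
        by (intro lborel.borel_measurable_lebesgue_integral) (simp only: case_prod_unfold)
      then show "(\<lambda>\<omega>. S * (\<integral>t. indicator {-1..1} t * unit (\<omega>, t) x \<partial>lborel)) \<in> borel_measurable V"
        unfolding measurable_cong_sets[OF V(2) refl] by measurable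
    qed (use norm1_nonneg S in auto)
    also have "\<dots> = (\<integral>\<omega>. norm1 \<omega> ^ m * (\<integral>t. indicator {-1..1} t * unit (\<omega>, t) x \<partial>lborel) \<partial>V)"
      using S by (intro Bochner_Integration.integral_cong refl) simp
    finally show ?thesis by (simp add: unit_def wt_def ridge_integral_def)
  qed
  define \<beta> where "\<beta> = (\<lambda>i. 2 * S * K (fst (t i)) (clip (snd (t i))) / n)"
  define w where "w = (\<lambda>i. wt (fst (t i)) (clip (snd (t i))))"
  define b where "b = (\<lambda>i. - (\<tau> * \<bar>clip (snd (t i))\<bar>))"
  have eq: "\<phi> (t i) x / n = \<beta> i * \<psi> (w i \<bullet> x + b i)" for i x
    by (simp add: \<phi>_def unit_def \<beta>_def w_def b_def)
  have "(\<integral>x. \<bar>(\<Sum>i=1..n. \<beta> i * \<psi> (w i \<bullet> x + b i)) - (\<integral>\<omega>. norm1 \<omega> ^ m * ridge_integral K \<psi> \<tau> x \<omega> \<partial>V)\<bar> \<partial>N)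
      = (\<integral>x. \<bar>(\<Sum>i=1..n. \<phi> (t i) x / n) - (\<integral>\<theta>. \<phi> \<theta> x \<partial>(A \<Otimes>\<^sub>M U))\<bar> \<partial>N)"
    by (intro Bochner_Integration.integral_cong refl) (simp add: mean eq spN)
  moreover have "integrable N (\<lambda>x. \<bar>(\<Sum>i=1..n. \<beta> i * \<psi> (w i \<bullet> x + b i)) - (\<integral>\<omega>. norm1 \<omega> ^ m * ridge_integral K \<psi> \<tau> x \<omega> \<partial>V)\<bar>)"
    using ti by (rule Bochner_Integration.integrable_cong[OF refl, THEN iffD1, rotated]) (simp add: mean eq spN)
  moreover have "norm1 (w i) \<le> \<tau> \<and> \<bar>b i\<bar> \<le> \<tau> \<and> \<bar>\<beta> i\<bar> \<le> 2 * S / n" for i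
  proof (intro conjI)
    show "norm1 (w i) \<le> \<tau>" unfolding w_def by (rule wt)
    show "\<bar>b i\<bar> \<le> \<tau>" using \<tau> clip[of "snd (t i)"] by (simp add: b_def abs_mult mult_left_le)
    have "2 * S * \<bar>K (fst (t i)) (clip (snd (t i)))\<bar> \<le> 2 * S * 1" using K(2) S by (intro mult_left_mono) auto
    then show "\<bar>\<beta> i\<bar> \<le> 2 * S / n" using S by (simp add: \<beta>_def abs_mult divide_right_mono)
  qed
  ultimately show ?thesis using t by (intro exI[of _ \<beta>] exI[of _ w] exI[of _ b]) auto
qed

section \<open>Approximation of functions with a Fourier representation\<close>


text \<open>A vanishing moment admits no normalized sampling law, but then the mixture is 0 and zero
  coefficients will do. The moment may now be replaced by an upper bound \<open>S\<close>.\<close>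

lemma ridge_mixture_approx:
  fixes V :: "(real ^ 'd) measure" and K :: "real ^ 'd \<Rightarrow> real \<Rightarrow> real" and S :: real
  assumes V: "finite_measure V" "sets V = sets borel"
    and K: "(\<lambda>z. K (fst z) (snd z)) \<in> borel_measurable (borel \<Otimes>\<^sub>M borel)" "\<And>\<omega> t. \<bar>K \<omega> t\<bar> \<le> 1"
    and S: "integrable V (\<lambda>\<omega>. norm1 \<omega> ^ m)" "(\<integral>\<omega>. norm1 \<omega> ^ m \<partial>V) \<le> S"
    and \<psi>: "bounded_ridge \<psi> \<tau> B TYPE('d)" "0 < B" and \<tau>: "0 \<le> \<tau>"
    and N: "prob_space N" "sets N = sets (restrict_space borel (unit_cube :: (real ^ 'd) set))" and n: "1 \<le> n"
  shows "\<exists>\<beta> w b. (\<forall>i\<in>{1..n}. norm1 (w i) \<le> \<tau> \<and> \<bar>b i\<bar> \<le> \<tau> \<and> \<bar>\<beta> i\<bar> \<le> 2 * S / real n) \<and>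
    integrable N (\<lambda>x. \<bar>(\<Sum>i=1..n. \<beta> i * \<psi> (w i \<bullet> x + b i)) - (\<integral>\<omega>. norm1 \<omega> ^ m * ridge_integral K \<psi> \<tau> x \<omega> \<partial>V)\<bar>) \<and>
    (\<integral>x. \<bar>(\<Sum>i=1..n. \<beta> i * \<psi> (w i \<bullet> x + b i)) - (\<integral>\<omega>. norm1 \<omega> ^ m * ridge_integral K \<psi> \<tau> x \<omega> \<partial>V)\<bar> \<partial>N)
      \<le> 2 * S * B / sqrt n"
proof (cases "(\<integral>\<omega>. norm1 \<omega> ^ m \<partial>V) = 0")
  case True
  then have ae: "AE \<omega> in V. norm1 \<omega> ^ m = 0" using S by (subst (asm) integral_nonneg_eq_0_iff_AE) auto
  have "(\<integral>\<omega>. norm1 \<omega> ^ m * ridge_integral K \<psi> \<tau> x \<omega> \<partial>V) = 0" for x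
    using ae by (intro integral_eq_zero_AE) (auto elim: eventually_mono)
  then show ?thesis using True S \<psi> \<tau>
    by (intro exI[of _ "\<lambda>_. 0"]) auto
next
  case False
  define s where "s = (\<integral>\<omega>. norm1 \<omega> ^ m \<partial>V)"
  have "0 \<le> s" unfolding s_def by (intro Bochner_Integration.integral_nonneg) simp
  moreover have "s \<noteq> 0" using False by (simp add: s_def)
  ultimately have s: "0 < s" by simp
  have le: "s \<le> S" using S by (simp add: s_def)
  have 1: "2 * s / real n \<le> 2 * S / real n" using le by (intro divide_right_mono) auto
  have 2: "2 * s * B / sqrt n \<le> 2 * S * B / sqrt n" using le \<psi> by (intro divide_right_mono mult_right_mono) auto
  show ?thesis
    using ridge_mixture_approx_pos[OF V K S(1) s_def s \<psi> \<tau> N n] 1 2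
  proof (elim exE conjE, intro exI conjI ballI)
    fix \<beta> w b i
    assume "\<forall>i\<in>{1..n}. norm1 (w i) \<le> \<tau> \<and> \<bar>b i\<bar> \<le> \<tau> \<and> \<bar>\<beta> i\<bar> \<le> 2 * s / real n" "i \<in> {1..n}"
    then show "norm1 (w i) \<le> \<tau>" "\<bar>b i\<bar> \<le> \<tau>" "\<bar>\<beta> i\<bar> \<le> 2 * S / real n"
      using order_trans[OF _ 1] by blast+
  qed (assumption | erule order_trans[OF _ 2])+
qed

text \<open>Real parts are taken in the polar form; \<open>h1\<close> and \<open>h2\<close> are the
  real and imaginary parts of the polar density.\<close>

lemma fourier_representation_realE:
  fixes g :: "real ^ 'd \<Rightarrow> real"
  assumes "fourier_representation g F"
  obtains V h1 h2 where "finite_measure V" "sets V = sets borel"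
    "h1 \<in> borel_measurable borel" "h2 \<in> borel_measurable borel" "\<And>\<omega>. (h1 \<omega>)\<^sup>2 + (h2 \<omega>)\<^sup>2 = 1"
    "\<And>x. g x = (\<integral>\<omega>. cos (\<omega> \<bullet> x) * h1 \<omega> - sin (\<omega> \<bullet> x) * h2 \<omega> \<partial>V)"
    "\<And>m. spectral_moment m F = (\<integral>\<^sup>+\<omega>. ennreal (norm1 \<omega> ^ m) \<partial>V)"
proof -
  define V where "V = variation F"
  have sV: "sets V = sets borel" unfolding V_def variation_def by (simp add: sets.sigma_sets_eq[of borel, simplified])
  obtain h where h: "integrable V h" "\<And>\<omega>. cmod (h \<omega>) = 1"
    "\<And>x. complex_of_real (g x) = (LINT \<omega>|V. exp (\<i> * complex_of_real (\<omega> \<bullet> x)) * h \<omega>)"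
    using assms unfolding fourier_representation_def polar_density_def V_def by auto
  \<comment> \<open>The polar density is integrable of modulus 1, hence the variation is
    finite.\<close>
  have "integrable V (\<lambda>\<omega>. 1 :: real)"
    using integrable_norm[OF h(1)] h(2) by simp
  then have "emeasure V (space V) < \<infinity>" by (simp add: integrable_iff_bounded)
  then have fin: "finite_measure V" by (intro finite_measureI) simp
  have hm: "h \<in> borel_measurable borel" using h(1) sV by (metis borel_measurable_integrable measurable_cong_sets)
  show ?thesis
  proof (rule that[OF fin sV])
    show "(\<lambda>\<omega>. Re (h \<omega>)) \<in> borel_measurable borel" "(\<lambda>\<omega>. Im (h \<omega>)) \<in> borel_measurable borel"
      using hm by measurable
    show "(Re (h \<omega>))\<^sup>2 + (Im (h \<omega>))\<^sup>2 = 1" for \<omega> using h(2)[of \<omega>] by (metis cmod_power2 one_power2)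
    show "spectral_moment m F = (\<integral>\<^sup>+\<omega>. ennreal (norm1 \<omega> ^ m) \<partial>V)" for m by (simp add: spectral_moment_def V_def)
    fix x
    have "integrable V (\<lambda>\<omega>. exp (\<i> * complex_of_real (\<omega> \<bullet> x)) * h \<omega>)"
    proof (rule Bochner_Integration.integrable_bound[OF h(1)])
      show "(\<lambda>\<omega>. exp (\<i> * complex_of_real (\<omega> \<bullet> x)) * h \<omega>) \<in> borel_measurable V"
        unfolding measurable_cong_sets[OF sV refl] using hm by measurable
      show "AE \<omega> in V. norm (exp (\<i> * complex_of_real (\<omega> \<bullet> x)) * h \<omega>) \<le> norm (h \<omega>)"
        by (simp add: norm_mult)
    qed
    then have "g x = (\<integral>\<omega>. Re (exp (\<i> * complex_of_real (\<omega> \<bullet> x)) * h \<omega>) \<partial>V)"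
      using h(3)[of x] by (metis Re_complex_of_real integral_Re)
    also have "\<dots> = (\<integral>\<omega>. cos (\<omega> \<bullet> x) * Re (h \<omega>) - sin (\<omega> \<bullet> x) * Im (h \<omega>) \<partial>V)"
      by (intro Bochner_Integration.integral_cong refl) (simp add: cis_conv_exp[symmetric])
    finally show "g x = (\<integral>\<omega>. cos (\<omega> \<bullet> x) * Re (h \<omega>) - sin (\<omega> \<bullet> x) * Im (h \<omega>) \<partial>V)" .
  qed
qed

lemma one_le_sup_norm_unit_cube: "1 \<le> sup_norm_set (unit_cube :: (real ^ 'd) set)"
proof -
  have "\<bar>((\<chi> i. 1) :: real ^ 'd) \<bullet> axis i 1\<bar> \<le> infnorm ((\<chi> i. 1) :: real ^ 'd)" for i :: 'd
    by (intro Basis_le_infnorm) (auto simp: axis_in_Basis_iff)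
  then have "1 \<le> infnorm ((\<chi> i. 1) :: real ^ 'd)" by (simp add: inner_axis)
  then have "ennreal 1 \<le> ennreal (infnorm ((\<chi> i. 1) :: real ^ 'd))" by (rule ennreal_leI)
  also have "\<dots> \<le> sup_norm_set (unit_cube :: (real ^ 'd) set)" unfolding sup_norm_set_def by (intro SUP_upper) simp
  finally show ?thesis by simp
qed

lemma moment_le:
  fixes V :: "(real ^ 'd) measure"
  assumes "sup_norm_set (unit_cube :: (real ^ 'd) set) * (\<integral>\<^sup>+\<omega>. ennreal (norm1 \<omega> ^ m) \<partial>V) \<le> ennreal c"
    "sets V = sets borel" "0 \<le> c"
  shows "integrable V (\<lambda>\<omega>. norm1 \<omega> ^ m)" "(\<integral>\<omega>. norm1 \<omega> ^ m \<partial>V) \<le> c"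
proof -
  have "(\<integral>\<^sup>+\<omega>. ennreal (norm1 \<omega> ^ m) \<partial>V) \<le> sup_norm_set (unit_cube :: (real ^ 'd) set) * (\<integral>\<^sup>+\<omega>. ennreal (norm1 \<omega> ^ m) \<partial>V)"
    using mult_right_mono[OF one_le_sup_norm_unit_cube, of "\<integral>\<^sup>+\<omega>. ennreal (norm1 \<omega> ^ m) \<partial>V"] by simp
  also note assms(1)
  finally have le: "(\<integral>\<^sup>+\<omega>. ennreal (norm1 \<omega> ^ m) \<partial>V) \<le> ennreal c" .
  have meas: "(\<lambda>\<omega>. norm1 \<omega> ^ m) \<in> borel_measurable V"
    unfolding measurable_cong_sets[OF assms(2) refl] by measurable
  show i: "integrable V (\<lambda>\<omega>. norm1 \<omega> ^ m)"
    using le by (intro integrableI_nonneg meas) (auto intro: le_less_trans)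
  have "ennreal (\<integral>\<omega>. norm1 \<omega> ^ m \<partial>V) \<le> ennreal c"
    using le i by (subst nn_integral_eq_integral[symmetric]) auto
  then show "(\<integral>\<omega>. norm1 \<omega> ^ m \<partial>V) \<le> c" using assms(3) by simp
qed

lemma borel_measurable_ridge_integral:
  fixes K :: "real ^ 'd \<Rightarrow> real \<Rightarrow> real"
  assumes [measurable]: "(\<lambda>z. K (fst z) (snd z)) \<in> borel_measurable (borel \<Otimes>\<^sub>M borel)" "\<psi> \<in> borel_measurable borel"
  shows "ridge_integral K \<psi> \<tau> x \<in> borel_measurable borel"
proof -
  have "(\<lambda>z. indicator {-1..1} (snd z) * (K (fst z) (snd z) * \<psi> (((\<tau> * sgn (snd z) / norm1 (fst z)) *\<^sub>R fst z) \<bullet> x - \<tau> * \<bar>snd z\<bar>)))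
    \<in> borel_measurable (borel \<Otimes>\<^sub>M borel)" by measurable
  then have "(\<lambda>z. indicator {-1..1} (snd z) * (K (fst z) (snd z) * \<psi> (((\<tau> * sgn (snd z) / norm1 (fst z)) *\<^sub>R fst z) \<bullet> x - \<tau> * \<bar>snd z\<bar>)))
    \<in> borel_measurable (borel \<Otimes>\<^sub>M lborel)" by simp
  then show ?thesis
    unfolding ridge_integral_def[abs_def]
    by (intro lborel.borel_measurable_lebesgue_integral) (simp add: case_prod_beta)
qed

text \<open>The two expressions are the coordinates of a rotated unit vector. Estimating both terms
  separately would lose a factor, and the sampled coefficients would leave the network
  class.\<close>

lemma abs_trig_combination_le:
  fixes a b :: real
  assumes "a\<^sup>2 + b\<^sup>2 = 1"
  shows "\<bar>cos t * a - sin t * b\<bar> \<le> 1" "\<bar>sin t * a + cos t * b\<bar> \<le> 1"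
proof -
  have "(cos t * a - sin t * b)\<^sup>2 + (sin t * a + cos t * b)\<^sup>2 = ((cos t)\<^sup>2 + (sin t)\<^sup>2) * (a\<^sup>2 + b\<^sup>2)"
    by algebra
  then have *: "(cos t * a - sin t * b)\<^sup>2 + (sin t * a + cos t * b)\<^sup>2 = 1" using assms by simp
  then have "(cos t * a - sin t * b)\<^sup>2 \<le> 1" "(sin t * a + cos t * b)\<^sup>2 \<le> 1"
    using zero_le_power2[of "cos t * a - sin t * b"] zero_le_power2[of "sin t * a + cos t * b"] by linarith+
  then show "\<bar>cos t * a - sin t * b\<bar> \<le> 1" "\<bar>sin t * a + cos t * b\<bar> \<le> 1" by (auto simp: abs_square_le_1)
qed


lemma ridge_argument:
  fixes \<omega> x :: "real ^ 'd"
  shows "((\<tau> * sgn t / norm1 \<omega>) *\<^sub>R \<omega>) \<bullet> x - \<tau> * \<bar>t\<bar> = \<tau> * (sgn t * (\<omega> \<bullet> x / norm1 \<omega> - t))"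
  by (simp add: right_diff_distrib sgn_mult_self_eq abs_sgn mult_ac)

text \<open>With division by 0 equal to 0 this also covers \<open>norm1 \<omega> = 0\<close>, where
  the inner product vanishes too.\<close>

lemma unit_cube_inner_div:
  assumes "x \<in> unit_cube"
  shows "\<bar>\<omega> \<bullet> x / norm1 \<omega>\<bar> \<le> 1" "norm1 \<omega> * (\<omega> \<bullet> x / norm1 \<omega>) = \<omega> \<bullet> x"
  using abs_inner_le_norm1[OF assms, of \<omega>] by (auto simp: abs_div divide_le_eq_1)

lemma integrable_trig_combination:
  fixes V :: "(real ^ 'd) measure"
  assumes V: "finite_measure V" "sets V = sets borel"
    and h [measurable]: "h1 \<in> borel_measurable borel" "h2 \<in> borel_measurable borel" "\<And>\<omega>. (h1 \<omega>)\<^sup>2 + (h2 \<omega>)\<^sup>2 = 1"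
  shows "integrable V (\<lambda>\<omega>. cos (\<omega> \<bullet> x) * h1 \<omega> - sin (\<omega> \<bullet> x) * h2 \<omega>)"
proof -
  interpret V: finite_measure V by fact
  show ?thesis
  proof (rule V.integrable_const_bound[of _ 1])
    show "(\<lambda>\<omega>. cos (\<omega> \<bullet> x) * h1 \<omega> - sin (\<omega> \<bullet> x) * h2 \<omega>) \<in> borel_measurable V"
      unfolding measurable_cong_sets[OF V(2) refl] by measurable
    show "AE \<omega> in V. norm (cos (\<omega> \<bullet> x) * h1 \<omega> - sin (\<omega> \<bullet> x) * h2 \<omega>) \<le> 1"
      using abs_trig_combination_le(1)[OF h(3)] by simp
  qed
qed

text \<open>Half of the bound is the smoothing error \<open>2 * c / \<tau>\<close>, half is the
  sampling error. The value \<open>g 0\<close> becomes the output bias, and the first-order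
  representation leaves no linear term, matching the absence of one in sigmoid networks.\<close>

theorem sigmoid_approximation:
  fixes g :: "real ^ 'd \<Rightarrow> real"
  assumes rep: "fourier_representation g F"
    and c: "sup_norm_set (unit_cube :: (real ^ 'd) set) * spectral_moment 1 F \<le> ennreal c" "\<bar>g 0\<bar> \<le> c" "0 \<le> c"
    and N: "prob_space N" "sets N = sets (restrict_space borel (unit_cube :: (real ^ 'd) set))" and n: "3 \<le> n"
  shows "\<exists>\<eta>\<in>sigmoid_networks n c. (\<integral>x. \<bar>\<eta> x - g x\<bar> \<partial>N) \<le> 4 * c / sqrt n"
proof -
  obtain V h1 h2 where V: "finite_measure V" "sets V = sets borel"
    and h [measurable]: "h1 \<in> borel_measurable borel" "h2 \<in> borel_measurable borel" and h1: "\<And>\<omega>. (h1 \<omega>)\<^sup>2 + (h2 \<omega>)\<^sup>2 = 1"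
    and g: "\<And>x. g x = (\<integral>\<omega>. cos (\<omega> \<bullet> x) * h1 \<omega> - sin (\<omega> \<bullet> x) * h2 \<omega> \<partial>V)"
    and mom: "\<And>m. spectral_moment m F = (\<integral>\<^sup>+\<omega>. ennreal (norm1 \<omega> ^ m) \<partial>V)"
    using fourier_representation_realE[OF rep] by blast
  interpret V: finite_measure V by fact
  interpret N: prob_space N by fact
  have spN: "space N = unit_cube" using sets_eq_imp_space_eq[OF N(2)] by (simp add: space_restrict_space)
  have S: "integrable V (\<lambda>\<omega>. norm1 \<omega> ^ 1)" "(\<integral>\<omega>. norm1 \<omega> ^ 1 \<partial>V) \<le> c"
    using moment_le[where m = 1 and V = V and c = c] c V mom by auto
  define \<tau> where "\<tau> = sqrt (real n) * ln (real n)"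
  \<comment> \<open>Here \<open>3 \<le> n\<close> enters: it makes \<open>\<tau>\<close> at least
    \<open>sqrt n\<close>, so the smoothing error is no larger than the sampling error.\<close>
  have ln1: "1 \<le> ln (real n)"
  proof -
    have "exp 1 \<le> real n" using exp_le n by linarith
    then show ?thesis using n by (simp add: ln_ge_iff)
  qed
  have \<tau>: "sqrt n \<le> \<tau>" using ln1 mult_left_mono[of 1 "ln (real n)" "sqrt n"] by (simp add: \<tau>_def)
  have \<tau>0: "0 < \<tau>" using \<tau> n by (smt (verit) of_nat_0_less_iff real_sqrt_gt_zero zero_less_numeral less_le_trans)
  define K where "K = (\<lambda>\<omega> t. sgn t * - (sin (norm1 \<omega> * t) * h1 \<omega> + cos (norm1 \<omega> * t) * h2 \<omega>))"
  have K: "(\<lambda>z. K (fst z) (snd z)) \<in> borel_measurable (borel \<Otimes>\<^sub>M borel)" unfolding K_def by measurable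
  have Kb: "\<bar>K \<omega> t\<bar> \<le> 1" for \<omega> t
    using abs_trig_combination_le(2)[OF h1, of "norm1 \<omega> * t" \<omega>] unfolding K_def by (auto simp: abs_mult sgn_if)
  have [measurable]: "sigmoid \<in> borel_measurable borel" unfolding sigmoid_def by measurable
  define Q where "Q = ridge_integral K sigmoid \<tau>"
  have Qm: "Q x \<in> borel_measurable borel" for x
    unfolding Q_def by (intro borel_measurable_ridge_integral K) measurable
  have err: "\<bar>(cos (\<omega> \<bullet> x) * h1 \<omega> - sin (\<omega> \<bullet> x) * h2 \<omega> - h1 \<omega>) - norm1 \<omega> * Q x \<omega>\<bar> \<le> norm1 \<omega> * (2 / \<tau>)"
    if x: "x \<in> unit_cube" for x \<omega>
  proof -
    define r z where "r = norm1 \<omega>" and "z = \<omega> \<bullet> x / norm1 \<omega>"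
    define G where "G = (\<lambda>t. cos (r * t) * h1 \<omega> - sin (r * t) * h2 \<omega>)"
    define G' where "G' = (\<lambda>t. r * - (sin (r * t) * h1 \<omega> + cos (r * t) * h2 \<omega>))"
    have rz: "r * z = \<omega> \<bullet> x" "\<bar>z\<bar> \<le> 1" unfolding r_def z_def using unit_cube_inner_div[OF x] by auto
    have "\<bar>G z - G 0 - (\<integral>t. indicator {-1..1} t * (sgn t * G' t * sigmoid (\<tau> * (sgn t * (z - t)))) \<partial>lborel)\<bar> \<le> r * (2 / \<tau>)"
    proof (rule sigmoid_representation_error[OF _ _ rz(2) _ \<tau>0])
      show "DERIV G t :> G' t" for t unfolding G_def G'_def by (auto intro!: derivative_eq_intros simp: algebra_simps)
      show "continuous_on UNIV G'" unfolding G'_def by (intro continuous_intros)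
      show "\<bar>G' t\<bar> \<le> r" for t
        using abs_trig_combination_le(2)[OF h1, of "r * t" \<omega>] mult_left_mono[of _ 1 r]
        unfolding G'_def by (simp add: abs_mult r_def mult_left_le)
    qed
    moreover have "(\<integral>t. indicator {-1..1} t * (sgn t * G' t * sigmoid (\<tau> * (sgn t * (z - t)))) \<partial>lborel) = r * Q x \<omega>"
    proof -
      have "(\<integral>t. indicator {-1..1} t * (sgn t * G' t * sigmoid (\<tau> * (sgn t * (z - t)))) \<partial>lborel) =
          (\<integral>t. r * (indicator {-1..1} t * (K \<omega> t * sigmoid (\<tau> * (sgn t * (z - t))))) \<partial>lborel)"
        unfolding G'_def K_def r_def by (intro Bochner_Integration.integral_cong refl) (simp add: algebra_simps)
      then show ?thesis unfolding Q_def ridge_integral_def ridge_argument z_def[symmetric] by simp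
    qed
    ultimately show ?thesis using rz(1) unfolding G_def r_def by simp
  qed
  \<comment> \<open>Integrability follows from \<open>err\<close>: the ridge term differs from a
    bounded function by at most a multiple of \<open>norm1\<close>.\<close>
  have Qb: "integrable V (\<lambda>\<omega>. norm1 \<omega> * Q x \<omega>)" if x: "x \<in> unit_cube" for x
  proof (rule Bochner_Integration.integrable_bound[of V "\<lambda>\<omega>. norm1 \<omega> * (2 / \<tau>) + 2"])
    show "integrable V (\<lambda>\<omega>. norm1 \<omega> * (2 / \<tau>) + 2)" using S by auto
    show "(\<lambda>\<omega>. norm1 \<omega> * Q x \<omega>) \<in> borel_measurable V"
      unfolding measurable_cong_sets[OF V(2) refl] using Qm[of x] by measurable
    have "\<bar>norm1 \<omega> * Q x \<omega>\<bar> \<le> norm1 \<omega> * (2 / \<tau>) + 2" for \<omega>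
    proof -
      have "\<bar>cos (\<omega> \<bullet> x) * h1 \<omega> - sin (\<omega> \<bullet> x) * h2 \<omega>\<bar> \<le> 1" by (rule abs_trig_combination_le(1)[OF h1])
      moreover have "\<bar>h1 \<omega>\<bar> \<le> 1" using abs_trig_combination_le(1)[OF h1, of 0 \<omega>] by simp
      ultimately show ?thesis using err[OF x, of \<omega>] by linarith
    qed
    moreover have "0 \<le> norm1 \<omega> * (2 / \<tau>) + 2" for \<omega> :: "real ^ 'd" using \<tau>0 by simp
    ultimately show "AE \<omega> in V. norm (norm1 \<omega> * Q x \<omega>) \<le> norm (norm1 \<omega> * (2 / \<tau>) + 2)" by simp
  qed
  define m where "m = (\<lambda>x. \<integral>\<omega>. norm1 \<omega> ^ 1 * Q x \<omega> \<partial>V)"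
  have m: "\<bar>(g x - g 0) - m x\<bar> \<le> 2 * c / sqrt n" if x: "x \<in> unit_cube" for x
  proof -
    note i = integrable_trig_combination[OF V h h1]
    have "(g x - g 0) - m x = (\<integral>\<omega>. (cos (\<omega> \<bullet> x) * h1 \<omega> - sin (\<omega> \<bullet> x) * h2 \<omega> - h1 \<omega>) - norm1 \<omega> * Q x \<omega> \<partial>V)"
      unfolding g m_def using i[of x] i[of 0] Qb[OF x] by simp
    also have "\<bar>\<dots>\<bar> \<le> (\<integral>\<omega>. \<bar>(cos (\<omega> \<bullet> x) * h1 \<omega> - sin (\<omega> \<bullet> x) * h2 \<omega> - h1 \<omega>) - norm1 \<omega> * Q x \<omega>\<bar> \<partial>V)"
      by (rule integral_abs_bound)
    also have "\<dots> \<le> (\<integral>\<omega>. norm1 \<omega> * (2 / \<tau>) \<partial>V)"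
      using err[OF x] S i[of x] i[of 0] Qb[OF x] by (intro integral_mono) auto
    also have "\<dots> \<le> c * (2 / \<tau>)"
      using S \<tau>0 unfolding integral_mult_left_zero by (intro mult_right_mono) auto
    also have "\<dots> \<le> 2 * c / sqrt n"
      using \<tau> \<tau>0 n c(3) frac_le[of "2 * c" "2 * c" "sqrt n" \<tau>] by (simp add: mult.commute)
    finally show ?thesis .
  qed
  have "\<exists>\<beta> w b. (\<forall>i\<in>{1..n}. norm1 (w i) \<le> \<tau> \<and> \<bar>b i\<bar> \<le> \<tau> \<and> \<bar>\<beta> i\<bar> \<le> 2 * c / real n) \<and>
      integrable N (\<lambda>x. \<bar>(\<Sum>i=1..n. \<beta> i * sigmoid (w i \<bullet> x + b i)) - m x\<bar>) \<and>
      (\<integral>x. \<bar>(\<Sum>i=1..n. \<beta> i * sigmoid (w i \<bullet> x + b i)) - m x\<bar> \<partial>N) \<le> 2 * c * 1 / sqrt n"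
    unfolding m_def Q_def
    by (rule ridge_mixture_approx[OF V K Kb S bounded_ridge_sigmoid _ _ N]) (use \<tau>0 n in auto)
  then obtain \<beta> w b where net: "\<And>i. i \<in> {1..n} \<Longrightarrow> norm1 (w i) \<le> \<tau> \<and> \<bar>b i\<bar> \<le> \<tau> \<and> \<bar>\<beta> i\<bar> \<le> 2 * c / real n"
    and ni: "integrable N (\<lambda>x. \<bar>(\<Sum>i=1..n. \<beta> i * sigmoid (w i \<bullet> x + b i)) - m x\<bar>)"
    and nl: "(\<integral>x. \<bar>(\<Sum>i=1..n. \<beta> i * sigmoid (w i \<bullet> x + b i)) - m x\<bar> \<partial>N) \<le> 2 * c * 1 / sqrt n"
    by (elim exE conjE) (rule that, blast+)
  define \<eta> where "\<eta> = (\<lambda>x. (\<Sum>i=1..n. \<beta> i * sigmoid (w i \<bullet> x + b i)) + 0 \<bullet> x + g 0)"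
  have "\<eta> \<in> sigmoid_networks n c"
    unfolding sigmoid_networks_def
    by (rule networksI[where \<beta> = \<beta> and w = w and b = b and ?w0.0 = 0 and ?b0.0 = "g 0"])
      (use net c in \<open>auto simp: \<eta>_def \<tau>_def\<close>)
  moreover have "(\<integral>x. \<bar>\<eta> x - g x\<bar> \<partial>N) \<le> 4 * c / sqrt n"
  proof -
    have "(\<integral>x. \<bar>\<eta> x - g x\<bar> \<partial>N) \<le> (\<integral>x. \<bar>(\<Sum>i=1..n. \<beta> i * sigmoid (w i \<bullet> x + b i)) - m x\<bar> + 2 * c / sqrt n \<partial>N)"
    proof (rule integral_mono')
      fix x assume "x \<in> space N"
      then show "\<bar>\<eta> x - g x\<bar> \<le> \<bar>(\<Sum>i=1..n. \<beta> i * sigmoid (w i \<bullet> x + b i)) - m x\<bar> + 2 * c / sqrt n"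
        using m[of x] unfolding \<eta>_def spN by simp
    qed (use ni c in auto)
    also have "\<dots> \<le> 4 * c / sqrt n" using ni nl by (simp add: N.prob_space)
    finally show ?thesis .
  qed
  ultimately show ?thesis by blast
qed


section \<open>Approximation by relu networks\<close>

lemma abs_cos_minus_one_le: "\<bar>cos x - 1\<bar> \<le> \<bar>x\<bar>" for x :: real
proof -
  have "cos x - 1 = - 2 * (sin (x / 2))\<^sup>2" using cos_double_sin[of "x / 2"] by simp
  then have "\<bar>cos x - 1\<bar> = 2 * (\<bar>sin (x / 2)\<bar> * \<bar>sin (x / 2)\<bar>)" by (simp add: power2_eq_square abs_mult)
  also have "\<dots> \<le> 2 * (\<bar>x / 2\<bar> * 1)"
    by (intro mult_left_mono mult_mono abs_sin_x_le_abs_x abs_sin_le_one) auto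
  finally show ?thesis by simp
qed

text \<open>
  The gradient in the definition of \<open>c_KB\<close> is only known to exist at the origin; comparing difference
  quotients along the ray through \<open>x\<close> identifies it with the formal derivative of the Fourier integral.
\<close>

lemma fourier_gradient:
  fixes V :: "(real ^ 'd) measure" and g :: "real ^ 'd \<Rightarrow> real"
  assumes V: "finite_measure V" "sets V = sets borel"
    and h [measurable]: "h1 \<in> borel_measurable borel" "h2 \<in> borel_measurable borel" and h1: "\<And>\<omega>. (h1 \<omega>)\<^sup>2 + (h2 \<omega>)\<^sup>2 = 1"
    and g: "\<And>x. g x = (\<integral>\<omega>. cos (\<omega> \<bullet> x) * h1 \<omega> - sin (\<omega> \<bullet> x) * h2 \<omega> \<partial>V)"
    and i: "integrable V norm1" and D: "GDERIV g 0 :> D" and x: "x \<in> unit_cube"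
  shows "D \<bullet> x = (\<integral>\<omega>. - h2 \<omega> * (\<omega> \<bullet> x) \<partial>V)"
proof -
  define s where "s = (\<lambda>n. inverse (real (Suc n)))"
  have s: "s \<longlonglongrightarrow> 0" "\<And>n. s n \<noteq> 0" "\<And>n. 0 < s n"
    using LIMSEQ_inverse_real_of_nat unfolding s_def by auto
  then have sf: "filterlim s (at 0) sequentially" by (auto simp: filterlim_at)
  have "((\<lambda>u :: real. g (u *\<^sub>R x)) has_derivative (\<lambda>u. (u *\<^sub>R x) \<bullet> D)) (at 0)"
  proof (rule has_derivative_compose[where g = g and g' = "\<lambda>v. v \<bullet> D"])
    show "((\<lambda>u. u *\<^sub>R x) has_derivative (\<lambda>u. u *\<^sub>R x)) (at (0 :: real))" by (auto intro!: derivative_eq_intros)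
    show "(g has_derivative (\<lambda>v. v \<bullet> D)) (at (0 *\<^sub>R x))" using D by (simp add: gderiv_def)
  qed
  then have "DERIV (\<lambda>u. g (u *\<^sub>R x)) 0 :> x \<bullet> D" by (simp add: has_field_derivative_def mult_commute_abs)
  then have "((\<lambda>u. (g (u *\<^sub>R x) - g 0) / u) \<longlongrightarrow> x \<bullet> D) (at 0)" by (simp add: DERIV_def)
  then have 1: "(\<lambda>n. (g (s n *\<^sub>R x) - g 0) / s n) \<longlonglongrightarrow> x \<bullet> D" by (rule filterlim_compose[OF _ sf])
  define q where "q = (\<lambda>n \<omega>. (cos (\<omega> \<bullet> (s n *\<^sub>R x)) * h1 \<omega> - sin (\<omega> \<bullet> (s n *\<^sub>R x)) * h2 \<omega> - h1 \<omega>) / s n)"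
  have 2: "(\<lambda>n. \<integral>\<omega>. q n \<omega> \<partial>V) \<longlonglongrightarrow> (\<integral>\<omega>. - h2 \<omega> * (\<omega> \<bullet> x) \<partial>V)"
  proof (rule integral_dominated_convergence[where w = "\<lambda>\<omega>. 2 * norm1 \<omega>"])
    show "(\<lambda>\<omega>. - h2 \<omega> * (\<omega> \<bullet> x)) \<in> borel_measurable V" "q n \<in> borel_measurable V" for n
      unfolding measurable_cong_sets[OF V(2) refl] q_def by measurable
    show "integrable V (\<lambda>\<omega>. 2 * norm1 \<omega>)" using i by simp
    have "(\<lambda>n. q n \<omega>) \<longlonglongrightarrow> - h2 \<omega> * (\<omega> \<bullet> x)" for \<omega>
    proof -
      have "DERIV (\<lambda>u. cos (u * (\<omega> \<bullet> x)) * h1 \<omega> - sin (u * (\<omega> \<bullet> x)) * h2 \<omega>) 0 :> - h2 \<omega> * (\<omega> \<bullet> x)"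
        by (auto intro!: derivative_eq_intros)
      then have "((\<lambda>u. (cos (u * (\<omega> \<bullet> x)) * h1 \<omega> - sin (u * (\<omega> \<bullet> x)) * h2 \<omega> - h1 \<omega>) / u) \<longlongrightarrow> - h2 \<omega> * (\<omega> \<bullet> x)) (at 0)"
        by (simp add: DERIV_def)
      from filterlim_compose[OF this sf] show ?thesis by (simp add: q_def)
    qed
    then show "AE \<omega> in V. (\<lambda>n. q n \<omega>) \<longlonglongrightarrow> - h2 \<omega> * (\<omega> \<bullet> x)" by simp
    have hb: "\<bar>h1 \<omega>\<bar> \<le> 1" "\<bar>h2 \<omega>\<bar> \<le> 1" for \<omega>
      using abs_trig_combination_le[OF h1, of 0 \<omega>] by auto
    have "norm (q n \<omega>) \<le> 2 * norm1 \<omega>" for n \<omega>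
    proof -
      define a where "a = s n * (\<omega> \<bullet> x)"
      have "\<bar>(cos a - 1) * h1 \<omega>\<bar> \<le> \<bar>a\<bar> * 1" "\<bar>sin a * h2 \<omega>\<bar> \<le> \<bar>a\<bar> * 1"
        unfolding abs_mult by (intro mult_mono abs_cos_minus_one_le abs_sin_x_le_abs_x hb; simp)+
      then have "\<bar>cos a * h1 \<omega> - sin a * h2 \<omega> - h1 \<omega>\<bar> \<le> 2 * \<bar>a\<bar>" by (simp add: algebra_simps)
      also have "\<dots> \<le> 2 * (s n * norm1 \<omega>)"
        unfolding a_def abs_mult using abs_inner_le_norm1[OF x, of \<omega>] s(3)[of n] by simp
      finally have *: "\<bar>cos a * h1 \<omega> - sin a * h2 \<omega> - h1 \<omega>\<bar> \<le> 2 * (s n * norm1 \<omega>)" .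
      have "norm (q n \<omega>) = \<bar>cos a * h1 \<omega> - sin a * h2 \<omega> - h1 \<omega>\<bar> / s n"
        using s(3)[of n] by (simp add: q_def a_def abs_divide)
      also have "\<dots> \<le> 2 * (s n * norm1 \<omega>) / s n" using * s(3)[of n] by (intro divide_right_mono) auto
      also have "\<dots> = 2 * norm1 \<omega>" using s(2)[of n] by simp
      finally show ?thesis .
    qed
    then show "AE \<omega> in V. norm (q n \<omega>) \<le> 2 * norm1 \<omega>" for n by simp
  qed
  have "(\<integral>\<omega>. q n \<omega> \<partial>V) = (g (s n *\<^sub>R x) - g 0) / s n" for n
  proof -
    note i = integrable_trig_combination[OF V h h1]
    show ?thesis unfolding q_def g using i[of "s n *\<^sub>R x"] i[of 0] by simp
  qed
  with 2 have 3: "(\<lambda>n. (g (s n *\<^sub>R x) - g 0) / s n) \<longlonglongrightarrow> (\<integral>\<omega>. - h2 \<omega> * (\<omega> \<bullet> x) \<partial>V)"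
    by (simp only:)
  from LIMSEQ_unique[OF 1 3] show ?thesis by (simp only: inner_commute)
qed

text \<open>The Taylor terms of order 0 and 1 are not sampled: \<open>g 0\<close> becomes the output
  bias and \<open>D\<close> the linear weight, and only the second-order remainder goes through the
  mixture. The constant is \<open>2 * c\<close> times the range 2 of \<open>relu\<close> on
  admissible arguments.\<close>

theorem relu_approximation:
  fixes g :: "real ^ 'd \<Rightarrow> real"
  assumes rep: "fourier_representation g F"
    and c: "sup_norm_set (unit_cube :: (real ^ 'd) set) * spectral_moment 2 F \<le> ennreal c" "\<bar>g 0\<bar> \<le> c" "0 \<le> c"
    and D: "GDERIV g 0 :> D" "norm1 D \<le> c"
    and N: "prob_space N" "sets N = sets (restrict_space borel (unit_cube :: (real ^ 'd) set))" and n: "1 \<le> n"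
  shows "\<exists>\<eta>\<in>relu_networks n c. (\<integral>x. \<bar>\<eta> x - g x\<bar> \<partial>N) \<le> 4 * c / sqrt n"
proof -
  obtain V h1 h2 where V: "finite_measure V" "sets V = sets borel"
    and h [measurable]: "h1 \<in> borel_measurable borel" "h2 \<in> borel_measurable borel" and h1: "\<And>\<omega>. (h1 \<omega>)\<^sup>2 + (h2 \<omega>)\<^sup>2 = 1"
    and g: "\<And>x. g x = (\<integral>\<omega>. cos (\<omega> \<bullet> x) * h1 \<omega> - sin (\<omega> \<bullet> x) * h2 \<omega> \<partial>V)"
    and mom: "\<And>m. spectral_moment m F = (\<integral>\<^sup>+\<omega>. ennreal (norm1 \<omega> ^ m) \<partial>V)"
    using fourier_representation_realE[OF rep] by blast
  interpret V: finite_measure V by fact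
  interpret N: prob_space N by fact
  have spN: "space N = unit_cube" using sets_eq_imp_space_eq[OF N(2)] by (simp add: space_restrict_space)
  have S: "integrable V (\<lambda>\<omega>. norm1 \<omega> ^ 2)" "(\<integral>\<omega>. norm1 \<omega> ^ 2 \<partial>V) \<le> c"
    using moment_le[where m = 2 and V = V and c = c] c V mom by auto
  have hb: "\<bar>h1 \<omega>\<bar> \<le> 1" "\<bar>h2 \<omega>\<bar> \<le> 1" for \<omega>
    using abs_trig_combination_le[OF h1, of 0 \<omega>] by auto
  \<comment> \<open>The first moment is finite because the second one is and \<open>V\<close> has
    finite mass; \<open>fourier_gradient\<close> needs it as dominating function.\<close>
  have S1: "integrable V norm1"
  proof (rule Bochner_Integration.integrable_bound[of V "\<lambda>\<omega>. 1 + norm1 \<omega> ^ 2"])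
    show "norm1 \<in> borel_measurable V" unfolding measurable_cong_sets[OF V(2) refl] by measurable
    have "norm1 \<omega> \<le> 1 + norm1 \<omega> ^ 2" for \<omega> :: "real ^ 'd"
    proof -
      have "2 * norm1 \<omega> \<le> 1 + norm1 \<omega> ^ 2" using zero_le_power2[of "norm1 \<omega> - 1"] by (simp add: power2_diff)
      with norm1_nonneg[of \<omega>] show ?thesis by linarith
    qed
    then show "AE \<omega> in V. norm (norm1 \<omega>) \<le> norm (1 + norm1 \<omega> ^ 2)" by simp
  qed (use S in auto)
  define K where "K = (\<lambda>\<omega> t. - (cos (norm1 \<omega> * t) * h1 \<omega> - sin (norm1 \<omega> * t) * h2 \<omega>))"
  have K: "(\<lambda>z. K (fst z) (snd z)) \<in> borel_measurable (borel \<Otimes>\<^sub>M borel)" unfolding K_def by measurable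
  have Kb: "\<bar>K \<omega> t\<bar> \<le> 1" for \<omega> t
    using abs_trig_combination_le(1)[OF h1, of "norm1 \<omega> * t" \<omega>] unfolding K_def by simp
  define Q where "Q = ridge_integral K relu 1"
  have eq: "norm1 \<omega> ^ 2 * Q x \<omega> = cos (\<omega> \<bullet> x) * h1 \<omega> - sin (\<omega> \<bullet> x) * h2 \<omega> - h1 \<omega> - - h2 \<omega> * (\<omega> \<bullet> x)"
    if x: "x \<in> unit_cube" for x \<omega>
  proof -
    define r z where "r = norm1 \<omega>" and "z = \<omega> \<bullet> x / norm1 \<omega>"
    define G where "G = (\<lambda>t. cos (r * t) * h1 \<omega> - sin (r * t) * h2 \<omega>)"
    define G' where "G' = (\<lambda>t. r * - (sin (r * t) * h1 \<omega> + cos (r * t) * h2 \<omega>))"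
    define G'' where "G'' = (\<lambda>t. r ^ 2 * - (cos (r * t) * h1 \<omega> - sin (r * t) * h2 \<omega>))"
    have rz: "r * z = \<omega> \<bullet> x" "\<bar>z\<bar> \<le> 1" unfolding r_def z_def using unit_cube_inner_div[OF x] by auto
    have "G z - G 0 - G' 0 * z = (\<integral>t. indicator {-1..1} t * (G'' t * relu (sgn t * (z - t))) \<partial>lborel)"
    proof (rule relu_representation[OF _ _ _ rz(2)])
      show "DERIV G t :> G' t" for t unfolding G_def G'_def by (auto intro!: derivative_eq_intros simp: algebra_simps)
      show "DERIV G' t :> G'' t" for t unfolding G'_def G''_def
        by (auto intro!: derivative_eq_intros simp: algebra_simps power2_eq_square)
      show "continuous_on UNIV G''" unfolding G''_def by (intro continuous_intros)
    qed
    also have "\<dots> = (\<integral>t. r ^ 2 * (indicator {-1..1} t * (K \<omega> t * relu (1 * (sgn t * (z - t))))) \<partial>lborel)"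
      unfolding G''_def K_def r_def by (intro Bochner_Integration.integral_cong refl) (simp add: algebra_simps)
    also have "\<dots> = r ^ 2 * Q x \<omega>" unfolding Q_def ridge_integral_def ridge_argument z_def[symmetric] by simp
    finally have "G z - G 0 - G' 0 * z = r ^ 2 * Q x \<omega>" .
    moreover have "G' 0 * z = - h2 \<omega> * (\<omega> \<bullet> x)" unfolding rz(1)[symmetric] by (simp add: G'_def)
    moreover have "G z - G 0 = cos (\<omega> \<bullet> x) * h1 \<omega> - sin (\<omega> \<bullet> x) * h2 \<omega> - h1 \<omega>"
      using rz(1) by (simp add: G_def)
    ultimately show ?thesis unfolding r_def by simp
  qed
  define m where "m = (\<lambda>x. \<integral>\<omega>. norm1 \<omega> ^ 2 * Q x \<omega> \<partial>V)"
  have m: "g x = m x + D \<bullet> x + g 0" if x: "x \<in> unit_cube" for x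
  proof -
    note i = integrable_trig_combination[OF V h h1]
    have i2: "integrable V (\<lambda>\<omega>. - h2 \<omega> * (\<omega> \<bullet> x))"
    proof (rule Bochner_Integration.integrable_bound[OF S1])
      show "(\<lambda>\<omega>. - h2 \<omega> * (\<omega> \<bullet> x)) \<in> borel_measurable V"
        unfolding measurable_cong_sets[OF V(2) refl] by measurable
      have "\<bar>h2 \<omega>\<bar> * \<bar>\<omega> \<bullet> x\<bar> \<le> 1 * norm1 \<omega>" for \<omega>
        using hb abs_inner_le_norm1[OF x] by (intro mult_mono) auto
      then show "AE \<omega> in V. norm (- h2 \<omega> * (\<omega> \<bullet> x)) \<le> norm (norm1 \<omega>)" by (simp add: abs_mult)
    qed
    have "m x = g x - g 0 - D \<bullet> x"
      unfolding m_def eq[OF x] fourier_gradient[OF V h h1 g S1 D(1) x] g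
      using i[of x] i[of 0] i2 by simp
    then show ?thesis by simp
  qed
  have "\<exists>\<beta> w b. (\<forall>i\<in>{1..n}. norm1 (w i) \<le> 1 \<and> \<bar>b i\<bar> \<le> 1 \<and> \<bar>\<beta> i\<bar> \<le> 2 * c / real n) \<and>
      integrable N (\<lambda>x. \<bar>(\<Sum>i=1..n. \<beta> i * relu (w i \<bullet> x + b i)) - m x\<bar>) \<and>
      (\<integral>x. \<bar>(\<Sum>i=1..n. \<beta> i * relu (w i \<bullet> x + b i)) - m x\<bar> \<partial>N) \<le> 2 * c * 2 / sqrt n"
    unfolding m_def Q_def
    by (rule ridge_mixture_approx[OF V K Kb S bounded_ridge_relu _ _ N]) (use n in auto)
  then obtain \<beta> w b where net: "\<And>i. i \<in> {1..n} \<Longrightarrow> norm1 (w i) \<le> 1 \<and> \<bar>b i\<bar> \<le> 1 \<and> \<bar>\<beta> i\<bar> \<le> 2 * c / real n"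
    and nl: "(\<integral>x. \<bar>(\<Sum>i=1..n. \<beta> i * relu (w i \<bullet> x + b i)) - m x\<bar> \<partial>N) \<le> 2 * c * 2 / sqrt n"
    by (elim exE conjE) (rule that, auto)
  define \<eta> where "\<eta> = (\<lambda>x. (\<Sum>i=1..n. \<beta> i * relu (w i \<bullet> x + b i)) + D \<bullet> x + g 0)"
  have "\<eta> \<in> relu_networks n c"
    unfolding relu_networks_def
    by (rule networksI[where \<beta> = \<beta> and w = w and b = b and ?w0.0 = D and ?b0.0 = "g 0"])
      (use net c D in \<open>auto simp: \<eta>_def\<close>)
  moreover have "(\<integral>x. \<bar>\<eta> x - g x\<bar> \<partial>N) = (\<integral>x. \<bar>(\<Sum>i=1..n. \<beta> i * relu (w i \<bullet> x + b i)) - m x\<bar> \<partial>N)"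
  proof (intro Bochner_Integration.integral_cong refl)
    fix x assume "x \<in> space N"
    then have "g x = m x + D \<bullet> x + g 0" unfolding spN by (rule m)
    then show "\<bar>\<eta> x - g x\<bar> = \<bar>(\<Sum>i=1..n. \<beta> i * relu (w i \<bullet> x + b i)) - m x\<bar>" by (simp add: \<eta>_def)
  qed
  ultimately show ?thesis using nl by (intro bexI[of _ \<eta>]) simp_all
qed

section \<open>Risk of the neural estimator\<close>


lemma exp_lipschitz:
  fixes a b B :: real
  assumes "a \<le> B" "b \<le> B"
  shows "\<bar>exp a - exp b\<bar> \<le> exp B * \<bar>a - b\<bar>"
proof -
  have *: "exp a - exp b \<le> exp B * (a - b)" if "b \<le> a" "a \<le> B" for a b :: real
  proof -
    have "exp a - exp b = exp a * (1 - exp (b - a))" by (simp add: exp_diff field_simps)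
    also have "\<dots> \<le> exp a * (a - b)"
    proof (intro mult_left_mono)
      show "1 - exp (b - a) \<le> a - b" using exp_ge_add_one_self[of "b - a"] by linarith
    qed simp
    also have "\<dots> \<le> exp B * (a - b)" using that by (intro mult_right_mono) auto
    finally show ?thesis .
  qed
  show ?thesis
  proof (cases "b \<le> a")
    case True then show ?thesis using *[of b a] assms by simp
  next
    case False then show ?thesis using *[of a b] assms by (simp add: abs_if)
  qed
qed

lemma density_log_version:
  assumes "prob_space \<nu>" "sets \<mu> = sets \<nu>" "absolutely_continuous \<nu> \<mu>" "log_density_version \<mu> \<nu> f"
  shows "\<mu> = density \<nu> (\<lambda>x. ennreal (exp (f x)))"
proof -
  interpret prob_space \<nu> by fact
  have [measurable]: "f \<in> borel_measurable \<nu>" using assms by (simp add: log_density_version_def)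
  have "\<mu> = density \<nu> (RN_deriv \<nu> \<mu>)" using assms by (intro density_RN_deriv[symmetric]) auto
  also have "\<dots> = density \<nu> (\<lambda>x. ennreal (exp (f x)))"
    using assms by (intro density_cong) (auto simp: log_density_version_def)
  finally show ?thesis .
qed

text \<open>Boundedness of \<open>f\<close> gives integrability under \<open>\<mu>\<close>, which
  selects the finite branch of \<open>KL\<close>; the library's entropy density agrees with
  \<open>f\<close> almost everywhere.\<close>

lemma KL_eq_integral:
  assumes "prob_space \<mu>" "prob_space \<nu>" and \<mu>: "\<mu> = density \<nu> (\<lambda>x. ennreal (exp (f x)))"
    and f: "log_density_version \<mu> \<nu> f" and B: "\<And>x. x \<in> space \<nu> \<Longrightarrow> \<bar>f x\<bar> \<le> B"
  shows "KL \<mu> \<nu> = ereal (\<integral>x. exp (f x) * f x \<partial>\<nu>)"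
proof -
  interpret N: prob_space \<nu> by fact
  interpret M: prob_space \<mu> by fact
  have fm [measurable]: "f \<in> borel_measurable \<nu>" using f by (simp add: log_density_version_def)
  have sets: "sets \<mu> = sets \<nu>" "space \<mu> = space \<nu>" by (simp_all add: \<mu>)
  have fM [measurable]: "f \<in> borel_measurable \<mu>" unfolding measurable_cong_sets[OF sets(1) refl] by (rule fm)
  have ac: "absolutely_continuous \<nu> \<mu>"
    unfolding \<mu> by (intro absolutely_continuousI_density) measurable
  have [measurable]: "entropy_density (exp 1) \<nu> \<mu> \<in> borel_measurable \<mu>"
    unfolding measurable_cong_sets[OF sets(1) refl] by (intro measurable_entropy_density)
  have "AE x in \<nu>. entropy_density (exp 1) \<nu> \<mu> x = f x"
    using f unfolding log_density_version_def entropy_density_def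
    by (auto simp: log_def elim: eventually_mono)
  then have ae: "AE x in \<mu>. entropy_density (exp 1) \<nu> \<mu> x = f x"
    unfolding \<mu> by (subst AE_density) (auto elim: eventually_mono)
  have "integrable \<mu> f" using B sets by (intro M.integrable_bounded[of _ B]) auto
  then have i: "integrable \<mu> (entropy_density (exp 1) \<nu> \<mu>)"
    using ae by (subst integrable_cong_AE) auto
  have "KL_divergence (exp 1) \<nu> \<mu> = (\<integral>x. f x \<partial>\<mu>)"
    unfolding KL_divergence_def using ae by (intro integral_cong_AE) auto
  also have "\<dots> = (\<integral>x. exp (f x) * f x \<partial>\<nu>)"
    by (subst \<mu>, subst integral_density) auto
  finally show ?thesis using ac i by (simp add: KL_def)
qed

text \<open>\<open>J g\<close> is the population version of the empirical objective. The error of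
  the supremum is bounded pointwise in the sample by deviations over a finite family plus bias and
  net error, and this majorant is measurable, so monotonicity of the nonnegative integral finishes
  the estimate.\<close>

theorem neural_estimator_risk_le:
  fixes X :: "'a::euclidean_space set" and G :: "('a \<Rightarrow> real) set"
  assumes \<mu>: "borel_prob_on X \<mu>" and \<nu>: "borel_prob_on X \<nu>"
    and ac: "absolutely_continuous \<nu> \<mu>" and f: "log_density_version \<mu> \<nu> f" and fB: "\<And>x. x \<in> X \<Longrightarrow> \<bar>f x\<bar> \<le> B"
    and G0: "(\<lambda>_. 0) \<in> G" and gm: "\<And>g. g \<in> G \<Longrightarrow> g \<in> borel_measurable borel"
    and gB: "\<And>g x. g \<in> G \<Longrightarrow> x \<in> X \<Longrightarrow> \<bar>g x\<bar> \<le> B" and nets: "finite_nets X G"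
    and disc: "\<And>g x e. g \<in> G \<Longrightarrow> (\<And>i. i \<in> {1..n} \<Longrightarrow> x i \<in> X) \<Longrightarrow>
      \<bar>\<Sum>i\<in>{1..n}. e i * g (x i)\<bar> \<le> A * halfspace_disc x {1..n} e"
    and n: "1 \<le> n" and A: "0 \<le> A" and \<gamma>: "\<gamma> \<in> G" "(\<integral>x. \<bar>\<gamma> x - f x\<bar> \<partial>\<nu>) \<le> b"
  shows "risk n (neural_estimator G n) \<mu> \<nu> \<le>
    ennreal (2 * exp B * b + (1 + exp B) * (4 * A * chaining_const (DIM('a) + 1) + 1) / sqrt n)"
proof -
  interpret M: prob_space \<mu> using \<mu> by (simp add: borel_prob_on_def)
  interpret N: prob_space \<nu> using \<nu> by (simp add: borel_prob_on_def)
  have sets: "sets \<mu> = sets (restrict_space borel X)" "sets \<nu> = sets (restrict_space borel X)"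
    using \<mu> \<nu> by (auto simp: borel_prob_on_def)
  have spM: "space \<mu> = X" and spN: "space \<nu> = X"
    using sets_eq_imp_space_eq[OF sets(1)] sets_eq_imp_space_eq[OF sets(2)] by (auto simp: space_restrict_space)
  have \<mu>d: "\<mu> = density \<nu> (\<lambda>x. ennreal (exp (f x)))"
    using sets by (intro density_log_version[OF N.prob_space_axioms _ ac f]) simp
  have fm [measurable]: "f \<in> borel_measurable \<nu>" using f by (simp add: log_density_version_def)
  have gM: "g \<in> borel_measurable \<mu>" and gN: "g \<in> borel_measurable \<nu>" if "g \<in> G" for g
    unfolding measurable_cong_sets[OF sets(1) refl] measurable_cong_sets[OF sets(2) refl]
    using gm[OF that] by (auto intro: measurable_restrict_space1)
  define D where "D = (\<integral>x. exp (f x) * f x \<partial>\<nu>)"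
  have KL: "real_of_ereal (KL \<mu> \<nu>) = D"
    using KL_eq_integral[OF M.prob_space_axioms N.prob_space_axioms \<mu>d f, of B] fB by (simp add: spN D_def)
  have ef1: "(\<integral>x. exp (f x) \<partial>\<nu>) = 1" and ief: "integrable \<nu> (\<lambda>x. exp (f x))"
  proof -
    have eb: "exp (f x) \<le> exp B" if "x \<in> X" for x using fB[OF that] by simp
    show ief: "integrable \<nu> (\<lambda>x. exp (f x))"
      using eb by (intro N.integrable_bounded[of _ "exp B"]) (auto simp: spN)
    have "ennreal (\<integral>x. exp (f x) \<partial>\<nu>) = (\<integral>\<^sup>+x. ennreal (exp (f x)) \<partial>\<nu>)"
      using ief by (intro nn_integral_eq_integral[symmetric]) auto
    also have "\<dots> = emeasure \<mu> (space \<mu>)"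
      unfolding spM by (subst \<mu>d, subst emeasure_density) (auto simp: spN[symmetric] intro!: nn_integral_cong)
    also have "\<dots> = 1" by (rule M.emeasure_space_1)
    finally show "(\<integral>x. exp (f x) \<partial>\<nu>) = 1" by (simp add: ennreal_eq_1)
  qed
  have eg: "\<bar>exp (g x)\<bar> \<le> exp B" if "g \<in> G" "x \<in> X" for g x using gB[OF that] by simp
  have ieg: "integrable \<nu> (\<lambda>x. exp (g x))" if "g \<in> G" for g
    using eg[OF that] gN[OF that] by (intro N.integrable_bounded[of _ "exp B"]) (auto simp: spN)
  have iefg: "integrable \<nu> (\<lambda>x. exp (f x) * g x)" if [measurable]: "g \<in> borel_measurable \<nu>" and "\<And>x. x \<in> X \<Longrightarrow> \<bar>g x\<bar> \<le> B" for g
  proof (intro N.integrable_bounded[of _ "exp B * B"])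
    fix x assume "x \<in> space \<nu>"
    then show "\<bar>exp (f x) * g x\<bar> \<le> exp B * B"
      using fB[of x] that(2)[of x] spN unfolding abs_mult by (intro mult_mono) auto
  qed measurable
  have mug: "(\<integral>x. g x \<partial>\<mu>) = (\<integral>x. exp (f x) * g x \<partial>\<nu>)" if "g \<in> G" for g
    using gN[OF that] by (subst \<mu>d, subst integral_density) auto
  define J where "J = (\<lambda>g :: 'a \<Rightarrow> real. (\<integral>x. g x \<partial>\<mu>) - ((\<integral>x. exp (g x) \<partial>\<nu>) - 1))"
  have DJ: "D - J g = (\<integral>x. exp (f x) * (f x - g x) + exp (g x) - exp (f x) \<partial>\<nu>)" if "g \<in> G" for g
    unfolding J_def D_def mug[OF that]
    using iefg[OF fm fB] iefg[OF gN[OF that] gB[OF that]] ieg[OF that] ief ef1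
    by (simp add: right_diff_distrib)
  have gibbs: "J g \<le> D" if "g \<in> G" for g
  proof -
    have "0 \<le> exp (f x) * (f x - g x) + exp (g x) - exp (f x)" for x
    proof -
      \<comment> \<open>The Gibbs inequality is the tangent inequality for exp at
        \<open>f x\<close>, integrated.\<close>
      have "exp (f x) * (1 + (g x - f x)) \<le> exp (f x) * exp (g x - f x)"
        by (intro mult_left_mono exp_ge_add_one_self) auto
      then show ?thesis by (simp add: exp_diff algebra_simps)
    qed
    then have "0 \<le> D - J g" unfolding DJ[OF that] by (intro Bochner_Integration.integral_nonneg)
    then show ?thesis by simp
  qed
  have bias: "D - J \<gamma> \<le> 2 * exp B * b"
  proof -
    have i: "integrable \<nu> (\<lambda>x. \<bar>\<gamma> x - f x\<bar>)"
    proof (intro N.integrable_bounded[of _ "2 * B"])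
      fix x assume "x \<in> space \<nu>"
      then show "\<bar>\<bar>\<gamma> x - f x\<bar>\<bar> \<le> 2 * B" using fB[of x] gB[OF \<gamma>(1), of x] spN by simp
    qed (use gN[OF \<gamma>(1)] in measurable)
    have "D - J \<gamma> \<le> (\<integral>x. 2 * exp B * \<bar>\<gamma> x - f x\<bar> \<partial>\<nu>)"
      unfolding DJ[OF \<gamma>(1)]
    proof (rule integral_mono')
      show "integrable \<nu> (\<lambda>x. 2 * exp B * \<bar>\<gamma> x - f x\<bar>)" using i by auto
      fix x assume x: "x \<in> space \<nu>"
      have "exp (f x) * (f x - \<gamma> x) \<le> exp (f x) * \<bar>\<gamma> x - f x\<bar>" by (intro mult_left_mono) auto
      also have "\<dots> \<le> exp B * \<bar>\<gamma> x - f x\<bar>" using fB[of x] x spN by (intro mult_right_mono) auto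
      finally have "exp (f x) * (f x - \<gamma> x) \<le> exp B * \<bar>\<gamma> x - f x\<bar>" .
      moreover have "exp (\<gamma> x) - exp (f x) \<le> exp B * \<bar>\<gamma> x - f x\<bar>"
      proof -
        have "\<gamma> x \<le> B" "f x \<le> B" using fB[of x] gB[OF \<gamma>(1), of x] x spN by (auto simp: abs_le_iff)
        from exp_lipschitz[OF this] show ?thesis by linarith
      qed
      ultimately show "exp (f x) * (f x - \<gamma> x) + exp (\<gamma> x) - exp (f x) \<le> 2 * exp B * \<bar>\<gamma> x - f x\<bar>" by simp
    qed auto
    also have "\<dots> \<le> 2 * exp B * b" using \<gamma>(2) by simp
    finally show ?thesis .
  qed
  \<comment> \<open>The net is as fine as the target rate and adds only
    \<open>(1 + exp B) * \<eta>\<close>.\<close>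
  define \<eta> where "\<eta> = 1 / sqrt n"
  have \<eta>: "0 < \<eta>" using n by (simp add: \<eta>_def)
  obtain F where F: "F \<subseteq> G" "finite F" "\<And>g. g \<in> G \<Longrightarrow> \<exists>g0\<in>F. \<forall>x\<in>X. \<bar>g x - g0 x\<bar> \<le> \<eta>"
    using finite_netsE[OF nets \<eta>] by blast
  \<comment> \<open>The zero function makes every maximal deviation \<open>dev\<close> nonnegative,
    so one-sided deviations can be added freely; \<open>\<gamma>\<close> is needed for the bound
    from below.\<close>
  define K where "K = insert (\<lambda>_. 0) (insert \<gamma> F)"
  have K: "finite K" "K \<noteq> {}" "K \<subseteq> G" "(\<lambda>_. 0) \<in> K" "\<gamma> \<in> K" using F G0 \<gamma> by (auto simp: K_def)
  define PM where "PM = PiM {1..n} (\<lambda>_. \<mu>)"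
  define PN where "PN = PiM {1..n} (\<lambda>_. \<nu>)"
  interpret PM: prob_space PM unfolding PM_def by (intro prob_space_PiM M.prob_space_axioms)
  interpret PN: prob_space PN unfolding PN_def by (intro prob_space_PiM N.prob_space_axioms)
  interpret P: pair_prob_space PM PN ..
  have spPM: "x i \<in> X" if "x \<in> space PM" "i \<in> {1..n}" for x i using that by (auto simp: PM_def space_PiM spM)
  have spPN: "x i \<in> X" if "x \<in> space PN" "i \<in> {1..n}" for x i using that by (auto simp: PN_def space_PiM spN)
  define dev where "dev = (\<lambda>(m :: 'a measure) (u :: real \<Rightarrow> real) x. Max ((\<lambda>g. \<Sum>i\<in>{1..n}. u (g (x i)) - (\<integral>y. u (g y) \<partial>m)) ` K))"
  define R where "R = A * (chaining_const (DIM('a) + 1) * sqrt n)"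
  have R0: "0 \<le> R" using A chaining_const_nonneg by (simp add: R_def)
  have dev_le: "(\<integral>x. dev m u x \<partial>PiM {1..n} (\<lambda>_. m)) \<le> 2 * L * R"
    if m: "prob_space m" "space m = X" "\<And>g. g \<in> G \<Longrightarrow> g \<in> borel_measurable m"
      and u [measurable]: "u \<in> borel_measurable borel" and L: "0 \<le> L" "\<And>s t. \<bar>s\<bar> \<le> B \<Longrightarrow> \<bar>t\<bar> \<le> B \<Longrightarrow> \<bar>u s - u t\<bar> \<le> L * \<bar>s - t\<bar>"
      and C: "\<And>s. \<bar>s\<bar> \<le> B \<Longrightarrow> \<bar>u s\<bar> \<le> C" for m u L C
    unfolding dev_def
  proof (rule expected_max_deviation_le[where B = "max B C" and v = "\<lambda>g. g" and H = "\<lambda>x e. A * halfspace_disc x {1..n} e"])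
    show "(\<lambda>y. u (g y)) \<in> borel_measurable m" if "g \<in> K" for g using m(3)[of g] that K by (auto intro: measurable_compose)
    show "g \<in> borel_measurable m" if "g \<in> K" for g using m(3)[of g] that K by auto
    show "\<bar>u (g x)\<bar> \<le> max B C \<and> \<bar>g x\<bar> \<le> max B C" if "g \<in> K" "x \<in> space m" for g x
      using gB[of g x] C[of "g x"] that K m(2) by (auto simp: subset_iff le_max_iff_disj)
    show "\<bar>u (k x) - u (l x)\<bar> \<le> L * \<bar>k x - l x\<bar>" if "k \<in> K" "l \<in> K" "x \<in> space m" for k l x
      using that K m(2) by (intro L(2) gB) auto
    show "\<bar>\<Sum>i\<in>{1..n}. e i * k (x i)\<bar> \<le> A * halfspace_disc x {1..n} e"
      if "k \<in> K" "x \<in> space (PiM {1..n} (\<lambda>_. m))" for k x e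
    proof (rule disc)
      show "k \<in> G" using that K by auto
      show "x i \<in> X" if "i \<in> {1..n}" for i using \<open>x \<in> space (PiM {1..n} (\<lambda>_. m))\<close> that m(2) by (auto simp: space_PiM)
    qed
    show "rad_avg {1..n} (\<lambda>e. A * halfspace_disc x {1..n} e) \<le> R" for x :: "nat \<Rightarrow> 'a"
      unfolding rad_avg_cmult R_def using rad_avg_halfspace_disc_le[of "{1..n}" x] A by (intro mult_left_mono) auto
  qed (use m K L in auto)
  have dev_meas: "dev m u \<in> borel_measurable (PiM {1..n} (\<lambda>_. m))"
    if "\<And>g. g \<in> G \<Longrightarrow> g \<in> borel_measurable m" and [measurable]: "u \<in> borel_measurable borel" for m u
  proof -
    have [measurable]: "g \<in> borel_measurable m" if "g \<in> K" for g using \<open>\<And>g. g \<in> G \<Longrightarrow> g \<in> borel_measurable m\<close> that K by auto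
    show ?thesis unfolding dev_def using K by (intro borel_measurable_Max) measurable
  qed
  have dev_ge: "(\<Sum>i\<in>{1..n}. u (g (x i)) - (\<integral>y. u (g y) \<partial>m)) \<le> dev m u x" if "g \<in> K" for m u g x
    unfolding dev_def using K that by (intro Max_ge) auto
  have dev_nonneg: "0 \<le> dev m u x" if "prob_space m" for m u x
  proof -
    have "(\<Sum>i\<in>{1..n}. u 0 - (\<integral>y. u 0 \<partial>m)) \<le> dev m u x" by (rule dev_ge[OF K(4)])
    then show ?thesis by (simp add: prob_space.prob_space[OF that])
  qed
  have dev_nn: "(\<integral>\<^sup>+x. ennreal (dev m u x) \<partial>PiM {1..n} (\<lambda>_. m)) \<le> ennreal (2 * L * R)"
    if m: "prob_space m" "space m = X" "\<And>g. g \<in> G \<Longrightarrow> g \<in> borel_measurable m"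
      and u [measurable]: "u \<in> borel_measurable borel" and L: "0 \<le> L" "\<And>s t. \<bar>s\<bar> \<le> B \<Longrightarrow> \<bar>t\<bar> \<le> B \<Longrightarrow> \<bar>u s - u t\<bar> \<le> L * \<bar>s - t\<bar>"
      and C: "\<And>s. \<bar>s\<bar> \<le> B \<Longrightarrow> \<bar>u s\<bar> \<le> C" for m u L C
  proof -
    interpret m: prob_space m by fact
    interpret Pm: prob_space "PiM {1..n} (\<lambda>_. m)" by (intro prob_space_PiM m)
    have "integrable (PiM {1..n} (\<lambda>_. m)) (dev m u)"
    proof (rule Pm.integrable_bounded[of _ "\<Sum>i\<in>{1..n}. 2 * C", OF dev_meas[OF m(3) u]])
      fix x assume x: "x \<in> space (PiM {1..n} (\<lambda>_. m))"
      show "\<bar>dev m u x\<bar> \<le> (\<Sum>i\<in>{1..n}. 2 * C)"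
        unfolding dev_def
      proof (intro abs_Max_le K order_trans[OF sum_abs] sum_mono)
        fix g i assume gi: "g \<in> K" "i \<in> {1..n}"
        then have g: "g \<in> G" using K by auto
        have "\<bar>\<integral>y. u (g y) \<partial>m\<bar> \<le> C"
          using gB[OF g] C m by (intro m.abs_integral_le_bound measurable_compose[OF m(3)[OF g] u]) auto
        moreover have "\<bar>u (g (x i))\<bar> \<le> C" using x gi m(2) by (intro C gB g) (auto simp: space_PiM)
        ultimately show "\<bar>u (g (x i)) - (\<integral>y. u (g y) \<partial>m)\<bar> \<le> 2 * C" by linarith
      qed
    qed
    then have "(\<integral>\<^sup>+x. ennreal (dev m u x) \<partial>PiM {1..n} (\<lambda>_. m)) = ennreal (\<integral>x. dev m u x \<partial>PiM {1..n} (\<lambda>_. m))"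
      using dev_nonneg[OF m(1)] by (intro nn_integral_eq_integral) auto
    also have "\<dots> \<le> ennreal (2 * L * R)" by (intro ennreal_leI dev_le[OF m u L C]) 
    finally show ?thesis .
  qed
  \<comment> \<open>Both signs occur: the upper bound on the supremum uses one direction of each
    deviation, the lower bound at \<open>\<gamma>\<close> the opposite one. The Lipschitz constants
    are 1 on the \<open>\<mu>\<close> sample and \<open>exp B\<close> on the \<open>\<nu>\<close>
    sample.\<close>
  define h1 where "h1 = (\<lambda>x. dev \<mu> (\<lambda>s. s) x + dev \<mu> (\<lambda>s. - s) x)"
  define h2 where "h2 = (\<lambda>y. dev \<nu> exp y + dev \<nu> (\<lambda>s. - exp s) y)"
  have h10: "0 \<le> h1 x" for x unfolding h1_def using dev_nonneg[OF M.prob_space_axioms] by (simp add: add_nonneg_nonneg)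
  have h20: "0 \<le> h2 x" for x unfolding h2_def using dev_nonneg[OF N.prob_space_axioms] by (simp add: add_nonneg_nonneg)
  have hm [measurable]: "h1 \<in> borel_measurable PM" "h2 \<in> borel_measurable PN"
    unfolding h1_def h2_def PM_def PN_def by (intro borel_measurable_add dev_meas gM gN; measurable)+
  have H1: "(\<integral>\<^sup>+x. ennreal (h1 x) \<partial>PM) \<le> ennreal (4 * R)"
  proof -
    have 1: "(\<integral>\<^sup>+x. ennreal (dev \<mu> (\<lambda>s. s) x) \<partial>PM) \<le> ennreal (2 * 1 * R)" unfolding PM_def
    proof (rule dev_nn[OF M.prob_space_axioms spM gM])
      show "\<bar>s\<bar> \<le> B \<Longrightarrow> \<bar>s\<bar> \<le> B" for s :: real by simp
    qed auto
    have 2: "(\<integral>\<^sup>+x. ennreal (dev \<mu> (\<lambda>s. - s) x) \<partial>PM) \<le> ennreal (2 * 1 * R)" unfolding PM_def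
    proof (rule dev_nn[OF M.prob_space_axioms spM gM])
      show "\<bar>s\<bar> \<le> B \<Longrightarrow> \<bar>- s\<bar> \<le> B" for s :: real by simp
    qed (auto simp: abs_minus_commute)
    have "(\<integral>\<^sup>+x. ennreal (h1 x) \<partial>PM) = (\<integral>\<^sup>+x. ennreal (dev \<mu> (\<lambda>s. s) x) \<partial>PM) + (\<integral>\<^sup>+x. ennreal (dev \<mu> (\<lambda>s. - s) x) \<partial>PM)"
    proof -
      have [measurable]: "dev \<mu> (\<lambda>s. s) \<in> borel_measurable PM" "dev \<mu> (\<lambda>s. - s) \<in> borel_measurable PM"
        unfolding PM_def by (intro dev_meas gM; measurable)+
      have "(\<integral>\<^sup>+x. ennreal (h1 x) \<partial>PM) = (\<integral>\<^sup>+x. ennreal (dev \<mu> (\<lambda>s. s) x) + ennreal (dev \<mu> (\<lambda>s. - s) x) \<partial>PM)"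
        by (simp add: h1_def ennreal_plus dev_nonneg[OF M.prob_space_axioms])
      also have "\<dots> = (\<integral>\<^sup>+x. ennreal (dev \<mu> (\<lambda>s. s) x) \<partial>PM) + (\<integral>\<^sup>+x. ennreal (dev \<mu> (\<lambda>s. - s) x) \<partial>PM)"
        by (intro nn_integral_add) measurable
      finally show ?thesis .
    qed
    also have "\<dots> \<le> ennreal (2 * 1 * R) + ennreal (2 * 1 * R)" by (intro add_mono 1 2)
    also have "\<dots> = ennreal (4 * R)" using R0 by (simp add: ennreal_plus[symmetric] del: ennreal_plus)
    finally show ?thesis .
  qed
  have H2: "(\<integral>\<^sup>+x. ennreal (h2 x) \<partial>PN) \<le> ennreal (4 * exp B * R)"
  proof -
    have l: "\<bar>exp s - exp t\<bar> \<le> exp B * \<bar>s - t\<bar>" if "\<bar>s\<bar> \<le> B" "\<bar>t\<bar> \<le> B" for s t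
      using that by (intro exp_lipschitz) auto
    have 1: "(\<integral>\<^sup>+x. ennreal (dev \<nu> exp x) \<partial>PN) \<le> ennreal (2 * exp B * R)" unfolding PN_def
    proof (rule dev_nn[OF N.prob_space_axioms spN gN])
      show "\<bar>s\<bar> \<le> B \<Longrightarrow> \<bar>exp s\<bar> \<le> exp B" for s :: real by simp
    qed (use l in auto)
    have 2: "(\<integral>\<^sup>+x. ennreal (dev \<nu> (\<lambda>s. - exp s) x) \<partial>PN) \<le> ennreal (2 * exp B * R)" unfolding PN_def
    proof (rule dev_nn[OF N.prob_space_axioms spN gN])
      show "\<bar>s\<bar> \<le> B \<Longrightarrow> \<bar>- exp s\<bar> \<le> exp B" for s :: real by simp
    qed (use l in \<open>auto simp: abs_minus_commute\<close>)
    have "(\<integral>\<^sup>+x. ennreal (h2 x) \<partial>PN) = (\<integral>\<^sup>+x. ennreal (dev \<nu> exp x) \<partial>PN) + (\<integral>\<^sup>+x. ennreal (dev \<nu> (\<lambda>s. - exp s) x) \<partial>PN)"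
    proof -
      have [measurable]: "dev \<nu> exp \<in> borel_measurable PN" "dev \<nu> (\<lambda>s. - exp s) \<in> borel_measurable PN"
        unfolding PN_def by (intro dev_meas gN; measurable)+
      have "(\<integral>\<^sup>+x. ennreal (h2 x) \<partial>PN) = (\<integral>\<^sup>+x. ennreal (dev \<nu> exp x) + ennreal (dev \<nu> (\<lambda>s. - exp s) x) \<partial>PN)"
        by (simp add: h2_def ennreal_plus dev_nonneg[OF N.prob_space_axioms])
      also have "\<dots> = (\<integral>\<^sup>+x. ennreal (dev \<nu> exp x) \<partial>PN) + (\<integral>\<^sup>+x. ennreal (dev \<nu> (\<lambda>s. - exp s) x) \<partial>PN)"
        by (intro nn_integral_add) measurable
      finally show ?thesis .
    qed
    also have "\<dots> \<le> ennreal (2 * exp B * R) + ennreal (2 * exp B * R)" by (intro add_mono 1 2)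
    also have "\<dots> = ennreal (4 * exp B * R)" using R0 by (simp add: ennreal_plus[symmetric] del: ennreal_plus)
    finally show ?thesis .
  qed
  define c where "c = 2 * exp B * b + (1 + exp B) * \<eta>"
  define val where "val = (\<lambda>x y (g :: 'a \<Rightarrow> real). (1 / real n) * (\<Sum>i=1..n. g (x i) - (exp (g (y i)) - 1)))"
  have val_J: "val x y g - J g = (1 / n) * ((\<Sum>i\<in>{1..n}. g (x i) - (\<integral>y. g y \<partial>\<mu>)) - (\<Sum>i\<in>{1..n}. exp (g (y i)) - (\<integral>y. exp (g y) \<partial>\<nu>)))"
    for x y g
    unfolding val_def J_def using n by (simp add: sum_subtractf sum.distrib field_simps)
  have point: "\<bar>neural_estimator G n (x, y) - D\<bar> \<le> (h1 x + h2 y) / n + c"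
    if x: "x \<in> space PM" and y: "y \<in> space PN" for x y
  proof -
    have T: "neural_estimator G n (x, y) = (SUP g\<in>G. val x y g)" by (simp add: neural_estimator_def val_def)
    have up: "val x y g - D \<le> (h1 x + h2 y) / n" if "g \<in> K" for g
    proof -
      have "val x y g - D \<le> val x y g - J g" using gibbs[of g] that K by auto
      also have "\<dots> \<le> (1 / n) * (h1 x + h2 y)"
        unfolding val_J
      proof (intro mult_left_mono)
        have "(\<Sum>i\<in>{1..n}. g (x i) - (\<integral>y. g y \<partial>\<mu>)) \<le> dev \<mu> (\<lambda>s. s) x" by (rule dev_ge[OF that])
        moreover have "0 \<le> dev \<mu> (\<lambda>s. - s) x" by (rule dev_nonneg[OF M.prob_space_axioms])
        ultimately have "(\<Sum>i\<in>{1..n}. g (x i) - (\<integral>y. g y \<partial>\<mu>)) \<le> h1 x" unfolding h1_def by linarith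
        moreover have "- (\<Sum>i\<in>{1..n}. exp (g (y i)) - (\<integral>y. exp (g y) \<partial>\<nu>)) \<le> h2 y"
        proof -
          have "(\<Sum>i\<in>{1..n}. - exp (g (y i)) - (\<integral>y. - exp (g y) \<partial>\<nu>)) \<le> dev \<nu> (\<lambda>s. - exp s) y" by (rule dev_ge[OF that])
          moreover have "0 \<le> dev \<nu> exp y" by (rule dev_nonneg[OF N.prob_space_axioms])
          ultimately show ?thesis unfolding h2_def by (simp add: sum_negf[symmetric])
        qed
        ultimately show "(\<Sum>i\<in>{1..n}. g (x i) - (\<integral>y. g y \<partial>\<mu>)) - (\<Sum>i\<in>{1..n}. exp (g (y i)) - (\<integral>y. exp (g y) \<partial>\<nu>)) \<le> h1 x + h2 y" by linarith
      qed simp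
      finally show ?thesis by simp
    qed
    have valG: "val x y g \<le> (h1 x + h2 y) / n + D + (1 + exp B) * \<eta>" if g: "g \<in> G" for g
    proof -
      obtain g0 where g0: "g0 \<in> F" "\<And>z. z \<in> X \<Longrightarrow> \<bar>g z - g0 z\<bar> \<le> \<eta>" using F(3)[OF g] by blast
      then have g0G: "g0 \<in> G" "g0 \<in> K" using F by (auto simp: K_def)
      have "val x y g - val x y g0 = (1 / n) * (\<Sum>i=1..n. (g (x i) - g0 (x i)) - (exp (g (y i)) - exp (g0 (y i))))"
        unfolding val_def right_diff_distrib[symmetric] sum_subtractf[symmetric]
        by (intro arg_cong[where f = "\<lambda>s. 1 / real n * s"] sum.cong refl) simp
      also have "\<dots> \<le> (1 / n) * (\<Sum>i=1..n. (1 + exp B) * \<eta>)"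
      proof (intro mult_left_mono sum_mono)
        fix i assume i: "i \<in> {1..n}"
        note X = spPM[OF x i] spPN[OF y i]
        have "\<bar>exp (g (y i)) - exp (g0 (y i))\<bar> \<le> exp B * \<bar>g (y i) - g0 (y i)\<bar>"
          using gB[OF g X(2)] gB[OF g0G(1) X(2)] by (intro exp_lipschitz) auto
        also have "\<dots> \<le> exp B * \<eta>" using g0(2)[OF X(2)] by (intro mult_left_mono) auto
        finally show "(g (x i) - g0 (x i)) - (exp (g (y i)) - exp (g0 (y i))) \<le> (1 + exp B) * \<eta>"
          using g0(2)[OF X(1)] by (simp add: algebra_simps abs_le_iff)
      qed simp
      also have "\<dots> = (1 + exp B) * \<eta>" using n by simp
      finally show ?thesis using up[OF g0G(2)] by linarith
    qed
    have "(SUP g\<in>G. val x y g) \<le> (h1 x + h2 y) / n + D + (1 + exp B) * \<eta>"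
      using G0 by (intro cSUP_least valG) auto
    moreover have "val x y \<gamma> \<le> (SUP g\<in>G. val x y g)"
      using valG by (intro cSUP_upper \<gamma>(1) bdd_aboveI2)
    moreover have "J \<gamma> - val x y \<gamma> \<le> (h1 x + h2 y) / n"
    proof -
      have "J \<gamma> - val x y \<gamma> = (1 / n) * ((\<Sum>i\<in>{1..n}. exp (\<gamma> (y i)) - (\<integral>y. exp (\<gamma> y) \<partial>\<nu>)) - (\<Sum>i\<in>{1..n}. \<gamma> (x i) - (\<integral>y. \<gamma> y \<partial>\<mu>)))"
        using val_J[of x y \<gamma>] by (simp add: algebra_simps)
      also have "\<dots> \<le> (1 / n) * (h1 x + h2 y)"
      proof (intro mult_left_mono)
        have "- (\<Sum>i\<in>{1..n}. \<gamma> (x i) - (\<integral>y. \<gamma> y \<partial>\<mu>)) \<le> h1 x"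
        proof -
          have "(\<Sum>i\<in>{1..n}. - \<gamma> (x i) - (\<integral>y. - \<gamma> y \<partial>\<mu>)) \<le> dev \<mu> (\<lambda>s. - s) x" by (rule dev_ge[OF K(5)])
          moreover have "0 \<le> dev \<mu> (\<lambda>s. s) x" by (rule dev_nonneg[OF M.prob_space_axioms])
          ultimately show ?thesis unfolding h1_def by (simp add: sum_negf[symmetric])
        qed
        moreover have "(\<Sum>i\<in>{1..n}. exp (\<gamma> (y i)) - (\<integral>y. exp (\<gamma> y) \<partial>\<nu>)) \<le> h2 y"
        proof -
          have "(\<Sum>i\<in>{1..n}. exp (\<gamma> (y i)) - (\<integral>y. exp (\<gamma> y) \<partial>\<nu>)) \<le> dev \<nu> exp y" by (rule dev_ge[OF K(5)])
          moreover have "0 \<le> dev \<nu> (\<lambda>s. - exp s) y" by (rule dev_nonneg[OF N.prob_space_axioms])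
          ultimately show ?thesis unfolding h2_def by linarith
        qed
        ultimately show "(\<Sum>i\<in>{1..n}. exp (\<gamma> (y i)) - (\<integral>y. exp (\<gamma> y) \<partial>\<nu>)) - (\<Sum>i\<in>{1..n}. \<gamma> (x i) - (\<integral>y. \<gamma> y \<partial>\<mu>)) \<le> h1 x + h2 y" by linarith
      qed simp
      finally show ?thesis by simp
    qed
    moreover have "0 \<le> 2 * exp B * b" using bias gibbs[OF \<gamma>(1)] by linarith
    moreover have "0 \<le> (1 + exp B) * \<eta>" using \<eta> by (intro mult_nonneg_nonneg add_nonneg_nonneg) auto
    ultimately show ?thesis using bias unfolding T c_def abs_le_iff by linarith
  qed
  have c0: "0 \<le> c"
  proof -
    have "0 \<le> 2 * exp B * b" using bias gibbs[OF \<gamma>(1)] by linarith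
    moreover have "0 \<le> (1 + exp B) * \<eta>" using \<eta> by (intro mult_nonneg_nonneg add_nonneg_nonneg) auto
    ultimately show ?thesis unfolding c_def by (rule add_nonneg_nonneg)
  qed
  have "risk n (neural_estimator G n) \<mu> \<nu> = (\<integral>\<^sup>+s. ennreal \<bar>neural_estimator G n s - D\<bar> \<partial>(PM \<Otimes>\<^sub>M PN))"
    unfolding risk_def KL sample_space_def PM_def PN_def ..
  also have "\<dots> \<le> (\<integral>\<^sup>+s. ennreal ((h1 (fst s) + h2 (snd s)) / n + c) \<partial>(PM \<Otimes>\<^sub>M PN))"
    using point by (intro nn_integral_mono ennreal_leI) (auto simp: space_pair_measure)
  also have "\<dots> = (\<integral>\<^sup>+x. (\<integral>\<^sup>+y. ennreal ((h1 x + h2 y) / n + c) \<partial>PN) \<partial>PM)"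
    by (subst PN.nn_integral_fst[symmetric]) (auto intro!: measurable_compose[OF _ measurable_ennreal])
  also have "\<dots> = (\<integral>\<^sup>+x. (\<integral>\<^sup>+y. ennreal (1 / n) * ennreal (h1 x) + (ennreal (1 / n) * ennreal (h2 y) + ennreal c) \<partial>PN) \<partial>PM)"
    using h10 h20 c0 by (intro nn_integral_cong)
      (auto simp: ennreal_plus[symmetric] ennreal_mult[symmetric] add_divide_distrib add_ac simp del: ennreal_plus intro!: arg_cong[where f = ennreal])
  also have "\<dots> = ennreal (1 / n) * (\<integral>\<^sup>+x. ennreal (h1 x) \<partial>PM) + (ennreal (1 / n) * (\<integral>\<^sup>+y. ennreal (h2 y) \<partial>PN) + ennreal c)"
    by (simp add: nn_integral_add nn_integral_cmult PN.emeasure_space_1 PM.emeasure_space_1)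
  also have "\<dots> \<le> ennreal (1 / n) * ennreal (4 * R) + (ennreal (1 / n) * ennreal (4 * exp B * R) + ennreal c)"
    by (intro add_mono mult_left_mono H1 H2) auto
  also have "\<dots> = ennreal ((1 / n) * (4 * R) + ((1 / n) * (4 * exp B * R) + c))"
    using R0 c0 by (simp add: ennreal_plus[symmetric] ennreal_mult[symmetric] del: ennreal_plus)
  also have "(1 / n) * (4 * R) + ((1 / n) * (4 * exp B * R) + c) =
      2 * exp B * b + (1 + exp B) * (4 * A * chaining_const (DIM('a) + 1) + 1) / sqrt n"
  proof -
    have "R / n = A * chaining_const (DIM('a) + 1) / sqrt n"
    proof -
      have "sqrt n * sqrt n = n" by simp
      then have "sqrt n / n = 1 / sqrt n" using n by (simp add: field_simps)
      moreover have "R / n = A * chaining_const (DIM('a) + 1) * (sqrt n / n)" by (simp add: R_def)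
      ultimately show ?thesis by simp
    qed
    moreover have "(1 / n) * (4 * R) + ((1 / n) * (4 * exp B * R) + c) = 4 * (1 + exp B) * (R / n) + c"
      by (simp add: algebra_simps)
    ultimately show ?thesis unfolding c_def \<eta>_def by (simp add: algebra_simps add_divide_distrib)
  qed
  finally show ?thesis .
qed

section \<open>Lower bound\<close>


lemma PiM_density:
  fixes M :: "'a measure" and l :: "'a \<Rightarrow> ennreal"
  assumes "prob_space M" "prob_space (density M l)" and [measurable]: "l \<in> borel_measurable M" and I: "finite I"
  shows "PiM I (\<lambda>_. density M l) = density (PiM I (\<lambda>_. M)) (\<lambda>x. \<Prod>i\<in>I. l (x i))"
proof -
  interpret M: prob_space M by fact
  interpret Ml: prob_space "density M l" by fact
  interpret P: product_prob_space "\<lambda>_. M" I ..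
  interpret Pl: product_prob_space "\<lambda>_. density M l" I ..
  show ?thesis
  proof (rule Pl.PiM_eqI[OF I, symmetric])
    show "sets (density (PiM I (\<lambda>_. M)) (\<lambda>x. \<Prod>i\<in>I. l (x i))) = sets (PiM I (\<lambda>_. density M l))"
      by (simp cong: sets_PiM_cong)
    fix A assume "\<And>i. i \<in> I \<Longrightarrow> A i \<in> sets (density M l)"
    then have A [measurable]: "\<And>i. i \<in> I \<Longrightarrow> A i \<in> sets M" by simp
    have "emeasure (density (PiM I (\<lambda>_. M)) (\<lambda>x. \<Prod>i\<in>I. l (x i))) (PiE I A) =
        (\<integral>\<^sup>+x. (\<Prod>i\<in>I. l (x i)) * indicator (PiE I A) x \<partial>PiM I (\<lambda>_. M))"
      using I A by (intro emeasure_density sets_PiM_I_finite) auto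
    also have "\<dots> = (\<integral>\<^sup>+x. (\<Prod>i\<in>I. l (x i) * indicator (A i) (x i)) \<partial>PiM I (\<lambda>_. M))"
    proof (intro nn_integral_cong)
      fix x assume "x \<in> space (PiM I (\<lambda>_. M))"
      then have "x \<in> extensional I" by (simp add: space_PiM PiE_def)
      then have "indicator (PiE I A) x = (\<Prod>i\<in>I. indicator (A i) (x i) :: ennreal)"
        using I by (auto simp: indicator_def PiE_def Pi_def)
      then show "(\<Prod>i\<in>I. l (x i)) * indicator (PiE I A) x = (\<Prod>i\<in>I. l (x i) * indicator (A i) (x i))"
        by (simp add: prod.distrib)
    qed
    also have "\<dots> = (\<Prod>i\<in>I. \<integral>\<^sup>+x. l x * indicator (A i) x \<partial>M)"
      using I A by (intro P.product_nn_integral_prod) auto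
    also have "\<dots> = (\<Prod>i\<in>I. emeasure (density M l) (A i))"
      using A by (intro prod.cong refl) (simp add: emeasure_density)
    finally show "emeasure (density (PiM I (\<lambda>_. M)) (\<lambda>x. \<Prod>i\<in>I. l (x i))) (PiE I A) = (\<Prod>i\<in>I. emeasure (density M l) (A i))" .
  qed
qed

text \<open>
  Le Cam's two-point method. The overlap of the two product laws is controlled by the \<open>\<chi>\<^sup>2\<close> divergence
  because it tensorizes exactly, via \<open>\<bar>u - v\<bar> \<le> (u + (v - u)\<^sup>2 / u) / 2\<close>.
\<close>

lemma le_cam:
  fixes l0 l1 :: "'a \<Rightarrow> real" and T :: "(nat \<Rightarrow> 'a) \<times> (nat \<Rightarrow> 'a) \<Rightarrow> real"
  assumes N: "prob_space N" and m [measurable]: "l0 \<in> borel_measurable N" "l1 \<in> borel_measurable N"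
    and b: "\<And>x. x \<in> space N \<Longrightarrow> 0 < l0 x \<and> 0 < l1 x \<and> l0 x \<le> C \<and> l1 x \<le> C \<and> l1 x ^ 2 / l0 x \<le> C"
    and one: "(\<integral>x. l0 x \<partial>N) = 1" "(\<integral>x. l1 x \<partial>N) = 1"
    and chi: "(\<integral>x. l1 x ^ 2 / l0 x \<partial>N) ^ n \<le> 2"
    and T: "T \<in> borel_measurable (PiM {1..n} (\<lambda>_. N) \<Otimes>\<^sub>M PiM {1..n} (\<lambda>_. N))"
  shows "ennreal (\<bar>D0 - D1\<bar> / 2) \<le>
    (\<integral>\<^sup>+s. ennreal \<bar>T s - D0\<bar> \<partial>(PiM {1..n} (\<lambda>_. density N l0) \<Otimes>\<^sub>M PiM {1..n} (\<lambda>_. N))) +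
    (\<integral>\<^sup>+s. ennreal \<bar>T s - D1\<bar> \<partial>(PiM {1..n} (\<lambda>_. density N l1) \<Otimes>\<^sub>M PiM {1..n} (\<lambda>_. N)))"
proof -
  interpret N: prob_space N by fact
  define P where "P = PiM {1..n} (\<lambda>_. N)"
  interpret PN: product_prob_space "\<lambda>_. N" "{1..n}" ..
  interpret P: prob_space P unfolding P_def by (intro prob_space_PiM N)
  define L where "L = (\<lambda>(l :: 'a \<Rightarrow> real) x. \<Prod>i\<in>{1..n}. l (x i))"
  have Lm [measurable]: "L l \<in> borel_measurable P" if [measurable]: "l \<in> borel_measurable N" for l
    unfolding L_def P_def by measurable
  have il: "integrable N l" if "l \<in> borel_measurable N" "\<And>x. x \<in> space N \<Longrightarrow> 0 < l x \<and> l x \<le> C" for l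
    using that by (intro N.integrable_bounded[of _ C]) (auto simp: abs_of_pos)
  have intL: "integrable P (L l)" "(\<integral>x. L l x \<partial>P) = (\<integral>x. l x \<partial>N) ^ n"
    if "l \<in> borel_measurable N" "\<And>x. x \<in> space N \<Longrightarrow> 0 < l x \<and> l x \<le> C" for l
  proof -
    show "integrable P (L l)"
      unfolding L_def P_def using il[OF that] by (intro PN.product_integrable_prod) auto
    have "(\<integral>x. L l x \<partial>P) = (\<Prod>i\<in>{1..n}. \<integral>x. l x \<partial>N)"
      unfolding L_def P_def using il[OF that] by (intro PN.product_integral_prod) auto
    then show "(\<integral>x. L l x \<partial>P) = (\<integral>x. l x \<partial>N) ^ n" by simp
  qed
  have Lpos: "0 < L l x" if "x \<in> space P" "\<And>x. x \<in> space N \<Longrightarrow> 0 < l x" for l x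
    unfolding L_def using that(1) by (intro prod_pos ballI that(2)) (auto simp: P_def space_PiM)
  have dens: "PiM {1..n} (\<lambda>_. density N l) = density P (\<lambda>x. ennreal (L l x))"
    if lm [measurable]: "l \<in> borel_measurable N" and lb: "\<And>x. x \<in> space N \<Longrightarrow> 0 < l x \<and> l x \<le> C" and l1: "(\<integral>x. l x \<partial>N) = 1" for l
  proof -
    have "prob_space (density N l)"
    proof (rule prob_spaceI)
      have "emeasure (density N l) (space (density N l)) = (\<integral>\<^sup>+x. ennreal (l x) \<partial>N)"
        by (simp add: emeasure_density cong: nn_integral_cong)
      also have "\<dots> = 1" using lb by (subst nn_integral_eq_integral[OF il[OF lm lb]]) (auto simp: l1 less_imp_le)
      finally show "emeasure (density N l) (space (density N l)) = 1" .
    qed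
    then have "PiM {1..n} (\<lambda>_. density N l) = density P (\<lambda>x. \<Prod>i\<in>{1..n}. ennreal (l (x i)))"
      unfolding P_def by (intro PiM_density N) auto
    also have "\<dots> = density P (\<lambda>x. ennreal (L l x))"
    proof (intro density_cong)
      show "(\<lambda>x. \<Prod>i\<in>{1..n}. ennreal (l (x i))) \<in> borel_measurable P" unfolding P_def by measurable
      have "(\<Prod>i\<in>{1..n}. ennreal (l (x i))) = ennreal (L l x)" if "x \<in> space P" for x
        unfolding L_def using lb that by (intro prod_ennreal less_imp_le conjunct1[OF lb]) (auto simp: P_def space_PiM)
      then show "AE x in P. (\<Prod>i\<in>{1..n}. ennreal (l (x i))) = ennreal (L l x)" by (intro AE_I2)
    qed measurable
    finally show ?thesis .
  qed
  \<comment> \<open>The second sample has the same law under both hypotheses and is integrated out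
    first; only the first sample carries a likelihood ratio.\<close>
  define \<phi> where "\<phi> = (\<lambda>D x. \<integral>\<^sup>+y. ennreal \<bar>T (x, y) - D\<bar> \<partial>P)"
  have TP [measurable]: "T \<in> borel_measurable (P \<Otimes>\<^sub>M P)" using T by (simp add: P_def)
  have \<phi>m [measurable]: "\<phi> D \<in> borel_measurable P" for D
    unfolding \<phi>_def by (intro P.borel_measurable_nn_integral) measurable
  have risk: "(\<integral>\<^sup>+s. ennreal \<bar>T s - D\<bar> \<partial>(PiM {1..n} (\<lambda>_. density N l) \<Otimes>\<^sub>M P)) = (\<integral>\<^sup>+x. ennreal (L l x) * \<phi> D x \<partial>P)"
    if lm [measurable]: "l \<in> borel_measurable N" and lb: "\<And>x. x \<in> space N \<Longrightarrow> 0 < l x \<and> l x \<le> C" and l1: "(\<integral>x. l x \<partial>N) = 1" for l D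
  proof -
    have "(\<lambda>s. ennreal \<bar>T s - D\<bar>) \<in> borel_measurable (P \<Otimes>\<^sub>M P)" by measurable
    then have "(\<lambda>s. ennreal \<bar>T s - D\<bar>) \<in> borel_measurable (density P (\<lambda>x. ennreal (L l x)) \<Otimes>\<^sub>M P)"
      by (simp only: measurable_cong_sets[OF sets_pair_measure_cong[OF sets_density refl] refl])
    then have "(\<integral>\<^sup>+s. ennreal \<bar>T s - D\<bar> \<partial>(density P (\<lambda>x. ennreal (L l x)) \<Otimes>\<^sub>M P)) =
        (\<integral>\<^sup>+x. \<phi> D x \<partial>density P (\<lambda>x. ennreal (L l x)))"
      unfolding \<phi>_def by (rule P.nn_integral_fst[symmetric])
    also have "\<dots> = (\<integral>\<^sup>+x. ennreal (L l x) * \<phi> D x \<partial>P)" by (intro nn_integral_density) measurable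
    finally show ?thesis using dens[OF lm lb l1] by simp
  qed
  have b0: "\<And>x. x \<in> space N \<Longrightarrow> 0 < l0 x \<and> l0 x \<le> C" and b1: "\<And>x. x \<in> space N \<Longrightarrow> 0 < l1 x \<and> l1 x \<le> C" using b by auto
  define \<Delta> where "\<Delta> = \<bar>D0 - D1\<bar>"
  define mn where "mn = (\<lambda>x. min (L l0 x) (L l1 x))"
  \<comment> \<open>Treated like a density, \<open>l2\<close> has the product
    \<open>L l1 x ^ 2 / L l0 x\<close>, so the integral of that quotient is an exact
    \<open>n\<close>-th power.\<close>
  define l2 where "l2 = (\<lambda>x. l1 x ^ 2 / l0 x)"
  have b2: "\<And>x. x \<in> space N \<Longrightarrow> 0 < l2 x \<and> l2 x \<le> C" using b by (auto simp: l2_def intro!: divide_pos_pos zero_less_power)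
  have l2m [measurable]: "l2 \<in> borel_measurable N" unfolding l2_def by measurable
  have L2: "L l2 x = L l1 x ^ 2 / L l0 x" for x by (simp add: L_def l2_def prod_dividef prod_power_distrib)
  have pos: "0 < L l0 x" "0 < L l1 x" "0 < L l2 x" if "x \<in> space P" for x
    using that b0 b1 b2 by (auto intro!: Lpos)
  have mn_ge: "L l1 x - L l2 x / 4 \<le> mn x" if x: "x \<in> space P" for x
  proof -
    \<comment> \<open>Expanding the square gives \<open>L l0 x \<ge> L l1 x - L l2 x / 4\<close>;
      integrating, with \<open>chi\<close> at most 2, leaves an overlap of at least
      \<open>1 - 2 / 4\<close>.\<close>
    have "0 \<le> (L l0 x - L l1 x / 2)\<^sup>2 / L l0 x" using pos[OF x] by simp
    also have "\<dots> = L l0 x - L l1 x + L l2 x / 4"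
      using pos[OF x] unfolding L2 by (simp add: field_simps power2_eq_square)
    finally show ?thesis using pos(3)[OF x] unfolding mn_def by simp
  qed
  have i0: "integrable P (L l0)" and i1: "integrable P (L l1)" and i2: "integrable P (L l2)"
    by (intro intL m l2m b0 b1 b2; assumption)+
  have imn: "integrable P mn" unfolding mn_def by (intro integrable_min i0 i1)
  have "1 / 2 \<le> (\<integral>x. l1 x \<partial>N) ^ n - (\<integral>x. l2 x \<partial>N) ^ n / 4" using chi unfolding one l2_def by simp
  also have "\<dots> = (\<integral>x. L l1 x - L l2 x / 4 \<partial>P)"
    using i1 i2 intL(2)[OF m(2) b1] intL(2)[OF l2m b2] by simp
  also have "\<dots> \<le> (\<integral>x. mn x \<partial>P)" using i1 i2 imn mn_ge by (intro integral_mono) auto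
  finally have half: "1 / 2 \<le> (\<integral>x. mn x \<partial>P)" .
  have \<phi>_ge: "ennreal \<Delta> \<le> \<phi> D0 x + \<phi> D1 x" if x: "x \<in> space P" for x
  proof -
    have Tx: "(\<lambda>y. T (x, y)) \<in> borel_measurable P" by (rule measurable_compose[OF measurable_Pair1'[OF x] TP])
    have "ennreal \<Delta> = (\<integral>\<^sup>+y. ennreal \<Delta> \<partial>P)" by (simp add: P.emeasure_space_1)
    also have "\<dots> \<le> (\<integral>\<^sup>+y. ennreal \<bar>T (x, y) - D0\<bar> + ennreal \<bar>T (x, y) - D1\<bar> \<partial>P)"
    proof (intro nn_integral_mono)
      fix y
      have "\<Delta> \<le> \<bar>T (x, y) - D0\<bar> + \<bar>T (x, y) - D1\<bar>" unfolding \<Delta>_def by linarith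
      then show "ennreal \<Delta> \<le> ennreal \<bar>T (x, y) - D0\<bar> + ennreal \<bar>T (x, y) - D1\<bar>"
        by (simp add: ennreal_plus[symmetric] ennreal_leI del: ennreal_plus)
    qed
    also have "\<dots> = \<phi> D0 x + \<phi> D1 x" unfolding \<phi>_def
      by (intro nn_integral_add measurable_compose[OF _ measurable_ennreal] borel_measurable_abs borel_measurable_diff
          borel_measurable_const Tx)
    finally show ?thesis .
  qed
  have "ennreal (\<Delta> / 2) \<le> ennreal (\<Delta> * (\<integral>x. mn x \<partial>P))"
    using mult_left_mono[OF half, of \<Delta>] by (intro ennreal_leI) (simp add: \<Delta>_def)
  also have "\<dots> = ennreal \<Delta> * (\<integral>\<^sup>+x. ennreal (mn x) \<partial>P)"
  proof -
    have "AE x in P. 0 \<le> mn x" using pos by (intro AE_I2) (auto simp: mn_def less_imp_le)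
    then show ?thesis
      using half by (subst nn_integral_eq_integral[OF imn]) (auto simp: \<Delta>_def ennreal_mult)
  qed
  also have "\<dots> = (\<integral>\<^sup>+x. ennreal \<Delta> * ennreal (mn x) \<partial>P)"
    using imn by (intro nn_integral_cmult[symmetric]) auto
  also have "\<dots> \<le> (\<integral>\<^sup>+x. ennreal (L l0 x) * \<phi> D0 x + ennreal (L l1 x) * \<phi> D1 x \<partial>P)"
  proof (intro nn_integral_mono)
    fix x assume x: "x \<in> space P"
    have "ennreal \<Delta> * ennreal (mn x) \<le> (\<phi> D0 x + \<phi> D1 x) * ennreal (mn x)"
      by (intro mult_right_mono \<phi>_ge x) simp
    also have "\<dots> = ennreal (mn x) * \<phi> D0 x + ennreal (mn x) * \<phi> D1 x" by (simp add: distrib_left mult.commute)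
    also have "\<dots> \<le> ennreal (L l0 x) * \<phi> D0 x + ennreal (L l1 x) * \<phi> D1 x"
      by (intro add_mono mult_right_mono ennreal_leI) (auto simp: mn_def)
    finally show "ennreal \<Delta> * ennreal (mn x) \<le> ennreal (L l0 x) * \<phi> D0 x + ennreal (L l1 x) * \<phi> D1 x" .
  qed
  also have "\<dots> = (\<integral>\<^sup>+x. ennreal (L l0 x) * \<phi> D0 x \<partial>P) + (\<integral>\<^sup>+x. ennreal (L l1 x) * \<phi> D1 x \<partial>P)"
    by (intro nn_integral_add) measurable
  also have "\<dots> = (\<integral>\<^sup>+s. ennreal \<bar>T s - D0\<bar> \<partial>(PiM {1..n} (\<lambda>_. density N l0) \<Otimes>\<^sub>M P)) +
      (\<integral>\<^sup>+s. ennreal \<bar>T s - D1\<bar> \<partial>(PiM {1..n} (\<lambda>_. density N l1) \<Otimes>\<^sub>M P))"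
    by (simp only: risk[OF m(1) b0 one(1)] risk[OF m(2) b1 one(2)])
  finally show ?thesis unfolding \<Delta>_def P_def .
qed


section \<open>Cosines as Fourier transforms of positive measures\<close>

lemma variation_measure:
  fixes P :: "'a::topological_space measure"
  assumes "finite_measure P" and sP: "sets P = sets borel"
  shows "variation (\<lambda>A. complex_of_real (measure P A)) = P"
proof -
  interpret finite_measure P by fact
  have sp: "space P = UNIV" using sets_eq_imp_space_eq[OF sP] by simp
  have eq: "(SUP E \<in> {E :: nat \<Rightarrow> 'a set. range E \<subseteq> sets borel \<and> disjoint_family E \<and> (\<Union>i. E i) = A}.
      (\<Sum>i. ennreal (cmod (complex_of_real (measure P (E i)))))) = emeasure P A"
    if A: "A \<in> sigma_sets UNIV (sets borel)" for A
  proof -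
    have AP: "A \<in> sets P" using A by (simp add: sP sets.sigma_sets_eq[of borel, simplified])
    have *: "(\<Sum>i. ennreal (cmod (complex_of_real (measure P (E i))))) = emeasure P A"
      if "range E \<subseteq> sets borel" "disjoint_family E" "(\<Union>i. E i) = A" for E :: "nat \<Rightarrow> 'a set"
    proof -
      have "(\<Sum>i. ennreal (cmod (complex_of_real (measure P (E i))))) = (\<Sum>i. emeasure P (E i))"
        by (simp add: emeasure_eq_measure)
      also have "\<dots> = emeasure P (\<Union>i. E i)" using that sP by (intro suminf_emeasure) auto
      finally show ?thesis using that by simp
    qed
    \<comment> \<open>By \<open>*\<close> every partition has the same total, so the trivial one
      shows that the supremum is attained.\<close>
    define E where "E = (\<lambda>i :: nat. if i = 0 then A else {})"
    have E: "range E \<subseteq> sets borel" "disjoint_family E" "(\<Union>i. E i) = A"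
      using AP sP by (auto simp: E_def disjoint_family_on_def split: if_splits)
    show ?thesis
    proof (intro antisym SUP_least)
      show "emeasure P A \<le> (SUP E \<in> {E :: nat \<Rightarrow> 'a set. range E \<subseteq> sets borel \<and> disjoint_family E \<and> (\<Union>i. E i) = A}.
          (\<Sum>i. ennreal (cmod (complex_of_real (measure P (E i))))))"
        unfolding *[OF E, symmetric] using E by (intro SUP_upper) auto
      fix E :: "nat \<Rightarrow> 'a set"
      assume "E \<in> {E. range E \<subseteq> sets borel \<and> disjoint_family E \<and> (\<Union>i. E i) = A}"
      then show "(\<Sum>i. ennreal (cmod (complex_of_real (measure P (E i))))) \<le> emeasure P A"
        by (elim CollectE conjE) (simp only: * order_refl)
    qed
  qed
  have "variation (\<lambda>A. complex_of_real (measure P A)) = measure_of UNIV (sets borel) (emeasure P)"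
    unfolding variation_def by (intro measure_of_eq eq) auto
  also have "\<dots> = P" using measure_of_of_measure[of P] sp sP by simp
  finally show ?thesis .
qed

text \<open>A positive measure is its own variation and has polar density 1; the vanishing sine
  integral makes its Fourier transform real.\<close>

lemma fourier_representation_measure:
  fixes P :: "'a::euclidean_space measure"
  assumes P: "finite_measure P" "sets P = sets borel"
    and g: "\<And>x. g x = (\<integral>\<omega>. cos (\<omega> \<bullet> x) \<partial>P)" "\<And>x. (\<integral>\<omega>. sin (\<omega> \<bullet> x) \<partial>P) = 0"
  shows "fourier_representation g (\<lambda>A. complex_of_real (measure P A))"
  unfolding fourier_representation_def
proof (intro conjI exI[of _ "\<lambda>_. 1"] allI)
  interpret finite_measure P by fact
  show "complex_borel_measure (\<lambda>A. complex_of_real (measure P A))"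
    unfolding complex_borel_measure_def using P(2) by (auto intro!: sums_of_real finite_measure_UNION)
  show "polar_density (\<lambda>A. complex_of_real (measure P A)) (\<lambda>_. 1)"
    unfolding polar_density_def variation_measure[OF P]
  proof (intro conjI ballI allI)
    fix A :: "'a set" assume A: "A \<in> sets borel"
    have "(LINT \<omega>:A|P. (1 :: complex)) = (\<integral>\<omega>. complex_of_real (indicator A \<omega>) \<partial>P)"
      unfolding set_lebesgue_integral_def by (intro Bochner_Integration.integral_cong) (auto simp: indicator_def)
    also have "\<dots> = complex_of_real (\<integral>\<omega>. indicator A \<omega> \<partial>P)" by (rule integral_complex_of_real)
    also have "(\<integral>\<omega>. indicator A \<omega> \<partial>P) = measure P A" using A P(2) by simp
    finally show "complex_of_real (measure P A) = (LINT \<omega>:A|P. 1)" by simp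
  qed auto
  fix x
  have meas: "(\<lambda>\<omega>. exp (\<i> * complex_of_real (\<omega> \<bullet> x))) \<in> borel_measurable P"
    unfolding measurable_cong_sets[OF P(2) refl] by measurable
  have int: "integrable P (\<lambda>\<omega>. exp (\<i> * complex_of_real (\<omega> \<bullet> x)))"
    using meas by (intro integrable_const_bound[of _ 1]) auto
  have "(\<integral>\<omega>. exp (\<i> * complex_of_real (\<omega> \<bullet> x)) \<partial>P) = complex_of_real (g x)"
  proof (rule complex_eqI)
    have "Re (\<integral>\<omega>. exp (\<i> * complex_of_real (\<omega> \<bullet> x)) \<partial>P) = (\<integral>\<omega>. cos (\<omega> \<bullet> x) \<partial>P)"
      by (subst integral_Re[OF int, symmetric]) (simp add: cis_conv_exp[symmetric])
    then show "Re (\<integral>\<omega>. exp (\<i> * complex_of_real (\<omega> \<bullet> x)) \<partial>P) = Re (complex_of_real (g x))" by (simp add: g)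
    have "Im (\<integral>\<omega>. exp (\<i> * complex_of_real (\<omega> \<bullet> x)) \<partial>P) = (\<integral>\<omega>. sin (\<omega> \<bullet> x) \<partial>P)"
      by (subst integral_Im[OF int, symmetric]) (simp add: cis_conv_exp[symmetric])
    then show "Im (\<integral>\<omega>. exp (\<i> * complex_of_real (\<omega> \<bullet> x)) \<partial>P) = Im (complex_of_real (g x))" by (simp add: g)
  qed
  then show "complex_of_real (g x) = (\<integral>\<omega>. exp (\<i> * complex_of_real (\<omega> \<bullet> x)) * 1 \<partial>variation (\<lambda>A. complex_of_real (measure P A)))"
    unfolding variation_measure[OF P] by simp
qed

text \<open>The measure has mass \<open>b\<close> at 0 and \<open>a / 2\<close> at each of
  \<open>u\<close> and \<open>- u\<close>, positive because \<open>a\<close> and \<open>b\<close>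
  are nonnegative. For \<open>m > 0\<close> the atom at 0 does not contribute to the moment.\<close>

lemma cosine_representation:
  fixes u :: "real ^ 'd" and a b :: real
  assumes "0 \<le> a" "0 \<le> b"
  shows "\<exists>F. fourier_representation (\<lambda>x. b + a * cos (u \<bullet> x)) F \<and>
    (\<forall>m>0. spectral_moment m F = ennreal (a * norm1 u ^ m))"
proof -
  define pt where "pt = (\<lambda>k :: nat. if k = 0 then 0 else if k = 1 then u else - u)"
  define wt where "wt = (\<lambda>k :: nat. if k = 0 then b else a / 2)"
  define C where "C = point_measure {0, 1, 2} (\<lambda>k. ennreal (wt k))"
  define P where "P = distr C borel pt"
  have wt: "0 \<le> wt k" for k using assms by (simp add: wt_def)
  have ptm [measurable]: "pt \<in> measurable C borel" by (simp add: C_def point_measure_def)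
  have sP: "sets P = sets borel" by (simp add: P_def)
  have nn: "(\<integral>\<^sup>+\<omega>. f \<omega> \<partial>P) = ennreal b * f 0 + ennreal (a / 2) * f u + ennreal (a / 2) * f (- u)"
    if [measurable]: "f \<in> borel_measurable borel" for f
    unfolding P_def by (subst nn_integral_distr)
      (auto simp: C_def nn_integral_point_measure_finite pt_def wt_def add_ac)
  have int: "(\<integral>\<omega>. f \<omega> \<partial>P) = b * f 0 + a / 2 * f u + a / 2 * f (- u)"
    if [measurable]: "f \<in> borel_measurable borel" for f :: "real ^ 'd \<Rightarrow> real"
    unfolding P_def using wt by (subst integral_distr)
      (auto simp: C_def lebesgue_integral_point_measure_finite pt_def wt_def add_ac)
  have fin: "finite_measure P"
  proof (rule finite_measureI)
    have "emeasure P (space P) = (\<integral>\<^sup>+\<omega>. 1 \<partial>P)" by simp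
    also have "\<dots> < \<infinity>" by (subst nn) (auto simp: ennreal_mult_less_top)
    finally show "emeasure P (space P) \<noteq> \<infinity>" by simp
  qed
  show ?thesis
  proof (intro exI[of _ "\<lambda>A. complex_of_real (measure P A)"] conjI allI impI)
    show "fourier_representation (\<lambda>x. b + a * cos (u \<bullet> x)) (\<lambda>A. complex_of_real (measure P A))"
      by (intro fourier_representation_measure fin sP; subst int) auto
    fix m :: nat assume m: "0 < m"
    have "spectral_moment m (\<lambda>A. complex_of_real (measure P A)) = (\<integral>\<^sup>+\<omega>. ennreal (norm1 \<omega> ^ m) \<partial>P)"
      by (simp add: spectral_moment_def variation_measure[OF fin sP])
    also have "\<dots> = ennreal (a / 2) * ennreal (norm1 u ^ m) + ennreal (a / 2) * ennreal (norm1 (- u) ^ m)"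
      using m by (subst nn) (auto simp: zero_power)
    also have "\<dots> = ennreal (a / 2 * norm1 u ^ m + a / 2 * norm1 u ^ m)"
      using assms by (simp add: norm1_def ennreal_mult[symmetric] ennreal_plus[symmetric] sum_nonneg del: ennreal_plus)
    also have "a / 2 * norm1 u ^ m + a / 2 * norm1 u ^ m = a * norm1 u ^ m" by simp
    finally show "spectral_moment m (\<lambda>A. complex_of_real (measure P A)) = ennreal (a * norm1 u ^ m)" .
  qed
qed

lemma sup_norm_unit_cube: "sup_norm_set (unit_cube :: (real ^ 'd) set) = 1"
proof (rule antisym[OF _ one_le_sup_norm_unit_cube])
  show "sup_norm_set (unit_cube :: (real ^ 'd) set) \<le> 1"
    unfolding sup_norm_set_def
  proof (rule SUP_least)
    fix x :: "real ^ 'd" assume "x \<in> unit_cube"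
    then have "infnorm x \<le> 1"
      unfolding infnorm_Max by (intro Max.boundedI) (auto simp: Basis_vec_def inner_axis)
    then show "ennreal (infnorm x) \<le> 1" by (simp add: ennreal_le_1)
  qed
qed

text \<open>The cosine serves as its own extension, and its gradient at the origin vanishes by
  evenness.\<close>

lemma cosine_coefficients_le:
  fixes u :: "real ^ 'd" and a b M :: real
  assumes ab: "0 \<le> a" "0 \<le> b" and M: "a + b \<le> M" "a * norm1 u \<le> M" "a * norm1 u ^ 2 \<le> M"
  shows "c_KB (\<lambda>x. b + a * cos (u \<bullet> x)) unit_cube \<le> ereal M" "c_B (\<lambda>x. b + a * cos (u \<bullet> x)) unit_cube \<le> ereal M"
proof -
  obtain F where F: "fourier_representation (\<lambda>x. b + a * cos (u \<bullet> x)) F"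
    "\<And>m. 0 < m \<Longrightarrow> spectral_moment m F = ennreal (a * norm1 u ^ m)"
    using cosine_representation[OF ab, of u] by blast
  have M0: "0 \<le> M" using ab M by linarith
  have D: "GDERIV (\<lambda>x. b + a * cos (u \<bullet> x)) 0 :> 0"
    unfolding gderiv_def by (auto intro!: derivative_eq_intros)
  show "c_KB (\<lambda>x. b + a * cos (u \<bullet> x)) unit_cube \<le> ereal M"
    unfolding c_KB_def
  proof (rule Inf_lower, intro CollectI exI[of _ M] exI[of _ "\<lambda>x. b + a * cos (u \<bullet> x)"] exI[of _ F] exI[of _ 0] conjI ballI refl M0 F(1) D)
    show "sup_norm_set (unit_cube :: (real ^ 'd) set) * spectral_moment 2 F \<le> ennreal M"
      using M by (simp add: sup_norm_unit_cube F ennreal_leI)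
  qed (use ab M M0 in auto)
  show "c_B (\<lambda>x. b + a * cos (u \<bullet> x)) unit_cube \<le> ereal M"
    unfolding c_B_def
  proof (rule Inf_lower, intro CollectI exI[of _ M] exI[of _ "\<lambda>x. b + a * cos (u \<bullet> x)"] exI[of _ F] conjI ballI refl M0 F(1))
    show "sup_norm_set (unit_cube :: (real ^ 'd) set) * spectral_moment 1 F \<le> ennreal M"
      using M by (simp add: sup_norm_unit_cube F ennreal_leI)
  qed (use ab M in auto)
qed


text \<open>Mass \<open>q\<close> sits at the vertex \<open>axis undefined 1\<close> and
  \<open>1 - q\<close> at the origin; \<open>undefined\<close> is just some fixed
  coordinate.\<close>

definition two_point_measure :: "real \<Rightarrow> (real ^ 'd) measure" where
  "two_point_measure q = distr (measure_pmf (bernoulli_pmf q)) (restrict_space borel unit_cube)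
     (\<lambda>b. if b then axis undefined 1 else 0)"

text \<open>The cosine is 1 at the origin and -1 at the vertex, so this interpolates the
  log-likelihood ratio of Bernoulli \<open>p\<close> against Bernoulli \<open>q\<close> at the two
  atoms by a function with an explicit Fourier measure.\<close>

definition two_point_log :: "real \<Rightarrow> real \<Rightarrow> real ^ 'd \<Rightarrow> real" where
  "two_point_log q p x = (ln ((1 - p) / (1 - q)) + ln (p / q)) / 2 +
     (ln ((1 - p) / (1 - q)) - ln (p / q)) / 2 * cos ((pi *\<^sub>R axis undefined 1) \<bullet> x)"

definition bernoulli_KL :: "real \<Rightarrow> real \<Rightarrow> real" where
  "bernoulli_KL p q = p * ln (p / q) + (1 - p) * ln ((1 - p) / (1 - q))"

lemma two_point_log_at: "two_point_log q p 0 = ln ((1 - p) / (1 - q))"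
  "two_point_log q p (axis undefined 1) = ln (p / q)"
  by (simp_all add: two_point_log_def inner_axis_axis field_simps)

lemma sets_two_point [simp]: "sets (two_point_measure q) = sets (restrict_space borel unit_cube)"
  by (simp add: two_point_measure_def)

lemma measurable_two_point: "(\<lambda>b. if b then axis undefined 1 else 0) \<in> measurable (measure_pmf p) (restrict_space borel (unit_cube :: (real ^ 'd) set))"
  by (auto simp: space_restrict_space axis_def)

lemma prob_space_two_point: "prob_space (two_point_measure q)"
  unfolding two_point_measure_def by (intro measure_pmf.prob_space_distr measurable_two_point)

lemma integral_two_point:
  fixes f :: "real ^ 'd \<Rightarrow> real"
  assumes "f \<in> borel_measurable borel" "0 \<le> q" "q \<le> 1"
  shows "(\<integral>x. f x \<partial>two_point_measure q) = q * f (axis undefined 1) + (1 - q) * f 0"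
  unfolding two_point_measure_def
  by (subst integral_distr[OF measurable_two_point])
    (use assms in \<open>auto intro!: measurable_restrict_space1\<close>)

lemma borel_measurable_two_point_log [measurable]: "two_point_log q p \<in> borel_measurable borel"
  unfolding two_point_log_def[abs_def] by measurable

lemma norm1_two_point: "norm1 (pi *\<^sub>R axis undefined 1 :: real ^ 'd) = pi"
  by (simp add: norm1_scale) (simp add: norm1_def axis_def if_distrib cong: if_cong)

text \<open>Both coefficients of the cosine form are nonnegative for \<open>p\<close> between 1/2
  and \<open>q\<close>. The margin 16 pays for the second moment, because the frequency has 1-norm
  pi, which is below 4.\<close>

lemma two_point_class:
  fixes M q p :: real
  assumes M: "0 < M" and q: "q = 1 - exp (- M / 16) / 2" and p: "1 / 2 \<le> p" "p \<le> q"
  defines "\<nu> \<equiv> (two_point_measure q :: (real ^ 'd) measure)"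
  defines "\<mu> \<equiv> density \<nu> (\<lambda>x. ennreal (exp (two_point_log q p x)))"
  shows "(\<mu>, \<nu>) \<in> P2_KL_KB M unit_cube" "(\<mu>, \<nu>) \<in> P2_KL_B M unit_cube"
    "real_of_ereal (KL \<mu> \<nu>) = bernoulli_KL p q"
    "\<bar>two_point_log q p (x :: real ^ 'd)\<bar> \<le> M"
    "(\<integral>x. exp (two_point_log q p x) \<partial>\<nu>) = 1"
proof -
  define f where "f = (two_point_log q p :: real ^ 'd \<Rightarrow> real)"
  define f0 f1 where "f0 = ln ((1 - p) / (1 - q))" and "f1 = ln (p / q)"
  define a b where "a = (f0 - f1) / 2" and "b = (f0 + f1) / 2"
  define u where "u = (pi *\<^sub>R axis undefined 1 :: real ^ 'd)"
  have q1: "1 / 2 \<le> q" "q < 1" using M by (auto simp: q)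
  have p1: "p < 1" using p q1 by simp
  have f0: "0 \<le> f0" using p q1 by (simp add: f0_def)
  have f1: "f1 \<le> 0" using p q1 by (simp add: f1_def)
  \<comment> \<open>The extreme case is \<open>p = 1 / 2\<close>, where the ratio equals
    \<open>exp (M / 16)\<close> by the choice of \<open>q\<close>.\<close>
  have f0M: "f0 \<le> M / 16"
  proof -
    have "(1 - p) / (1 - q) \<le> (1 / 2) / (1 - q)" using p q1 by (intro divide_right_mono) auto
    then have "f0 \<le> ln ((1 / 2) / (1 - q))"
      unfolding f0_def using q1 p1 by (intro ln_le_cancel_iff[THEN iffD2] divide_pos_pos) auto
    also have "(1 / 2) / (1 - q) = exp (M / 16)" by (simp add: q exp_minus inverse_eq_divide)
    finally show ?thesis by simp
  qed
  have b0: "0 \<le> b"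
  proof -
    \<comment> \<open>This says that the Bernoulli variance decreases from \<open>p\<close> to
      \<open>q\<close>; taking logarithms, it is the nonnegativity of
      \<open>f0 + f1\<close>.\<close>
    have "0 \<le> (q - p) * (q + p - 1)" using p q1 by (intro mult_nonneg_nonneg) auto
    then have "q * (1 - q) \<le> p * (1 - p)" by (simp add: algebra_simps)
    then have "1 \<le> (1 - p) / (1 - q) * (p / q)" using p q1 by (simp add: field_simps)
    then have "0 \<le> ln ((1 - p) / (1 - q) * (p / q))" by simp
    then have "0 \<le> f0 + f1" using p q1 p1 by (subst (asm) ln_mult) (auto simp: f0_def f1_def)
    then show ?thesis by (simp add: b_def)
  qed
  have a0: "0 \<le> a" using f0 f1 by (simp add: a_def)
  have ab: "a + b \<le> M / 16" using f0M by (simp add: a_def b_def field_simps)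
  have aM: "a \<le> M / 16" using ab b0 by simp
  have f: "f = (\<lambda>x. b + a * cos (u \<bullet> x))"
    by (simp add: f_def two_point_log_def fun_eq_iff a_def b_def f0_def f1_def u_def)
  have fb: "\<bar>f x\<bar> \<le> M / 16" for x
  proof -
    have "\<bar>a * cos (u \<bullet> x)\<bar> \<le> a * 1" unfolding abs_mult using a0 by (intro mult_mono) auto
    then show ?thesis unfolding f using ab b0 by linarith
  qed
  then show "\<bar>two_point_log q p (x :: real ^ 'd)\<bar> \<le> M" using M unfolding f_def[symmetric] by (intro order_trans[OF fb]) simp
  interpret N: prob_space \<nu> unfolding \<nu>_def by (rule prob_space_two_point)
  have int: "(\<integral>x. g x \<partial>\<nu>) = q * g (axis undefined 1) + (1 - q) * g 0" if "g \<in> borel_measurable borel" for g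
    unfolding \<nu>_def using that q1 by (intro integral_two_point) auto
  have fm: "f \<in> borel_measurable borel" by (simp add: f_def)
  have fN [measurable]: "f \<in> borel_measurable \<nu>"
    unfolding \<nu>_def using fm by (simp add: measurable_cong_sets[OF sets_two_point refl] measurable_restrict_space1)
  have ef: "exp (f 0) = (1 - p) / (1 - q)" "exp (f (axis undefined 1)) = p / q"
    using p q1 p1 by (simp_all add: f_def two_point_log_at)
  have one: "(\<integral>x. exp (f x) \<partial>\<nu>) = 1"
    using fm q1 p by (subst int) (auto simp: ef)
  then show "(\<integral>x. exp (two_point_log q p x) \<partial>\<nu>) = 1" by (simp add: f_def)
  have \<mu>: "\<mu> = density \<nu> (\<lambda>x. ennreal (exp (f x)))" by (simp add: \<mu>_def f_def)
  have ief: "integrable \<nu> (\<lambda>x. exp (f x))"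
  proof (rule N.integrable_bounded[of _ "exp (M / 16)"])
    show "\<bar>exp (f x)\<bar> \<le> exp (M / 16)" for x using fb[of x] by simp
  qed measurable
  interpret M: prob_space \<mu>
  proof (rule prob_spaceI)
    have "emeasure \<mu> (space \<mu>) = (\<integral>\<^sup>+x. ennreal (exp (f x)) \<partial>\<nu>)"
      unfolding \<mu> by (simp add: emeasure_density cong: nn_integral_cong)
    also have "\<dots> = 1" by (subst nn_integral_eq_integral[OF ief]) (auto simp: one)
    finally show "emeasure \<mu> (space \<mu>) = 1" .
  qed
  have ver: "log_density_version \<mu> \<nu> f"
    unfolding log_density_version_def
  proof
    have "AE x in \<nu>. ennreal (exp (f x)) = RN_deriv \<nu> \<mu> x"
      by (intro N.RN_deriv_unique) (auto simp: \<mu>)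
    then show "AE x in \<nu>. RN_deriv \<nu> \<mu> x = ennreal (exp (f x))" by (auto elim: eventually_mono)
  qed (rule fN)
  have KL: "KL \<mu> \<nu> = ereal (bernoulli_KL p q)"
  proof -
    have "KL \<mu> \<nu> = ereal (\<integral>x. exp (f x) * f x \<partial>\<nu>)"
      by (rule KL_eq_integral[OF M.prob_space_axioms N.prob_space_axioms \<mu> ver fb])
    also have "(\<integral>x. exp (f x) * f x \<partial>\<nu>) = bernoulli_KL p q"
      using fm p q1 p1 by (subst int) (auto simp: ef bernoulli_KL_def, simp add: f_def two_point_log_at)
    finally show ?thesis .
  qed
  then show "real_of_ereal (KL \<mu> \<nu>) = bernoulli_KL p q" by simp
  have KLM: "bernoulli_KL p q \<le> M"
  proof -
    have "p * f1 \<le> 0" using p f1 by (simp add: mult_nonneg_nonpos)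
    moreover have "(1 - p) * f0 \<le> 1 * f0" using p f0 by (intro mult_right_mono) auto
    ultimately show ?thesis using f0M M by (simp add: bernoulli_KL_def f0_def f1_def)
  qed
  have P2: "(\<mu>, \<nu>) \<in> P2_KL unit_cube"
    unfolding P2_KL_def borel_prob_on_def
    using M.prob_space_axioms N.prob_space_axioms absolutely_continuousI_density[of "\<lambda>x. ennreal (exp (f x))" \<nu>]
    by (auto simp: KL \<mu>[symmetric]) (auto simp: \<mu> \<nu>_def)
  have nu: "norm1 u = pi" unfolding u_def by (rule norm1_two_point)
  have "a * pi \<le> M / 16 * 4" using aM a0 pi_less_4 by (intro mult_mono) auto
  then have 1: "a * norm1 u \<le> M" using M by (simp add: nu)
  have "pi\<^sup>2 \<le> 4\<^sup>2" using pi_less_4 pi_gt_zero by (intro power_mono) auto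
  then have "a * pi\<^sup>2 \<le> M / 16 * 4\<^sup>2" using aM a0 by (intro mult_mono) auto
  then have 2: "a * norm1 u ^ 2 \<le> M" by (simp add: nu)
  have 3: "a + b \<le> M" using ab M by simp
  show "(\<mu>, \<nu>) \<in> P2_KL_KB M unit_cube" "(\<mu>, \<nu>) \<in> P2_KL_B M unit_cube"
    unfolding P2_KL_KB_def P2_KL_B_def using P2 ver KLM cosine_coefficients_le[OF a0 b0 3 1 2] KL
    by (auto simp: f)
qed

lemma powr_neg_half: "real n powr (-1/2) = 1 / sqrt (real n)"
proof -
  have "real n powr (-1/2) = real n powr (- (1/2))" by simp
  also have "\<dots> = inverse (real n powr (1/2))" by (rule powr_minus)
  also have "\<dots> = inverse (sqrt (real n))" by (simp only: powr_half_sqrt of_nat_0_le_iff)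
  finally show ?thesis by (simp only: inverse_eq_divide)
qed

text \<open>Convexity in the first argument: the left side is the increment, from \<open>r\<close>
  to 1/2, along the tangent at \<open>r\<close>. The difference of the two sides is exactly
  \<open>bernoulli_KL (1 / 2) r\<close>.\<close>

lemma bernoulli_KL_diff_ge:
  assumes "1 / 2 \<le> r" "r < 1" "0 < q" "q < 1"
  shows "(r - 1 / 2) * (ln ((1 - r) / (1 - q)) - ln (r / q)) \<le> bernoulli_KL (1 / 2) q - bernoulli_KL r q"
proof -
  have *: "1 - 2 * t \<le> ln ((1 / 2) / t)" if t: "0 < t" for t :: real
  proof -
    have "ln ((1 / 2) / t) = - ln (2 * t)" using t ln_inverse[of "2 * t"] by (simp add: inverse_eq_divide)
    then show ?thesis using ln_le_minus_one[of "2 * t"] t by simp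
  qed
  have 1: "1 - 2 * r \<le> ln ((1 / 2) / r)" and 2: "1 - 2 * (1 - r) \<le> ln ((1 / 2) / (1 - r))"
    using assms by (intro *; simp)+
  have e: "ln ((1 / 2) / t) = ln ((1 / 2) / s) + ln (s / t)" if "0 < s" "0 < t" for s t :: real
  proof -
    have "ln ((1 / 2) / s) + ln (s / t) = ln ((1 / 2) / s * (s / t))"
      by (rule ln_mult_pos[symmetric]) (use that in auto)
    then show ?thesis using that by simp
  qed
  have e1: "ln ((1 / 2) / q) = ln ((1 / 2) / r) + ln (r / q)"
    and e2: "ln ((1 / 2) / (1 - q)) = ln ((1 / 2) / (1 - r)) + ln ((1 - r) / (1 - q))"
    using assms by (intro e; simp)+
  have "bernoulli_KL (1 / 2) q - bernoulli_KL r q - (r - 1 / 2) * (ln ((1 - r) / (1 - q)) - ln (r / q)) =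
      (ln ((1 / 2) / r) + ln ((1 / 2) / (1 - r))) / 2"
    unfolding bernoulli_KL_def using e1 e2 by (simp add: algebra_simps)
  then show ?thesis using 1 2 by simp
qed

text \<open>The hypotheses are Bernoulli parameters 1/2 and \<open>1 / 2 + 1 / (4 * sqrt n)\<close>
  against the same \<open>q > 1 / 2\<close>. Any \<open>Q\<close> containing one of the two classes
  is allowed because the two-point family lies in both.\<close>

theorem minimax_lower_bound:
  fixes Q :: "((real ^ 'd) measure \<times> (real ^ 'd) measure) set"
  assumes M: "0 < M" and Q: "P2_KL_KB M unit_cube \<subseteq> Q \<or> P2_KL_B M unit_cube \<subseteq> Q"
  shows "\<exists>c>0. \<forall>\<^sub>F n in sequentially.
    ennreal (c * real n powr (-1/2)) \<le> (INF T\<in>estimators n unit_cube. sup_risk n T Q)"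
proof -
  define q where "q = 1 - exp (- M / 16) / 2"
  have q: "1 / 2 < q" "q < 1" using M by (auto simp: q_def)
  \<comment> \<open>Staying below the midpoint keeps the perturbed parameter away from
    \<open>q\<close>, where the slope of the divergence vanishes; \<open>c0\<close> is the absolute
    slope at \<open>r\<close> and bounds the slopes on [1/2, r] from below.\<close>
  define r where "r = (1 / 2 + q) / 2"
  have r: "1 / 2 < r" "r < q" using q by (auto simp: r_def)
  define c0 where "c0 = ln ((1 - r) / (1 - q)) - ln (r / q)"
  have c0: "0 < c0"
  proof -
    have "0 < ln ((1 - r) / (1 - q))" using r q by (simp add: ln_gt_zero)
    moreover have "ln (r / q) < 0" using r q by (simp add: ln_less_zero)
    ultimately show ?thesis by (simp add: c0_def)
  qed
  define \<nu> where "\<nu> = (two_point_measure q :: (real ^ 'd) measure)"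
  define l where "l = (\<lambda>p (x :: real ^ 'd). exp (two_point_log q p x))"
  define \<mu> where "\<mu> = (\<lambda>p. density \<nu> (\<lambda>x. ennreal (l p x)))"
  interpret N: prob_space \<nu> unfolding \<nu>_def by (rule prob_space_two_point)
  note cls = two_point_class[OF M q_def, where 'd = 'd, folded \<nu>_def]
  have inQ: "(\<mu> p, \<nu>) \<in> Q" if "1 / 2 \<le> p" "p \<le> q" for p
    using Q cls(1,2)[OF that] unfolding \<mu>_def l_def by blast
  have KL: "real_of_ereal (KL (\<mu> p) \<nu>) = bernoulli_KL p q" if "1 / 2 \<le> p" "p \<le> q" for p
    using cls(3)[OF that] unfolding \<mu>_def l_def by simp
  have lm: "l p \<in> borel_measurable borel" for p unfolding l_def by measurable
  have lN: "l p \<in> borel_measurable \<nu>" for p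
    unfolding \<nu>_def using lm by (simp add: measurable_cong_sets[OF sets_two_point refl] measurable_restrict_space1)
  have lower: "ennreal (c0 / 16 * real n powr (-1/2)) \<le> sup_risk n T Q"
    if n: "1 \<le> n" "1 / (4 * sqrt n) \<le> r - 1 / 2" and T: "T \<in> estimators n unit_cube" for n T
  proof -
    define p1 where "p1 = 1 / 2 + 1 / (4 * sqrt n)"
    have p1: "1 / 2 \<le> p1" "p1 \<le> r" "p1 \<le> q" "p1 < 1" using n r q by (auto simp: p1_def)
    have half: "1 / 2 \<le> (1 / 2 :: real)" "1 / 2 \<le> q" using q by auto
    define D where "D = (\<lambda>p. bernoulli_KL p q)"
    have c01: "c0 \<le> ln ((1 - p1) / (1 - q)) - ln (p1 / q)"
    proof -
      have "ln ((1 - r) / (1 - q)) \<le> ln ((1 - p1) / (1 - q))"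
        using p1 r q by (subst ln_le_cancel_iff) (auto intro!: divide_right_mono)
      moreover have "ln (p1 / q) \<le> ln (r / q)"
        using p1 r q by (subst ln_le_cancel_iff) (auto intro!: divide_right_mono)
      ultimately show ?thesis by (simp add: c0_def)
    qed
    have "1 / (4 * sqrt n) * c0 \<le> (p1 - 1 / 2) * (ln ((1 - p1) / (1 - q)) - ln (p1 / q))"
      using c01 c0 p1 by (intro mult_mono) (auto simp: p1_def)
    also have "\<dots> \<le> D (1 / 2) - D p1" unfolding D_def using p1 q by (intro bernoulli_KL_diff_ge) auto
    finally have diff: "1 / (4 * sqrt n) * c0 \<le> \<bar>D (1 / 2) - D p1\<bar>" by linarith
    have lb: "exp (- M) \<le> l p x \<and> l p x \<le> exp M" if "1 / 2 \<le> p" "p \<le> q" for p x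
      using cls(4)[OF that, of x] by (auto simp: l_def abs_le_iff)
    have lat: "l p 0 = (1 - p) / (1 - q)" "l p (axis undefined 1) = p / q" if "1 / 2 \<le> p" "p \<le> q" for p
      using that q by (simp_all add: l_def two_point_log_at)
    \<comment> \<open>One observation gives \<open>1 + 4 * (p1 - 1 / 2)\<^sup>2\<close>,
      independently of \<open>q\<close>. The distance \<open>1 / (4 * sqrt n)\<close> turns this
      into \<open>1 + 1 / (4 * n)\<close>, whose \<open>n\<close>-th power is at most
      \<open>exp (1 / 4)\<close>.\<close>
    have chi: "(\<integral>x. l p1 x ^ 2 / l (1 / 2) x \<partial>\<nu>) ^ n \<le> 2"
    proof -
      have "(\<integral>x. l p1 x ^ 2 / l (1 / 2) x \<partial>\<nu>) = q * ((p1 / q) ^ 2 / ((1 / 2) / q)) + (1 - q) * (((1 - p1) / (1 - q)) ^ 2 / ((1 / 2) / (1 - q)))"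
        unfolding \<nu>_def using lm[of p1] lm[of "1 / 2"] q lat[OF p1(1,3)] lat[OF half]
        by (subst integral_two_point) auto
      also have "\<dots> = 2 * p1 ^ 2 + 2 * (1 - p1) ^ 2"
      proof -
        have "s * ((t / s) ^ 2 / ((1 / 2) / s)) = 2 * t ^ 2" if "0 < s" for s t :: real
          using that by (simp add: field_simps power2_eq_square)
        from this[of q p1] this[of "1 - q" "1 - p1"] show ?thesis using q by (simp only: diff_gt_0_iff_gt)
      qed
      also have "\<dots> = 1 + 4 * (1 / (4 * sqrt n)) ^ 2" unfolding p1_def by (simp add: power2_eq_square algebra_simps)
      also have "\<dots> = 1 + 1 / (4 * n)" using n by (simp add: power_divide power_mult_distrib)
      finally have eq: "(\<integral>x. l p1 x ^ 2 / l (1 / 2) x \<partial>\<nu>) = 1 + 1 / (4 * n)" .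
      have "(1 + 1 / (4 * real n)) ^ n \<le> exp (1 / (4 * real n)) ^ n"
        by (intro power_mono) (auto intro: exp_ge_add_one_self)
      also have "\<dots> = exp (1 / 4)" using n by (simp add: exp_of_nat_mult[symmetric])
      also have "\<dots> \<le> 2" using exp_bound[of "1 / 4"] by (simp add: power2_eq_square)
      finally show ?thesis unfolding eq by simp
    qed
    have TN: "T \<in> borel_measurable (PiM {1..n} (\<lambda>_. \<nu>) \<Otimes>\<^sub>M PiM {1..n} (\<lambda>_. \<nu>))"
    proof -
      have "sets (PiM {1..n} (\<lambda>_. \<nu>)) = sets (PiM {1..n} (\<lambda>_. restrict_space borel (unit_cube :: (real ^ 'd) set)))"
        by (intro sets_PiM_cong) (auto simp: \<nu>_def)
      from measurable_cong_sets[OF sets_pair_measure_cong[OF this this] refl] T show ?thesis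
        by (auto simp: estimators_def sample_space_def)
    qed
    have "ennreal (\<bar>D (1 / 2) - D p1\<bar> / 2) \<le> risk n T (\<mu> (1 / 2)) \<nu> + risk n T (\<mu> p1) \<nu>"
      unfolding risk_def sample_space_def KL[OF half] KL[OF p1(1,3)] unfolding \<mu>_def D_def
    proof (rule le_cam[OF N.prob_space_axioms lN lN _ _ _ chi TN, where C = "exp (3 * M)"])
      fix x
      have "l p1 x ^ 2 / l (1 / 2) x \<le> exp M ^ 2 / exp (- M)"
        using lb[OF half, of x] lb[OF p1(1,3), of x] by (intro frac_le power_mono) (auto simp: l_def)
      also have "\<dots> = exp (3 * M)" by (simp add: exp_minus power2_eq_square exp_add[symmetric] field_simps)
      finally have "l p1 x ^ 2 / l (1 / 2) x \<le> exp (3 * M)" .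
      moreover have "exp M \<le> exp (3 * M)" using M by simp
      ultimately show "0 < l (1 / 2) x \<and> 0 < l p1 x \<and> l (1 / 2) x \<le> exp (3 * M) \<and> l p1 x \<le> exp (3 * M) \<and>
          l p1 x ^ 2 / l (1 / 2) x \<le> exp (3 * M)"
        using lb[OF half, of x] lb[OF p1(1,3), of x] by (auto simp: l_def)
    qed (use cls(5)[OF half] cls(5)[OF p1(1,3)] in \<open>auto simp: l_def\<close>)
    also have "\<dots> \<le> sup_risk n T Q + sup_risk n T Q"
      unfolding sup_risk_def using inQ[OF half] inQ[OF p1(1,3)]
      by (intro add_mono SUP_upper2[of "(\<mu> (1 / 2), \<nu>)"] SUP_upper2[of "(\<mu> p1, \<nu>)"]) auto
    finally have le: "ennreal (\<bar>D (1 / 2) - D p1\<bar> / 2) \<le> sup_risk n T Q + sup_risk n T Q" .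
    have half_le: "ennreal (t / 2) \<le> s" if "ennreal t \<le> s + s" "0 \<le> t" for t and s :: ennreal
    proof (cases s)
      case (real y)
      then have "ennreal t \<le> ennreal (y + y)" using that by (simp add: ennreal_plus[symmetric] del: ennreal_plus)
      then have "t \<le> y + y" using real by (subst (asm) ennreal_le_iff) auto
      then show ?thesis using real by (simp add: ennreal_leI)
    qed simp
    \<comment> \<open>The 16 consists of 4 from the perturbation, 2 from \<open>le_cam\<close> and 2
      from passing from a sum of two risks to the supremum.\<close>
    have "c0 / 16 * real n powr (-1/2) = 1 / (4 * sqrt n) * c0 / 2 / 2"
      unfolding powr_neg_half by simp
    also have "\<dots> \<le> \<bar>D (1 / 2) - D p1\<bar> / 2 / 2" using diff by (intro divide_right_mono) auto
    finally have "ennreal (c0 / 16 * real n powr (-1/2)) \<le> ennreal (\<bar>D (1 / 2) - D p1\<bar> / 2 / 2)" by (rule ennreal_leI)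
    also have "\<dots> \<le> sup_risk n T Q" by (rule half_le[OF le]) simp
    finally show ?thesis .
  qed
  have "(\<lambda>n. 1 / (4 * sqrt (real n))) \<longlonglongrightarrow> 0" by real_asymp
  then have "\<forall>\<^sub>F n in sequentially. 1 / (4 * sqrt (real n)) < r - 1 / 2"
    using r by (intro order_tendstoD) auto
  then have "\<forall>\<^sub>F n in sequentially. ennreal (c0 / 16 * real n powr (-1/2)) \<le> (INF T\<in>estimators n unit_cube. sup_risk n T Q)"
    using eventually_ge_at_top[of 1]
  proof eventually_elim
    case (elim n)
    show ?case by (intro INF_greatest lower elim(2) less_imp_le[OF elim(1)])
  qed
  then show ?thesis using c0 by (intro exI[of _ "c0 / 16"]) auto
qed

section \<open>Risk over the distribution classes\<close>


lemma relu_networks_props: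
  fixes g :: "real ^ 'd \<Rightarrow> real"
  assumes "1 \<le> n" "0 \<le> a"
  shows "(\<lambda>_. 0) \<in> (relu_networks n a :: (real ^ 'd \<Rightarrow> real) set)"
    "finite_nets unit_cube (relu_networks n a :: (real ^ 'd \<Rightarrow> real) set)"
    "g \<in> relu_networks n a \<Longrightarrow> continuous_on UNIV g"
    "g \<in> relu_networks n a \<Longrightarrow> x \<in> unit_cube \<Longrightarrow> \<bar>g x\<bar> \<le> 6 * a"
    "g \<in> relu_networks n a \<Longrightarrow> (\<And>i. i \<in> {1..n} \<Longrightarrow> y i \<in> unit_cube) \<Longrightarrow>
      \<bar>\<Sum>i\<in>{1..n}. e i * g (y i)\<bar> \<le> 6 * a * halfspace_disc y {1..n} e"
proof -
  have c: "continuous_on UNIV relu" using bounded_ridge_relu unfolding bounded_ridge_def by blast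
  \<comment> \<open>Total outer weight \<open>2 * a\<close> times the activation range 2, plus
    linear and constant part.\<close>
  have eq: "real n * (2 * a / real n) * 2 + a + a = 6 * a" using assms by simp
  show "(\<lambda>_. 0) \<in> (relu_networks n a :: (real ^ 'd \<Rightarrow> real) set)"
    unfolding relu_networks_def using assms by (intro zero_in_networks) auto
  show "finite_nets unit_cube (relu_networks n a :: (real ^ 'd \<Rightarrow> real) set)"
    unfolding relu_networks_def by (rule finite_nets_networks[OF c])
  show "g \<in> relu_networks n a \<Longrightarrow> continuous_on UNIV g"
    unfolding relu_networks_def by (erule continuous_on_network[OF _ c])
  show "g \<in> relu_networks n a \<Longrightarrow> x \<in> unit_cube \<Longrightarrow> \<bar>g x\<bar> \<le> 6 * a"
    unfolding relu_networks_def using network_bound[OF _ bounded_ridge_relu, of g n "2 * a / real n" a a x] assms eq by auto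
  show "g \<in> relu_networks n a \<Longrightarrow> (\<And>i. i \<in> {1..n} \<Longrightarrow> y i \<in> unit_cube) \<Longrightarrow>
      \<bar>\<Sum>i\<in>{1..n}. e i * g (y i)\<bar> \<le> 6 * a * halfspace_disc y {1..n} e"
    unfolding relu_networks_def
    using network_signed_sum_le[where g = g and x = y and I = "{1..n}" and e = e, OF _ bounded_ridge_relu, of n "2 * a / real n" a a] assms
    unfolding eq by simp
qed

lemma sigmoid_networks_props:
  fixes g :: "real ^ 'd \<Rightarrow> real"
  assumes "1 \<le> n" "0 \<le> a"
  shows "(\<lambda>_. 0) \<in> (sigmoid_networks n a :: (real ^ 'd \<Rightarrow> real) set)"
    "finite_nets unit_cube (sigmoid_networks n a :: (real ^ 'd \<Rightarrow> real) set)"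
    "g \<in> sigmoid_networks n a \<Longrightarrow> continuous_on UNIV g"
    "g \<in> sigmoid_networks n a \<Longrightarrow> x \<in> unit_cube \<Longrightarrow> \<bar>g x\<bar> \<le> 6 * a"
    "g \<in> sigmoid_networks n a \<Longrightarrow> (\<And>i. i \<in> {1..n} \<Longrightarrow> y i \<in> unit_cube) \<Longrightarrow>
      \<bar>\<Sum>i\<in>{1..n}. e i * g (y i)\<bar> \<le> 6 * a * halfspace_disc y {1..n} e"
proof -
  have t: "0 \<le> sqrt (real n) * ln (real n)" using assms by simp
  have r: "bounded_ridge sigmoid (sqrt (real n) * ln (real n)) 1 TYPE('d)" by (rule bounded_ridge_sigmoid[OF t])
  have c: "continuous_on UNIV sigmoid" using r unfolding bounded_ridge_def by blast
  \<comment> \<open>The sigmoid has range 1 and no linear part; \<open>3 * a\<close> is relaxed to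
    \<open>6 * a\<close> to share the relu interface.\<close>
  have eq: "real n * (2 * a / real n) * 1 + 0 + a = 3 * a" using assms by simp
  show "(\<lambda>_. 0) \<in> (sigmoid_networks n a :: (real ^ 'd \<Rightarrow> real) set)"
    unfolding sigmoid_networks_def using assms t by (intro zero_in_networks) auto
  show "finite_nets unit_cube (sigmoid_networks n a :: (real ^ 'd \<Rightarrow> real) set)"
    unfolding sigmoid_networks_def by (rule finite_nets_networks[OF c])
  show "g \<in> sigmoid_networks n a \<Longrightarrow> continuous_on UNIV g"
    unfolding sigmoid_networks_def by (erule continuous_on_network[OF _ c])
  show "\<bar>g x\<bar> \<le> 6 * a" if "g \<in> sigmoid_networks n a" "x \<in> unit_cube"
    using network_bound[OF that(1)[unfolded sigmoid_networks_def] r that(2)] assms eq by simp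
  show "\<bar>\<Sum>i\<in>{1..n}. e i * g (y i)\<bar> \<le> 6 * a * halfspace_disc y {1..n} e"
    if "g \<in> sigmoid_networks n a" "\<And>i. i \<in> {1..n} \<Longrightarrow> y i \<in> unit_cube"
  proof -
    have "\<bar>\<Sum>i\<in>{1..n}. e i * g (y i)\<bar> \<le> 3 * a * halfspace_disc y {1..n} e"
      using network_signed_sum_le[where I = "{1..n}" and e = e, OF that(1)[unfolded sigmoid_networks_def] r _ that(2)] assms
      unfolding eq by simp
    also have "\<dots> \<le> 6 * a * halfspace_disc y {1..n} e"
      using assms by (intro mult_right_mono halfspace_disc_nonneg) auto
    finally show ?thesis .
  qed
qed

lemma relu_networks_scale_mono:
  "g \<in> relu_networks n a \<Longrightarrow> 0 \<le> s \<Longrightarrow> (\<lambda>x. s * g x) \<in> relu_networks n (s * a)"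
  "a \<le> a' \<Longrightarrow> relu_networks n a \<subseteq> relu_networks n a'"
proof -
  show "g \<in> relu_networks n a \<Longrightarrow> 0 \<le> s \<Longrightarrow> (\<lambda>x. s * g x) \<in> relu_networks n (s * a)"
    unfolding relu_networks_def using scale_in_networks[of g n 1 "2 * a / real n" a a relu s] by (simp add: mult_ac)
  show "a \<le> a' \<Longrightarrow> relu_networks n a \<subseteq> relu_networks n a'"
    unfolding relu_networks_def by (intro networks_mono divide_right_mono) auto
qed

lemma sigmoid_networks_scale_mono:
  "g \<in> sigmoid_networks n a \<Longrightarrow> 0 \<le> s \<Longrightarrow> (\<lambda>x. s * g x) \<in> sigmoid_networks n (s * a)"
  "a \<le> a' \<Longrightarrow> sigmoid_networks n a \<subseteq> sigmoid_networks n a'"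
proof -
  show "g \<in> sigmoid_networks n a \<Longrightarrow> 0 \<le> s \<Longrightarrow> (\<lambda>x. s * g x) \<in> sigmoid_networks n (s * a)"
    unfolding sigmoid_networks_def
    using scale_in_networks[of g n "sqrt (real n) * ln (real n)" "2 * a / real n" a 0 sigmoid s] by (simp add: mult_ac)
  show "a \<le> a' \<Longrightarrow> sigmoid_networks n a \<subseteq> sigmoid_networks n a'"
    unfolding sigmoid_networks_def by (intro networks_mono divide_right_mono) auto
qed


lemma borel_measurable_fourier:
  fixes g :: "real ^ 'd \<Rightarrow> real"
  assumes "fourier_representation g F"
  shows "g \<in> borel_measurable borel"
proof -
  obtain V h1 h2 where V: "finite_measure V" "sets V = sets borel"
    and h: "h1 \<in> borel_measurable borel" "h2 \<in> borel_measurable borel"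
    and g: "\<And>x. g x = (\<integral>\<omega>. cos (\<omega> \<bullet> x) * h1 \<omega> - sin (\<omega> \<bullet> x) * h2 \<omega> \<partial>V)"
    by (rule fourier_representation_realE[OF assms]) (rule that; assumption)
  interpret V: finite_measure V by fact
  have [measurable]: "h1 \<in> borel_measurable V" "h2 \<in> borel_measurable V" "(\<lambda>\<omega>. \<omega>) \<in> measurable V borel"
    using h by (simp_all add: measurable_cong_sets[OF V(2) refl])
  have "(\<lambda>z. cos (snd z \<bullet> fst z) * h1 (snd z) - sin (snd z \<bullet> fst z) * h2 (snd z)) \<in> borel_measurable (borel \<Otimes>\<^sub>M V)"
  proof -
    have 1: "(\<lambda>z. snd z) \<in> measurable (borel \<Otimes>\<^sub>M V) (borel :: (real ^ 'd) measure)"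
      by (rule measurable_compose[OF measurable_snd]) measurable
    have [measurable]: "(\<lambda>z :: (real ^ 'd) \<times> (real ^ 'd). snd z \<bullet> fst z) \<in> borel_measurable (borel \<Otimes>\<^sub>M V)"
      using 1 by (intro borel_measurable_inner) measurable
    show ?thesis by measurable
  qed
  then have "(\<lambda>x. \<integral>\<omega>. cos (\<omega> \<bullet> x) * h1 \<omega> - sin (\<omega> \<bullet> x) * h2 \<omega> \<partial>V) \<in> borel_measurable borel"
    by (intro V.borel_measurable_lebesgue_integral) (simp only: case_prod_unfold)
  then show ?thesis by (simp only: g[symmetric])
qed

text \<open>Admissibility at a fixed level \<open>c\<close>: the infimum \<open>c_KB\<close> yields
  such extensions only at levels above it.\<close>

definition KB_extension :: "real \<Rightarrow> (real ^ 'd \<Rightarrow> real) \<Rightarrow> bool" where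
  "KB_extension c g \<longleftrightarrow> (\<exists>F. fourier_representation g F \<and>
     sup_norm_set (unit_cube :: (real ^ 'd) set) * spectral_moment 2 F \<le> ennreal c \<and>
     \<bar>g 0\<bar> \<le> c \<and> (\<exists>D. GDERIV g 0 :> D \<and> norm1 D \<le> c))"

definition B_extension :: "real \<Rightarrow> (real ^ 'd \<Rightarrow> real) \<Rightarrow> bool" where
  "B_extension c g \<longleftrightarrow> (\<exists>F. fourier_representation g F \<and>
     sup_norm_set (unit_cube :: (real ^ 'd) set) * spectral_moment 1 F \<le> ennreal c \<and> \<bar>g 0\<bar> \<le> c)"

text \<open>
  \<open>ext\<close> stands for \<open>KB_extension\<close> or \<open>B_extension\<close>. The approximation property starts at \<open>n = 3\<close> because the weight bound
  \<open>n\<^sup>1\<^sup>/\<^sup>2 log n\<close> of the sigmoid networks vanishes for \<open>n = 1\<close>.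
\<close>

definition good_architecture ::
  "(nat \<Rightarrow> real \<Rightarrow> (real ^ 'd \<Rightarrow> real) set) \<Rightarrow> (real \<Rightarrow> (real ^ 'd \<Rightarrow> real) \<Rightarrow> bool) \<Rightarrow> bool" where
  "good_architecture G ext \<longleftrightarrow>
     (\<forall>n\<ge>1. \<forall>a\<ge>0. (\<lambda>_. 0) \<in> G n a \<and> finite_nets unit_cube (G n a) \<and>
        (\<forall>g\<in>G n a. g \<in> borel_measurable borel \<and> (\<forall>x\<in>unit_cube. \<bar>g x\<bar> \<le> 6 * a) \<and>
          (\<forall>y e. (\<forall>i\<in>{1..n}. y i \<in> unit_cube) \<longrightarrow>
            \<bar>\<Sum>i\<in>{1..n}. e i * g (y i)\<bar> \<le> 6 * a * halfspace_disc y {1..n} e))) \<and>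
     (\<forall>n a s g. g \<in> G n a \<longrightarrow> 0 \<le> s \<longrightarrow> (\<lambda>x. s * g x) \<in> G n (s * a)) \<and>
     (\<forall>n a a'. a \<le> a' \<longrightarrow> G n a \<subseteq> G n a') \<and>
     (\<forall>c g n N. ext c g \<longrightarrow> 0 \<le> c \<longrightarrow> 3 \<le> n \<longrightarrow> prob_space N \<longrightarrow> sets N = sets (restrict_space borel unit_cube) \<longrightarrow>
        g \<in> borel_measurable borel \<and> (\<exists>\<gamma>\<in>G n c. (\<integral>x. \<bar>\<gamma> x - g x\<bar> \<partial>N) \<le> 4 * c / sqrt n))"

lemma good_architecture_relu:
  "good_architecture relu_networks (KB_extension :: real \<Rightarrow> (real ^ 'd \<Rightarrow> real) \<Rightarrow> bool)"
  unfolding good_architecture_def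
proof (intro conjI allI impI ballI)
  fix n :: nat and a :: real assume n: "1 \<le> n" "0 \<le> a"
  note p = relu_networks_props[OF n]
  show "(\<lambda>_. 0) \<in> (relu_networks n a :: (real ^ 'd \<Rightarrow> real) set)" by (rule p(1))
  show "finite_nets unit_cube (relu_networks n a :: (real ^ 'd \<Rightarrow> real) set)" by (rule p(2))
  fix g :: "real ^ 'd \<Rightarrow> real" assume g: "g \<in> relu_networks n a"
  show "g \<in> borel_measurable borel" by (intro borel_measurable_continuous_onI p(3) g)
  show "x \<in> unit_cube \<Longrightarrow> \<bar>g x\<bar> \<le> 6 * a" for x by (rule p(4)[OF g])
  show "\<forall>i\<in>{1..n}. y i \<in> unit_cube \<Longrightarrow> \<bar>\<Sum>i\<in>{1..n}. e i * g (y i)\<bar> \<le> 6 * a * halfspace_disc y {1..n} e" for y e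
    by (rule p(5)[OF g]) blast
next
  show "(\<lambda>x. s * g x) \<in> relu_networks n (s * a)" if "g \<in> relu_networks n a" "0 \<le> s" for n a s and g :: "real ^ 'd \<Rightarrow> real"
    using that by (rule relu_networks_scale_mono)
  show "(relu_networks n a :: (real ^ 'd \<Rightarrow> real) set) \<subseteq> relu_networks n a'" if "a \<le> a'" for n a a'
    using that by (rule relu_networks_scale_mono)
qed (auto simp: KB_extension_def intro: borel_measurable_fourier relu_approximation)

lemma good_architecture_sigmoid:
  "good_architecture sigmoid_networks (B_extension :: real \<Rightarrow> (real ^ 'd \<Rightarrow> real) \<Rightarrow> bool)"
  unfolding good_architecture_def
proof (intro conjI allI impI ballI)
  fix n :: nat and a :: real assume n: "1 \<le> n" "0 \<le> a"
  note p = sigmoid_networks_props[OF n]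
  show "(\<lambda>_. 0) \<in> (sigmoid_networks n a :: (real ^ 'd \<Rightarrow> real) set)" by (rule p(1))
  show "finite_nets unit_cube (sigmoid_networks n a :: (real ^ 'd \<Rightarrow> real) set)" by (rule p(2))
  fix g :: "real ^ 'd \<Rightarrow> real" assume g: "g \<in> sigmoid_networks n a"
  show "g \<in> borel_measurable borel" by (intro borel_measurable_continuous_onI p(3) g)
  show "x \<in> unit_cube \<Longrightarrow> \<bar>g x\<bar> \<le> 6 * a" for x by (rule p(4)[OF g])
  show "\<forall>i\<in>{1..n}. y i \<in> unit_cube \<Longrightarrow> \<bar>\<Sum>i\<in>{1..n}. e i * g (y i)\<bar> \<le> 6 * a * halfspace_disc y {1..n} e" for y e
    by (rule p(5)[OF g]) blast
next
  show "(\<lambda>x. s * g x) \<in> sigmoid_networks n (s * a)" if "g \<in> sigmoid_networks n a" "0 \<le> s" for n a s and g :: "real ^ 'd \<Rightarrow> real"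
    using that by (rule sigmoid_networks_scale_mono)
  show "(sigmoid_networks n a :: (real ^ 'd \<Rightarrow> real) set) \<subseteq> sigmoid_networks n a'" if "a \<le> a'" for n a a'
    using that by (rule sigmoid_networks_scale_mono)
qed (auto simp: B_extension_def intro: borel_measurable_fourier sigmoid_approximation)

text \<open>Here 20 bounds log-density and networks in units of \<open>a\<close>, 92 is twice the 46
  of \<open>class_approx\<close>, and 48 and 2 are twice the constants of the fluctuation term, from
  \<open>1 + exp (20 * a) \<le> 2 * exp (20 * a)\<close>.\<close>

definition risk_const :: "'d::finite itself \<Rightarrow> real \<Rightarrow> real" where
  "risk_const (_ :: 'd itself) a = exp (20 * a) * (a * (92 + 48 * chaining_const (CARD('d) + 1)) + 2)"

context
  fixes G :: "nat \<Rightarrow> real \<Rightarrow> (real ^ 'd \<Rightarrow> real) set" and ext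
  assumes good: "good_architecture G ext"
begin

lemmas arch_rules =
  good[unfolded good_architecture_def, THEN conjunct1, THEN spec, THEN mp, THEN spec, THEN mp]
  good[unfolded good_architecture_def, THEN conjunct2, THEN conjunct1, THEN spec, THEN spec, THEN spec, THEN spec, THEN mp, THEN mp]
  good[unfolded good_architecture_def, THEN conjunct2, THEN conjunct2, THEN conjunct1, THEN spec, THEN spec, THEN spec, THEN mp]
  good[unfolded good_architecture_def, THEN conjunct2, THEN conjunct2, THEN conjunct2, THEN spec, THEN spec, THEN spec, THEN spec,
    THEN mp, THEN mp, THEN mp, THEN mp, THEN mp]

lemmas arch_network = arch_rules(1)[THEN conjunct2, THEN conjunct2, THEN bspec]

lemma arch_zero: "1 \<le> n \<Longrightarrow> 0 \<le> a \<Longrightarrow> (\<lambda>_. 0) \<in> G n a"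
  and arch_nets: "1 \<le> n \<Longrightarrow> 0 \<le> a \<Longrightarrow> finite_nets unit_cube (G n a)"
  and arch_meas: "1 \<le> n \<Longrightarrow> 0 \<le> a \<Longrightarrow> g \<in> G n a \<Longrightarrow> g \<in> borel_measurable borel"
  and arch_bound: "1 \<le> n \<Longrightarrow> 0 \<le> a \<Longrightarrow> g \<in> G n a \<Longrightarrow> x \<in> unit_cube \<Longrightarrow> \<bar>g x\<bar> \<le> 6 * a"
  and arch_disc: "1 \<le> n \<Longrightarrow> 0 \<le> a \<Longrightarrow> g \<in> G n a \<Longrightarrow> (\<And>i. i \<in> {1..n} \<Longrightarrow> y i \<in> unit_cube) \<Longrightarrow>
      \<bar>\<Sum>i\<in>{1..n}. e i * g (y i)\<bar> \<le> 6 * a * halfspace_disc y {1..n} e"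
  and arch_scale: "g \<in> G n a \<Longrightarrow> 0 \<le> s \<Longrightarrow> (\<lambda>x. s * g x) \<in> G n (s * a)"
  and arch_mono: "a \<le> a' \<Longrightarrow> G n a \<subseteq> G n a'"
proof -
  show "1 \<le> n \<Longrightarrow> 0 \<le> a \<Longrightarrow> (\<lambda>_. 0) \<in> G n a" by (rule arch_rules(1)[THEN conjunct1])
  show "1 \<le> n \<Longrightarrow> 0 \<le> a \<Longrightarrow> finite_nets unit_cube (G n a)" by (rule arch_rules(1)[THEN conjunct2, THEN conjunct1])
  show "1 \<le> n \<Longrightarrow> 0 \<le> a \<Longrightarrow> g \<in> G n a \<Longrightarrow> g \<in> borel_measurable borel" by (rule arch_network[THEN conjunct1])
  show "1 \<le> n \<Longrightarrow> 0 \<le> a \<Longrightarrow> g \<in> G n a \<Longrightarrow> x \<in> unit_cube \<Longrightarrow> \<bar>g x\<bar> \<le> 6 * a"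
    by (rule arch_network[THEN conjunct2, THEN conjunct1, THEN bspec])
  show "1 \<le> n \<Longrightarrow> 0 \<le> a \<Longrightarrow> g \<in> G n a \<Longrightarrow> (\<And>i. i \<in> {1..n} \<Longrightarrow> y i \<in> unit_cube) \<Longrightarrow>
      \<bar>\<Sum>i\<in>{1..n}. e i * g (y i)\<bar> \<le> 6 * a * halfspace_disc y {1..n} e"
    by (rule arch_network[THEN conjunct2, THEN conjunct2, THEN spec, THEN spec, THEN mp]) (assumption | rule ballI)+
  show "g \<in> G n a \<Longrightarrow> 0 \<le> s \<Longrightarrow> (\<lambda>x. s * g x) \<in> G n (s * a)" by (rule arch_rules(2))
  show "a \<le> a' \<Longrightarrow> G n a \<subseteq> G n a'" by (rule arch_rules(3))
qed

lemma arch_approx: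
  assumes "ext c g" "0 \<le> c" "3 \<le> n" "prob_space N" "sets N = sets (restrict_space borel unit_cube)"
  shows "g \<in> borel_measurable borel" "\<exists>\<gamma>\<in>G n c. (\<integral>x. \<bar>\<gamma> x - g x\<bar> \<partial>N) \<le> 4 * c / sqrt n"
  using arch_rules(4)[OF assms] by (rule conjunct1, rule conjunct2)

text \<open>Apply the approximation property to a point mass at \<open>x\<close>.\<close>

lemma ext_bound:
  assumes g: "ext c g" "0 \<le> c" and x: "x \<in> unit_cube"
  shows "\<bar>g x\<bar> \<le> 10 * c"
proof -
  define N where "N = return (restrict_space borel unit_cube) x"
  have xs: "x \<in> space (restrict_space borel unit_cube)" using x by (simp add: space_restrict_space)
  have N: "prob_space N" "sets N = sets (restrict_space borel unit_cube)"
    unfolding N_def using xs by (auto intro: prob_space_return)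
  have 1: "(1 :: nat) \<le> 3" "(3 :: nat) \<le> 3" by auto
  obtain \<gamma> where \<gamma>: "\<gamma> \<in> G 3 c" "(\<integral>x. \<bar>\<gamma> x - g x\<bar> \<partial>N) \<le> 4 * c / sqrt (real 3)"
    using arch_approx(2)[OF g 1(2) N] by blast
  have "(\<lambda>x. \<bar>\<gamma> x - g x\<bar>) \<in> borel_measurable borel"
    using arch_approx(1)[OF g 1(2) N] arch_meas[OF 1(1) g(2) \<gamma>(1)] by measurable
  then have "(\<integral>x. \<bar>\<gamma> x - g x\<bar> \<partial>N) = \<bar>\<gamma> x - g x\<bar>"
    unfolding N_def by (intro integral_return xs measurable_restrict_space1)
  \<comment> \<open>The smallest admissible size 3 is enough; 10 is 4 from the approximation plus 6
    from the network bound.\<close>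
  moreover have "4 * c / sqrt (real 3) \<le> 4 * c / 1"
    using g(2) by (intro divide_left_mono) auto
  ultimately have "\<bar>\<gamma> x - g x\<bar> \<le> 4 * c" using \<gamma>(2) by simp
  moreover have "\<bar>\<gamma> x\<bar> \<le> 6 * c" by (rule arch_bound[OF 1(1) g(2) \<gamma>(1) x])
  ultimately show ?thesis by linarith
qed

text \<open>An extension is taken at a level \<open>c\<close> exceeding \<open>M\<close> by less
  than \<open>M / sqrt n\<close>. If its network overshoots the class, scaling by
  \<open>M / c\<close> brings it back and costs at most \<open>6 * (c - M)\<close>. The constant 46
  is 40 from \<open>20 * c\<close> with \<open>c \<le> 2 * M\<close>, plus this 6.\<close>

lemma class_approx:
  assumes M: "0 < M" and c: "\<And>e. 0 < e \<Longrightarrow> \<exists>c g. 0 \<le> c \<and> c < M + e \<and> ext c g \<and> (\<forall>x\<in>unit_cube. g x = f x)"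
    and N: "prob_space N" "sets N = sets (restrict_space borel unit_cube)" and n: "1 \<le> n"
  shows "\<exists>\<gamma>\<in>G n M. (\<integral>x. \<bar>\<gamma> x - f x\<bar> \<partial>N) \<le> 46 * M / sqrt n"
proof -
  interpret N: prob_space N by fact
  have spN: "space N = unit_cube" using sets_eq_imp_space_eq[OF N(2)] by (simp add: space_restrict_space)
  have n0: "0 < sqrt n" "1 \<le> sqrt n" using n by auto
  obtain c g where g: "0 \<le> c" "c < M + M / sqrt n" "ext c g" "\<And>x. x \<in> unit_cube \<Longrightarrow> g x = f x"
    using assms(2)[of "M / sqrt n"] M n0 by auto
  have "M / sqrt n \<le> M / 1" using M n0 by (intro divide_left_mono) auto
  then have c2: "c \<le> 2 * M" using g(2) by simp
  have 3: "(3 :: nat) \<le> 3" by simp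
  have gm [measurable]: "g \<in> borel_measurable borel" by (rule arch_approx(1)[OF g(3,1) 3 N])
  have toN: "h \<in> borel_measurable N" if "h \<in> borel_measurable borel" for h :: "real ^ 'd \<Rightarrow> real"
    using that by (simp add: measurable_cong_sets[OF N(2) refl] measurable_restrict_space1)
  have "\<exists>\<gamma>\<in>G n c. (\<integral>x. \<bar>\<gamma> x - g x\<bar> \<partial>N) \<le> 20 * c / sqrt n"
  proof (cases "3 \<le> n")
    case True
    have "4 * c / sqrt n \<le> 20 * c / sqrt n" using g(1) n0 by (intro divide_right_mono) auto
    then show ?thesis using arch_approx(2)[OF g(3,1) True N] by force
  next
    case False
    \<comment> \<open>For \<open>n < 3\<close> the zero network suffices, since
      \<open>ext_bound\<close> bounds \<open>g\<close> by \<open>10 * c\<close> and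
      \<open>sqrt n \<le> 2\<close>.\<close>
    have "sqrt n \<le> sqrt 4" using False by (intro real_sqrt_le_mono) auto
    then have "10 * c * sqrt n \<le> 10 * c * 2" using g(1) by (intro mult_left_mono) auto
    then have "10 * c \<le> 20 * c / sqrt n" using n0 by (simp add: field_simps)
    moreover have "(\<integral>x. \<bar>0 - g x\<bar> \<partial>N) \<le> 10 * c"
      using ext_bound[OF g(3,1)] toN[OF gm]
      by (intro N.integral_le_bound N.integrable_bounded[of _ "10 * c"]) (auto simp: spN)
    ultimately show ?thesis using arch_zero[OF n g(1)] by (intro bexI[of _ "\<lambda>_. 0"]) auto
  qed
  then obtain \<gamma> where \<gamma>: "\<gamma> \<in> G n c" "(\<integral>x. \<bar>\<gamma> x - g x\<bar> \<partial>N) \<le> 20 * c / sqrt n" by blast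
  have "20 * c / sqrt n \<le> 20 * (2 * M) / sqrt n" using c2 n0 by (intro divide_right_mono) auto
  with \<gamma>(2) have \<gamma>2: "(\<integral>x. \<bar>\<gamma> x - g x\<bar> \<partial>N) \<le> 40 * M / sqrt n" by simp
  have \<gamma>m [measurable]: "\<gamma> \<in> borel_measurable borel" by (rule arch_meas[OF n g(1) \<gamma>(1)])
  have ci: "integrable N (\<lambda>x. \<bar>\<gamma> x - g x\<bar>)"
  proof (rule N.integrable_bounded[of _ "16 * c"])
    show "(\<lambda>x. \<bar>\<gamma> x - g x\<bar>) \<in> borel_measurable N" by (rule toN) measurable
    fix x assume "x \<in> space N"
    then show "\<bar>\<bar>\<gamma> x - g x\<bar>\<bar> \<le> 16 * c"
      using ext_bound[OF g(3,1), of x] arch_bound[OF n g(1) \<gamma>(1), of x] spN by simp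
  qed
  have feq: "(\<integral>x. \<bar>h x - f x\<bar> \<partial>N) = (\<integral>x. \<bar>h x - g x\<bar> \<partial>N)" for h
    using g(4) spN by (intro Bochner_Integration.integral_cong) auto
  show ?thesis
  proof (cases "c \<le> M")
    case True
    have "40 * M / sqrt n \<le> 46 * M / sqrt n" using M n0 by (intro divide_right_mono) auto
    then show ?thesis using \<gamma> \<gamma>2 arch_mono[OF True] unfolding feq by (intro bexI[of _ \<gamma>]) auto
  next
    case False
    define s where "s = M / c"
    have s: "0 \<le> s" "s \<le> 1" "s * c = M" using False M by (auto simp: s_def)
    have "(\<lambda>x. s * \<gamma> x) \<in> G n M" using arch_scale[OF \<gamma>(1) s(1)] by (simp add: s(3))
    moreover have "(\<integral>x. \<bar>s * \<gamma> x - g x\<bar> \<partial>N) \<le> 46 * M / sqrt n"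
    proof -
      have "(\<integral>x. \<bar>s * \<gamma> x - g x\<bar> \<partial>N) \<le> (\<integral>x. \<bar>\<gamma> x - g x\<bar> + 6 * (M / sqrt n) \<partial>N)"
      proof (rule integral_mono')
        fix x assume x: "x \<in> space N"
        have "\<bar>(1 - s) * \<gamma> x\<bar> \<le> (1 - s) * (6 * c)"
          unfolding abs_mult using s arch_bound[OF n g(1) \<gamma>(1), of x] x spN by (intro mult_mono) auto
        also have "\<dots> = 6 * (c - M)" using s(3) by (simp add: algebra_simps)
        also have "\<dots> \<le> 6 * (M / sqrt n)" using g(2) by simp
        finally have "\<bar>(1 - s) * \<gamma> x\<bar> \<le> 6 * (M / sqrt n)" .
        moreover have "s * \<gamma> x - g x = (\<gamma> x - g x) - (1 - s) * \<gamma> x" by (simp add: algebra_simps)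
        ultimately show "\<bar>s * \<gamma> x - g x\<bar> \<le> \<bar>\<gamma> x - g x\<bar> + 6 * (M / sqrt n)" by linarith
      qed (use ci M in auto)
      also have "\<dots> = (\<integral>x. \<bar>\<gamma> x - g x\<bar> \<partial>N) + 6 * (M / sqrt n)" using ci by (simp add: N.prob_space)
      also have "\<dots> \<le> 40 * M / sqrt n + 6 * (M / sqrt n)" using \<gamma>2 by simp
      also have "\<dots> = 46 * M / sqrt n" by (simp add: add_divide_distrib[symmetric])
      finally show ?thesis .
    qed
    ultimately show ?thesis unfolding feq by (intro bexI)
  qed
qed

text \<open>The scale \<open>a\<close> of the networks is separate from the radius \<open>M\<close>
  of the class: approximation happens at level \<open>M\<close> inside the larger network class,
  while bounds and fluctuations are measured at \<open>a\<close>. This serves both the known-radius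
  estimator and the adaptive one.\<close>

theorem class_sup_risk_le:
  assumes M: "0 < M" "M \<le> a" and n: "1 \<le> n"
    and Q: "\<And>\<mu> \<nu>. (\<mu>, \<nu>) \<in> Q \<Longrightarrow> (\<mu>, \<nu>) \<in> P2_KL unit_cube \<and> (\<exists>f. log_density_version \<mu> \<nu> f \<and>
      (\<forall>e>0. \<exists>c g. 0 \<le> c \<and> c < M + e \<and> ext c g \<and> (\<forall>x\<in>unit_cube. g x = f x)))"
  shows "sup_risk n (neural_estimator (G n a) n) Q \<le> ennreal (risk_const TYPE('d) a * real n powr (-1/2))"
  unfolding sup_risk_def
proof (rule SUP_least, clarify)
  fix \<mu> \<nu> assume "(\<mu>, \<nu>) \<in> Q"
  from Q[OF this] obtain f where P: "(\<mu>, \<nu>) \<in> P2_KL unit_cube" and f: "log_density_version \<mu> \<nu> f"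
    and c: "\<And>e. 0 < e \<Longrightarrow> \<exists>c g. 0 \<le> c \<and> c < M + e \<and> ext c g \<and> (\<forall>x\<in>unit_cube. g x = f x)" by blast
  have \<mu>\<nu>: "borel_prob_on unit_cube \<mu>" "borel_prob_on unit_cube \<nu>" "absolutely_continuous \<nu> \<mu>"
    using P by (auto simp: P2_KL_def)
  then have N: "prob_space \<nu>" "sets \<nu> = sets (restrict_space borel unit_cube)" by (auto simp: borel_prob_on_def)
  have a: "0 \<le> a" using M by simp
  have fB: "\<bar>f x\<bar> \<le> 20 * a" if x: "x \<in> unit_cube" for x
  proof -
    \<comment> \<open>Slack \<open>M\<close> gives a level below \<open>2 * M\<close>, and with
      \<open>ext_bound\<close> the factor 20.\<close>
    obtain c' g where g: "0 \<le> c'" "c' < M + M" "ext c' g" "\<And>x. x \<in> unit_cube \<Longrightarrow> g x = f x" using c[OF M(1)] by blast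
    have "\<bar>g x\<bar> \<le> 10 * c'" by (rule ext_bound[OF g(3,1) x])
    then show ?thesis using g(2) g(4)[OF x] M by simp
  qed
  obtain \<gamma> where \<gamma>: "\<gamma> \<in> G n M" "(\<integral>x. \<bar>\<gamma> x - f x\<bar> \<partial>\<nu>) \<le> 46 * M / sqrt n"
    using class_approx[OF M(1) c N n] by blast
  have \<gamma>a: "\<gamma> \<in> G n a" using \<gamma>(1) arch_mono[OF M(2)] by blast
  define C where "C = chaining_const (DIM(real ^ 'd) + 1)"
  have C0: "0 \<le> C" unfolding C_def by (rule chaining_const_nonneg)
  have "risk n (neural_estimator (G n a) n) \<mu> \<nu> \<le>
      ennreal (2 * exp (20 * a) * (46 * M / sqrt n) + (1 + exp (20 * a)) * (4 * (6 * a) * C + 1) / sqrt n)"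
    unfolding C_def
  proof (rule neural_estimator_risk_le[OF \<mu>\<nu> f fB arch_zero[OF n a] arch_meas[OF n a] _ arch_nets[OF n a] arch_disc[OF n a] n _ \<gamma>a \<gamma>(2)])
    show "\<bar>g x\<bar> \<le> 20 * a" if "g \<in> G n a" "x \<in> unit_cube" for g x
      using arch_bound[OF n a that] a by linarith
  qed (use a in auto)
  also have "\<dots> \<le> ennreal (risk_const TYPE('d) a * real n powr (-1/2))"
  proof (rule ennreal_leI)
    have "2 * exp (20 * a) * (46 * M) + (1 + exp (20 * a)) * (4 * (6 * a) * C + 1) \<le>
        2 * exp (20 * a) * (46 * a) + (2 * exp (20 * a)) * (4 * (6 * a) * C + 1)"
      using M a C0 by (intro add_mono mult_left_mono mult_right_mono) auto
    also have "\<dots> = risk_const TYPE('d) a" by (simp add: risk_const_def C_def algebra_simps)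
    finally have "(2 * exp (20 * a) * (46 * M) + (1 + exp (20 * a)) * (4 * (6 * a) * C + 1)) / sqrt n \<le> risk_const TYPE('d) a / sqrt n"
      by (intro divide_right_mono) auto
    then show "2 * exp (20 * a) * (46 * M / sqrt n) + (1 + exp (20 * a)) * (4 * (6 * a) * C + 1) / sqrt n \<le> risk_const TYPE('d) a * real n powr (-1/2)"
      unfolding powr_neg_half by (simp add: add_divide_distrib)
  qed
  finally show "risk n (neural_estimator (G n a) n) \<mu> \<nu> \<le> ennreal (risk_const TYPE('d) a * real n powr (-1/2))" .
qed

end


text \<open>At scale \<open>ln (ln n)\<close> the factor \<open>exp (20 * a)\<close> is the 20th
  power of \<open>ln n\<close>; the factor affine in \<open>a\<close> costs one more power.\<close>

lemma risk_const_log_log: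
  "\<exists>p K. 0 < K \<and> (\<forall>\<^sub>F n in sequentially. max (ln (ln (real n))) 1 \<ge> M \<and>
    risk_const TYPE('d::finite) (max (ln (ln (real n))) 1) \<le> K * ln (real n) ^ p)"
proof (intro exI conjI)
  define C where "C = 92 + 48 * chaining_const (CARD('d) + 1)"
  have C: "92 \<le> C" unfolding C_def using chaining_const_nonneg by simp
  show "0 < C + 2" using C by simp
  have "filterlim (\<lambda>n. ln (ln (real n))) at_top sequentially" by real_asymp
  then have "\<forall>\<^sub>F n in sequentially. max M 1 \<le> ln (ln (real n))" unfolding filterlim_at_top by (rule spec)
  moreover have "\<forall>\<^sub>F n in sequentially. 1 \<le> ln (real n)" by real_asymp
  ultimately show "\<forall>\<^sub>F n in sequentially. max (ln (ln (real n))) 1 \<ge> M \<and>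
    risk_const TYPE('d) (max (ln (ln (real n))) 1) \<le> (C + 2) * ln (real n) ^ 21"
  proof eventually_elim
    case (elim n)
    define L where "L = ln (real n)"
    have L: "1 \<le> L" "max (ln L) 1 = ln L" "M \<le> ln L" using elim by (auto simp: L_def)
    have "exp (20 * ln L) = L ^ 20" using L exp_of_nat_mult[of 20 "ln L"] by simp
    moreover have "ln L \<le> L" using ln_le_minus_one[of L] L by simp
    then have "ln L * C + 2 \<le> L * C + L * 2" using C L by (intro add_mono mult_right_mono) auto
    then have "L ^ 20 * (ln L * C + 2) \<le> L ^ 20 * (L * C + L * 2)" using L by (intro mult_left_mono) auto
    moreover have "L ^ 20 * (L * C + L * 2) = (C + 2) * L ^ 21" by (simp add: algebra_simps power_Suc[symmetric] del: power_Suc)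
    ultimately show ?case using L unfolding L_def[symmetric] risk_const_def C_def[symmetric] by simp
  qed
qed

theorem corollary18:
  fixes M :: real
    and X :: "(real ^ 'd) set"
    and Q :: "((real ^ 'd) measure \<times> (real ^ 'd) measure) set"
    and G :: "nat \<Rightarrow> real \<Rightarrow> (real ^ 'd \<Rightarrow> real) set"
    and m :: "nat \<Rightarrow> real"
  assumes "X = {x. \<forall>i. 0 \<le> x $ i \<and> x $ i \<le> 1}"
    and "M > 0"
    and "(Q, G) = (P2_KL_KB M X, relu_networks) \<or> (Q, G) = (P2_KL_B M X, sigmoid_networks)"
    and "\<And>n. m n = max (ln (ln (real n))) 1"
  shows "(\<exists>c C. 0 < c \<and> c \<le> C \<and>
            (\<forall>n\<ge>1. sup_risk n (neural_estimator (G n M) n) Q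
                      \<le> ennreal (C * real n powr (-1/2))) \<and>
            (\<forall>\<^sub>F n in sequentially.
               (INF T\<in>estimators n X. sup_risk n T Q) \<ge> ennreal (c * real n powr (-1/2))))
       \<and> (\<exists>p K. 0 < K \<and>
            (\<forall>\<^sub>F n in sequentially.
               sup_risk n (neural_estimator (G n (m n)) n) Q
                 \<le> ennreal (K * ln (real n) ^ p * real n powr (-1/2))))"
proof -
  \<comment> \<open>Both cases are brought into one form, so the rest of the proof does not
    distinguish them.\<close>
  have ub: "\<exists>ext. good_architecture G ext \<and> (\<forall>\<mu> \<nu>. (\<mu>, \<nu>) \<in> Q \<longrightarrow> (\<mu>, \<nu>) \<in> P2_KL unit_cube \<and> (\<exists>f. log_density_version \<mu> \<nu> f \<and>
      (\<forall>e>0. \<exists>c g. 0 \<le> c \<and> c < M + e \<and> ext c g \<and> (\<forall>x\<in>unit_cube. g x = f x))))"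
    using assms(3)
  proof
    assume "(Q, G) = (P2_KL_KB M X, relu_networks)"
    then have QG: "Q = P2_KL_KB M unit_cube" "G = relu_networks" by (auto simp: assms(1))
    show ?thesis
      unfolding QG
    proof (rule exI, rule conjI[OF good_architecture_relu], intro allI impI)
      fix \<mu> \<nu> :: "(real ^ 'd) measure" assume "(\<mu>, \<nu>) \<in> P2_KL_KB M unit_cube"
      then obtain f where P: "(\<mu>, \<nu>) \<in> P2_KL unit_cube" and f: "log_density_version \<mu> \<nu> f" "c_KB f unit_cube \<le> ereal M"
        by (auto simp: P2_KL_KB_def)
      have main: "\<exists>c g. 0 \<le> c \<and> c < M + e \<and> KB_extension c g \<and> (\<forall>x\<in>unit_cube. g x = f x)"
        if "0 < e" for e
      proof -
        have "c_KB f unit_cube < ereal (M + e)" using that by (intro le_less_trans[OF f(2)]) simp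
        then obtain c g F D where "c < M + e" "0 \<le> c" "fourier_representation g F" "\<forall>x\<in>unit_cube. g x = f x"
          "sup_norm_set (unit_cube :: (real ^ 'd) set) * spectral_moment 2 F \<le> ennreal c" "\<bar>g 0\<bar> \<le> c"
          "GDERIV g 0 :> D" "norm1 D \<le> c"
          unfolding c_KB_def Inf_less_iff by (elim bexE CollectE exE conjE) (rule that, simp_all only: less_ereal.simps)
        then show ?thesis
          unfolding KB_extension_def by (intro exI[of _ c] exI[of _ g] conjI exI[of _ F] exI[of _ D])
      qed
      show "(\<mu>, \<nu>) \<in> P2_KL unit_cube \<and> (\<exists>f. log_density_version \<mu> \<nu> f \<and> (\<forall>e>0. \<exists>c g. 0 \<le> c \<and> c < M + e \<and> KB_extension c g \<and> (\<forall>x\<in>unit_cube. g x = f x)))"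
        by (intro conjI P exI[of _ f] f(1) allI impI main)
    qed
  next
    assume "(Q, G) = (P2_KL_B M X, sigmoid_networks)"
    then have QG: "Q = P2_KL_B M unit_cube" "G = sigmoid_networks" by (auto simp: assms(1))
    show ?thesis
      unfolding QG
    proof (rule exI, rule conjI[OF good_architecture_sigmoid], intro allI impI)
      fix \<mu> \<nu> :: "(real ^ 'd) measure" assume "(\<mu>, \<nu>) \<in> P2_KL_B M unit_cube"
      then obtain f where P: "(\<mu>, \<nu>) \<in> P2_KL unit_cube" and f: "log_density_version \<mu> \<nu> f" "c_B f unit_cube \<le> ereal M"
        by (auto simp: P2_KL_B_def)
      have main: "\<exists>c g. 0 \<le> c \<and> c < M + e \<and> B_extension c g \<and> (\<forall>x\<in>unit_cube. g x = f x)"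
        if "0 < e" for e
      proof -
        have "c_B f unit_cube < ereal (M + e)" using that by (intro le_less_trans[OF f(2)]) simp
        then obtain c g F where "c < M + e" "0 \<le> c" "fourier_representation g F" "\<forall>x\<in>unit_cube. g x = f x"
          "sup_norm_set (unit_cube :: (real ^ 'd) set) * spectral_moment 1 F \<le> ennreal c" "\<bar>g 0\<bar> \<le> c"
          unfolding c_B_def Inf_less_iff by (elim bexE CollectE exE conjE) (rule that, simp_all only: less_ereal.simps)
        then show ?thesis
          unfolding B_extension_def by (intro exI[of _ c] exI[of _ g] conjI exI[of _ F])
      qed
      show "(\<mu>, \<nu>) \<in> P2_KL unit_cube \<and> (\<exists>f. log_density_version \<mu> \<nu> f \<and> (\<forall>e>0. \<exists>c g. 0 \<le> c \<and> c < M + e \<and> B_extension c g \<and> (\<forall>x\<in>unit_cube. g x = f x)))"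
        by (intro conjI P exI[of _ f] f(1) allI impI main)
    qed
  qed
  then obtain ext where good: "good_architecture G ext" and cls: "\<And>\<mu> \<nu>. (\<mu>, \<nu>) \<in> Q \<Longrightarrow> (\<mu>, \<nu>) \<in> P2_KL unit_cube \<and> (\<exists>f. log_density_version \<mu> \<nu> f \<and>
      (\<forall>e>0. \<exists>c g. 0 \<le> c \<and> c < M + e \<and> ext c g \<and> (\<forall>x\<in>unit_cube. g x = f x)))"
    by blast
  note upper = class_sup_risk_le[OF good assms(2) _ _ cls]
  have "P2_KL_KB M unit_cube \<subseteq> Q \<or> P2_KL_B M unit_cube \<subseteq> Q" using assms(1,3) by auto
  from minimax_lower_bound[OF assms(2) this] obtain c where c: "0 < c"
    "\<forall>\<^sub>F n in sequentially. ennreal (c * real n powr (-1/2)) \<le> (INF T\<in>estimators n X. sup_risk n T Q)"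
    unfolding assms(1) by auto
  \<comment> \<open>The maximum only secures \<open>c \<le> C\<close>.\<close>
  define C where "C = max c (risk_const TYPE('d) M)"
  have "\<forall>n\<ge>1. sup_risk n (neural_estimator (G n M) n) Q \<le> ennreal (C * real n powr (-1/2))"
  proof (intro allI impI)
    fix n :: nat assume n: "1 \<le> n"
    have "risk_const TYPE('d) M * real n powr (-1/2) \<le> C * real n powr (-1/2)"
      by (intro mult_right_mono) (auto simp: C_def)
    then show "sup_risk n (neural_estimator (G n M) n) Q \<le> ennreal (C * real n powr (-1/2))"
      by (intro order_trans[OF upper[OF order_refl n]] ennreal_leI)
  qed
  then have part1: "\<exists>c C. 0 < c \<and> c \<le> C \<and>
      (\<forall>n\<ge>1. sup_risk n (neural_estimator (G n M) n) Q \<le> ennreal (C * real n powr (-1/2))) \<and>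
      (\<forall>\<^sub>F n in sequentially. (INF T\<in>estimators n X. sup_risk n T Q) \<ge> ennreal (c * real n powr (-1/2)))"
    using c by (intro exI[of _ c] exI[of _ C]) (auto simp: C_def)
  obtain p K where K: "0 < K" "\<forall>\<^sub>F n in sequentially. max (ln (ln (real n))) 1 \<ge> M \<and>
      risk_const TYPE('d) (max (ln (ln (real n))) 1) \<le> K * ln (real n) ^ p"
    using risk_const_log_log[where 'd = 'd and M = M] by blast
  \<comment> \<open>Since \<open>m n\<close> tends to infinity, eventually it exceeds the unknown
    \<open>M\<close>, and from then on the upper bound applies at scale \<open>m n\<close>.\<close>
  have "\<forall>\<^sub>F n in sequentially. sup_risk n (neural_estimator (G n (m n)) n) Q
      \<le> ennreal (K * ln (real n) ^ p * real n powr (-1/2))"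
    using K(2) eventually_ge_at_top[of 1]
  proof eventually_elim
    case (elim n)
    have "risk_const TYPE('d) (m n) * real n powr (-1/2) \<le> K * ln (real n) ^ p * real n powr (-1/2)"
      using elim by (intro mult_right_mono) (auto simp: assms(4))
    moreover have "M \<le> m n" using elim by (simp add: assms(4))
    ultimately show ?case
      by (intro order_trans[OF upper[OF _ elim(2)]] ennreal_leI)
  qed
  with K(1) part1 show ?thesis by blast
qed

end
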